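(* Let $(X^4,g)$ be a conformally compact Einstein manifold of dimension $4$ (so $n=3$) with boundary $M^3$, let $\hat g$ be a metric in the conformal infinity $[\hat g]$ with associated special defining function $x$, and let $v$ be the function with $-\Delta_g v=3$ in $X$ and $v=\log x+A+Bx^3$ near $M$, where $A,B$ are even in $x$ and $A|_{x=0}=0$. Then the boundary curvature $T$ of the compactified manifold $(X^4,e^{2v}g)$ satisfies $$T_{e^{2v}g}=3B|_{x=0}=(Q_3)_{(g,\hat g)}\quad\text{on } M.$$
   Context: Conformally compact Einstein manifold: $X^{n+1}$ is (the interior of) a compact smooth manifold with smooth boundary $\partial X=M^n$. A defining function $x$ for $M$ satisfies $x>0$ in $X$, $x=0$ on $M$, $dx\ne0$ on $M$. A metric $g$ on $X$ is conformally compact if $x^2g$ extends to a Riemannian metric on the compact manifold with boundary; the restrictions of $x^2g$ to $M$ form a conformal class $[\hat g]$, the conformal infinity. If also $\mathrm{Ric}_g=-ng$, then $(X,g)$ is a conformally compact Einstein manifold. Each $\hat g\in[\hat g]$ determines a unique (special) defining function $x$ near $M$ and an identification of a neighborhood of $M$ with $M\times[0,\epsilon)$ such that $g=x^{-2}(dx^2+g_x)$ with $g_0=\hat g$. The function $v$ ($n$ odd): $\Delta$ is the Laplacian with nonpositive spectrum. The function $v$ is the solution of $-\Delta_g v=n$ in $X^{n+1}$ with $v=\log x+A+Bx^n$ near $M$, where $A,B$ are smooth up to $M$, even in $x$ (only even powers in their Taylor expansions at $x=0$), and $A|_{x=0}=0$. Fefferman and Graham define $$(Q_n)_{(g,\hat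 g)}=k_nB|_{x=0},\qquad k_n=2^n\frac{\Gamma(n/2)}{\Gamma(-n/2)}.$$ Boundary curvature $T$: on a compact Riemannian $4$-manifold with boundary, $$T=\frac1{12}\frac{\partial R}{\partial n}+\frac16RH-R_{\alpha N\beta N}L_{\alpha\beta}+\frac19H^3-\frac13\mathrm{Tr}L^3-\frac13\tilde\Delta H,$$ where $\frac{\partial}{\partial n}$ is the outer normal derivative, $N$ the unit normal, $\alpha,\beta$ are tangential orthonormal indices, $\tilde\Delta$ is the Laplacian of the boundary metric, $L$ is the second fundamental form of the boundary, $H=\mathrm{Tr}L$, and $R$ is the scalar curvature (curvature sign convention: $R_{\alpha N\alpha N}=\mathrm{Ric}(N,N)$). *)

theory Defs
  imports "HOL-Analysis.Analysis"
begin

section \<open>Calculus on a model space\<close>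

text \<open>
  Charts of an (n+1)-dimensional manifold with boundary take values in the half-space
  \<open>y $ None \<ge> 0\<close> of \<open>real ^ 'm option\<close>, where n = CARD('m): the index \<open>None\<close> is the
  coordinate transverse to the boundary and the indices \<open>Some \<alpha>\<close> are the tangential ones.
  Charts of a boundaryless n-manifold take values in \<open>real ^ 'm\<close>. The set \<open>D\<close> below is the
  model space (the half-space or \<open>UNIV\<close>); all derivatives are taken within \<open>D\<close>, hence are
  the ordinary ones at interior points and one-sided ones at the boundary of the half-space.
\<close>

definition halfspace :: "(real ^ ('m::finite option)) set" where
  "halfspace = {y. 0 \<le> y $ None}"

definition pd :: "(real ^ 'i) set \<Rightarrow> 'i \<Rightarrow> (real ^ 'i \<Rightarrow> 'b) \<Rightarrow> (real ^ 'i \<Rightarrow> 'b::real_normed_vector)"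
  where "pd D i f y = frechet_derivative f (at y within D) (axis i 1)"

primrec Ck_on :: "(real ^ 'i) set \<Rightarrow> (real ^ 'i) set \<Rightarrow> nat \<Rightarrow> (real ^ 'i \<Rightarrow> 'b::real_normed_vector) \<Rightarrow> bool"
  where
    "Ck_on D S 0 f \<longleftrightarrow> continuous_on S f"
  | "Ck_on D S (Suc k) f \<longleftrightarrow>
       (\<forall>y\<in>S. f differentiable (at y within D)) \<and> (\<forall>i. Ck_on D S k (pd D i f))"

text \<open>Only used for \<open>S\<close> relatively open in \<open>D\<close>; it means smoothness up to the part of the
  boundary of \<open>D\<close> that lies in \<open>S\<close>.\<close>

definition smooth_on :: "(real ^ 'i) set \<Rightarrow> (real ^ 'i) set \<Rightarrow> (real ^ 'i \<Rightarrow> 'b::real_normed_vector) \<Rightarrow> bool"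
  where "smooth_on D S f \<longleftrightarrow> (\<forall>k. Ck_on D S k f)"

section \<open>Riemannian geometry in local coordinates\<close>

text \<open>Here \<open>\<gamma> y $ i $ j\<close> are the components of a metric in coordinates \<open>y\<close>.\<close>

definition christoffel ::
  "(real ^ 'i) set \<Rightarrow> (real ^ 'i \<Rightarrow> real ^ 'i ^ 'i) \<Rightarrow> 'i \<Rightarrow> 'i \<Rightarrow> 'i \<Rightarrow> real ^ 'i \<Rightarrow> real" where
  "christoffel D \<gamma> k i j y =
     (1/2) * (\<Sum>l\<in>UNIV. matrix_inv (\<gamma> y) $ k $ l *
        (pd D i (\<lambda>z. \<gamma> z $ j $ l) y + pd D j (\<lambda>z. \<gamma> z $ i $ l) y - pd D l (\<lambda>z. \<gamma> z $ i $ j) y))"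

text \<open>\<open>riemann D \<gamma> l k i j\<close> is the component \<open>l\<close> of
  \<open>R(\<partial>i,\<partial>j)\<partial>k = \<nabla>i \<nabla>j \<partial>k - \<nabla>j \<nabla>i \<partial>k\<close>.\<close>

definition riemann ::
  "(real ^ 'i) set \<Rightarrow> (real ^ 'i \<Rightarrow> real ^ 'i ^ 'i) \<Rightarrow> 'i \<Rightarrow> 'i \<Rightarrow> 'i \<Rightarrow> 'i \<Rightarrow> real ^ 'i \<Rightarrow> real" where
  "riemann D \<gamma> l k i j y =
     pd D i (christoffel D \<gamma> l j k) y - pd D j (christoffel D \<gamma> l i k) y
     + (\<Sum>m\<in>UNIV. christoffel D \<gamma> l i m y * christoffel D \<gamma> m j k y
                   - christoffel D \<gamma> l j m y * christoffel D \<gamma> m i k y)"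

text \<open>Sign convention for the lowered tensor: \<open>R\<^sub>i\<^sub>j\<^sub>k\<^sub>l = \<gamma>(R(\<partial>i,\<partial>j)\<partial>l, \<partial>k)\<close>, so that the trace
  of \<open>R\<^sub>i\<^sub>j\<^sub>k\<^sub>l\<close> over \<open>i, k\<close> is the Ricci tensor (positive on round spheres).\<close>

definition riemann_low ::
  "(real ^ 'i) set \<Rightarrow> (real ^ 'i \<Rightarrow> real ^ 'i ^ 'i) \<Rightarrow> 'i \<Rightarrow> 'i \<Rightarrow> 'i \<Rightarrow> 'i \<Rightarrow> real ^ 'i \<Rightarrow> real" where
  "riemann_low D \<gamma> i j k l y = (\<Sum>m\<in>UNIV. \<gamma> y $ k $ m * riemann D \<gamma> m l i j y)"

definition ricci ::
  "(real ^ 'i) set \<Rightarrow> (real ^ 'i \<Rightarrow> real ^ 'i ^ 'i) \<Rightarrow> 'i \<Rightarrow> 'i \<Rightarrow> real ^ 'i \<Rightarrow> real" where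
  "ricci D \<gamma> j k y = (\<Sum>i\<in>UNIV. riemann D \<gamma> i k i j y)"

definition scalar_curv ::
  "(real ^ 'i) set \<Rightarrow> (real ^ 'i \<Rightarrow> real ^ 'i ^ 'i) \<Rightarrow> real ^ 'i \<Rightarrow> real" where
  "scalar_curv D \<gamma> y = (\<Sum>j\<in>UNIV. \<Sum>k\<in>UNIV. matrix_inv (\<gamma> y) $ j $ k * ricci D \<gamma> j k y)"

definition laplacian ::
  "(real ^ 'i) set \<Rightarrow> (real ^ 'i \<Rightarrow> real ^ 'i ^ 'i) \<Rightarrow> (real ^ 'i \<Rightarrow> real) \<Rightarrow> real ^ 'i \<Rightarrow> real" where
  "laplacian D \<gamma> f y = (\<Sum>i\<in>UNIV. \<Sum>j\<in>UNIV. matrix_inv (\<gamma> y) $ i $ j *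
      (pd D i (pd D j f) y - (\<Sum>k\<in>UNIV. christoffel D \<gamma> k i j y * pd D k f y)))"

section \<open>Boundary geometry in local coordinates\<close>

definition bemb :: "real ^ 'm \<Rightarrow> real ^ ('m::finite option)" where
  "bemb z = (\<chi> i. case i of None \<Rightarrow> 0 | Some \<alpha> \<Rightarrow> z $ \<alpha>)"

definition bcoord :: "real ^ ('m::finite option) \<Rightarrow> real ^ 'm" where
  "bcoord y = (\<chi> \<alpha>. y $ Some \<alpha>)"

definition tang :: "real ^ ('m::finite option) ^ ('m option) \<Rightarrow> real ^ 'm ^ 'm" where
  "tang G = (\<chi> \<alpha> \<beta>. G $ Some \<alpha> $ Some \<beta>)"

text \<open>The outer unit normal: the coordinate vector obtained by raising the index of the outward
  conormal \<open>- dy\<^sub>N\<^sub>o\<^sub>n\<^sub>e\<close> and normalizing.\<close>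

definition outer_normal ::
  "(real ^ ('m::finite option) \<Rightarrow> real ^ ('m option) ^ ('m option))
    \<Rightarrow> real ^ ('m option) \<Rightarrow> real ^ ('m option)" where
  "outer_normal \<gamma> y =
     (\<chi> i. - matrix_inv (\<gamma> y) $ i $ None / sqrt (matrix_inv (\<gamma> y) $ None $ None))"

text \<open>\<open>L\<^sub>\<alpha>\<^sub>\<beta> = \<gamma>(\<nabla>\<^sub>\<alpha> \<nu>, \<partial>\<^sub>\<beta>) = - \<gamma>(\<nu>, \<nabla>\<^sub>\<alpha> \<partial>\<^sub>\<beta>)\<close> with \<open>\<nu>\<close> the outer unit normal; this is positive on the
  boundary of a Euclidean ball, the sign for which the boundary curvature \<open>T\<close> below is the
  transgression term in the Gauss-Bonnet-Chern formula.\<close>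

definition second_ff ::
  "(real ^ ('m::finite option) \<Rightarrow> real ^ ('m option) ^ ('m option)) \<Rightarrow> real ^ 'm \<Rightarrow> real ^ 'm ^ 'm" where
  "second_ff \<gamma> z = (\<chi> \<alpha> \<beta>. - (\<Sum>k\<in>UNIV. \<Sum>l\<in>UNIV.
      \<gamma> (bemb z) $ k $ l * outer_normal \<gamma> (bemb z) $ k
        * christoffel halfspace \<gamma> l (Some \<alpha>) (Some \<beta>) (bemb z)))"

definition bmetric ::
  "(real ^ ('m::finite option) \<Rightarrow> real ^ ('m option) ^ ('m option)) \<Rightarrow> real ^ 'm \<Rightarrow> real ^ 'm ^ 'm" where
  "bmetric \<gamma> z = tang (\<gamma> (bemb z))"

definition shape_op ::
  "(real ^ ('m::finite option) \<Rightarrow> real ^ ('m option) ^ ('m option)) \<Rightarrow> real ^ 'm \<Rightarrow> real ^ 'm ^ 'm" where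
  "shape_op \<gamma> z = matrix_inv (bmetric \<gamma> z) ** second_ff \<gamma> z"

definition mean_curv ::
  "(real ^ ('m::finite option) \<Rightarrow> real ^ ('m option) ^ ('m option)) \<Rightarrow> real ^ 'm \<Rightarrow> real" where
  "mean_curv \<gamma> z = trace (shape_op \<gamma> z)"

text \<open>The tensor \<open>R\<^sub>\<alpha>\<^sub>N\<^sub>\<beta>\<^sub>N\<close> on the boundary.\<close>

definition normal_riemann ::
  "(real ^ ('m::finite option) \<Rightarrow> real ^ ('m option) ^ ('m option)) \<Rightarrow> real ^ 'm \<Rightarrow> real ^ 'm ^ 'm" where
  "normal_riemann \<gamma> z = (\<chi> \<alpha> \<beta>. \<Sum>j\<in>UNIV. \<Sum>l\<in>UNIV.
      outer_normal \<gamma> (bemb z) $ j * outer_normal \<gamma> (bemb z) $ l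
        * riemann_low halfspace \<gamma> (Some \<alpha>) j (Some \<beta>) l (bemb z))"

text \<open>Contractions over tangential orthonormal indices are written with the inverse of the boundary
  metric, so the coordinates need not be orthonormal.\<close>

definition T_curv ::
  "(real ^ (3 option) \<Rightarrow> real ^ (3 option) ^ (3 option)) \<Rightarrow> real ^ 3 \<Rightarrow> real" where
  "T_curv \<gamma> z =
     (1/12) * (\<Sum>i\<in>UNIV. outer_normal \<gamma> (bemb z) $ i
                  * pd halfspace i (scalar_curv halfspace \<gamma>) (bemb z))
     + (1/6) * scalar_curv halfspace \<gamma> (bemb z) * mean_curv \<gamma> z
     - (\<Sum>\<alpha>\<in>UNIV. \<Sum>\<alpha>'\<in>UNIV. \<Sum>\<beta>\<in>UNIV. \<Sum>\<beta>'\<in>UNIV.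
          matrix_inv (bmetric \<gamma> z) $ \<alpha> $ \<alpha>' * matrix_inv (bmetric \<gamma> z) $ \<beta> $ \<beta>'
            * normal_riemann \<gamma> z $ \<alpha> $ \<beta> * second_ff \<gamma> z $ \<alpha>' $ \<beta>')
     + (1/9) * mean_curv \<gamma> z ^ 3
     - (1/3) * trace (shape_op \<gamma> z ** shape_op \<gamma> z ** shape_op \<gamma> z)
     - (1/3) * laplacian UNIV (bmetric \<gamma>) (mean_curv \<gamma>) z"

section \<open>Smooth manifolds and tensors\<close>

type_synonym ('a, 'i) chart = "'a set \<times> ('a \<Rightarrow> real ^ 'i)"

record ('a, 'i) mfd =
  mtop :: "'a topology"
  model :: "(real ^ 'i) set"
  atlas :: "('a, 'i) chart set"

definition coord_inv :: "('a, 'i) chart \<Rightarrow> real ^ 'i \<Rightarrow> 'a" where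
  "coord_inv c = inv_into (fst c) (snd c)"

definition coord_map ::
  "('a, 'i) chart \<Rightarrow> ('b, 'j) chart \<Rightarrow> ('a \<Rightarrow> 'b) \<Rightarrow> real ^ 'i \<Rightarrow> real ^ 'j" where
  "coord_map c c' F = snd c' \<circ> F \<circ> coord_inv c"

definition smooth_map ::
  "('a, 'i::finite) mfd \<Rightarrow> ('b, 'j::finite) mfd \<Rightarrow> 'a set \<Rightarrow> ('a \<Rightarrow> 'b) \<Rightarrow> bool" where
  "smooth_map N N' S F \<longleftrightarrow>
     continuous_map (subtopology (mtop N) S) (mtop N') F \<and>
     (\<forall>c\<in>atlas N. \<forall>c'\<in>atlas N'.
        smooth_on (model N) (snd c ` {p \<in> fst c \<inter> S. F p \<in> fst c'}) (coord_map c c' F))"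

definition smooth_fun ::
  "('a, 'i::finite) mfd \<Rightarrow> 'a set \<Rightarrow> ('a \<Rightarrow> real) \<Rightarrow> bool" where
  "smooth_fun N S f \<longleftrightarrow> (\<forall>c\<in>atlas N. smooth_on (model N) (snd c ` (fst c \<inter> S)) (f \<circ> coord_inv c))"

text \<open>Second countability is automatic for the compact manifolds considered here.\<close>

definition compact_manifold_with_boundary :: "('a, ('m::finite) option) mfd \<Rightarrow> bool" where
  "compact_manifold_with_boundary N \<longleftrightarrow>
     model N = halfspace \<and> compact_space (mtop N) \<and> Hausdorff_space (mtop N) \<and>
     (\<Union>c\<in>atlas N. fst c) = topspace (mtop N) \<and>
     (\<forall>c\<in>atlas N. openin (mtop N) (fst c) \<and>
        openin (top_of_set (model N)) (snd c ` fst c) \<and>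
        homeomorphic_map (subtopology (mtop N) (fst c)) (top_of_set (snd c ` fst c)) (snd c)) \<and>
     smooth_map N N (topspace (mtop N)) (\<lambda>p. p)"

definition bdry :: "('a, ('m::finite) option) mfd \<Rightarrow> 'a set" where
  "bdry N = {p \<in> topspace (mtop N). \<exists>c\<in>atlas N. p \<in> fst c \<and> snd c p $ None = 0}"

definition inner_pts :: "('a, ('m::finite) option) mfd \<Rightarrow> 'a set" where
  "inner_pts N = topspace (mtop N) - bdry N"

definition bchart :: "('a, ('m::finite) option) mfd \<Rightarrow> ('a, 'm option) chart \<Rightarrow> ('a, 'm) chart" where
  "bchart N c = (fst c \<inter> bdry N, bcoord \<circ> snd c)"

definition bdry_mfd :: "('a, ('m::finite) option) mfd \<Rightarrow> ('a, 'm) mfd" where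
  "bdry_mfd N = \<lparr>mtop = subtopology (mtop N) (bdry N), model = UNIV, atlas = bchart N ` atlas N\<rparr>"

text \<open>The product \<open>P \<times> [0,\<epsilon>)\<close> of a boundaryless manifold with a half-open interval, the interval
  variable being the coordinate \<open>None\<close>.\<close>

definition cyl_chart :: "real \<Rightarrow> ('a, 'm::finite) chart \<Rightarrow> ('a \<times> real, 'm option) chart" where
  "cyl_chart \<epsilon> c = (fst c \<times> {0..<\<epsilon>},
     \<lambda>(p, t). \<chi> i. case i of None \<Rightarrow> t | Some \<alpha> \<Rightarrow> snd c p $ \<alpha>)"

definition cylinder :: "('a, 'm::finite) mfd \<Rightarrow> real \<Rightarrow> ('a \<times> real, 'm option) mfd" where
  "cylinder P \<epsilon> = \<lparr>mtop = prod_topology (mtop P) (top_of_set {0..<\<epsilon>}), model = halfspace,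
                   atlas = cyl_chart \<epsilon> ` atlas P\<rparr>"

definition diffeo_onto_open ::
  "('a, 'i::finite) mfd \<Rightarrow> ('b, 'j::finite) mfd \<Rightarrow> 'b set \<Rightarrow> ('a \<Rightarrow> 'b) \<Rightarrow> bool" where
  "diffeo_onto_open P N W F \<longleftrightarrow>
     openin (mtop N) W \<and> bij_betw F (topspace (mtop P)) W \<and>
     smooth_map P N (topspace (mtop P)) F \<and>
     smooth_map N P W (inv_into (topspace (mtop P)) F)"

text \<open>A covariant 2-tensor field is given classically, by its component matrices in every chart
  of the atlas; only the values at points of the chart domain matter.\<close>

type_synonym ('a, 'i) tensor2 = "('a, 'i) chart \<Rightarrow> 'a \<Rightarrow> real ^ 'i ^ 'i"

text \<open>Components in chart \<open>c\<close> of the pullback under \<open>F\<close> of the tensor with components \<open>g c'\<close>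
  in the chart \<open>c'\<close>.\<close>

definition pullback ::
  "(real ^ 'i::finite) set \<Rightarrow> ('a \<Rightarrow> 'b) \<Rightarrow> ('b, 'j::finite) tensor2 \<Rightarrow>
   ('a, 'i) chart \<Rightarrow> ('b, 'j) chart \<Rightarrow> 'a \<Rightarrow> real ^ 'i ^ 'i" where
  "pullback D F g c c' p =
     (let J = jacobian (coord_map c c' F) (at (snd c p) within D)
      in transpose J ** g c' (F p) ** J)"

definition riemannian_metric_on ::
  "('a, 'i::finite) mfd \<Rightarrow> 'a set \<Rightarrow> ('a, 'i) tensor2 \<Rightarrow> bool" where
  "riemannian_metric_on N S g \<longleftrightarrow>
     (\<forall>c\<in>atlas N. smooth_on (model N) (snd c ` (fst c \<inter> S)) (g c \<circ> coord_inv c) \<and>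
        (\<forall>p\<in>fst c \<inter> S. transpose (g c p) = g c p \<and> (\<forall>w. w \<noteq> 0 \<longrightarrow> 0 < w \<bullet> (g c p *v w)))) \<and>
     (\<forall>c\<in>atlas N. \<forall>c'\<in>atlas N. \<forall>p\<in>fst c \<inter> fst c' \<inter> S.
        g c p = pullback (model N) (\<lambda>q. q) g c c' p)"

section \<open>Conformally compact Einstein manifolds\<close>

text \<open>Throughout, \<open>N\<close> is the compact manifold with boundary; the complete metric \<open>g\<close> lives on
  \<open>inner_pts N\<close> only.\<close>

definition defining_function_on ::
  "('a, ('m::finite) option) mfd \<Rightarrow> 'a set \<Rightarrow> ('a \<Rightarrow> real) \<Rightarrow> bool" where
  "defining_function_on N W x \<longleftrightarrow>
     openin (mtop N) W \<and> bdry N \<subseteq> W \<and> smooth_fun N W x \<and>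
     (\<forall>p\<in>W - bdry N. 0 < x p) \<and> (\<forall>p\<in>bdry N. x p = 0) \<and>
     (\<forall>c\<in>atlas N. \<forall>p\<in>fst c \<inter> bdry N. \<exists>i. pd (model N) i (x \<circ> coord_inv c) (snd c p) \<noteq> 0)"

text \<open>\<open>h\<close> is a Riemannian metric on the open set \<open>W\<close>, up to the boundary, that extends the metric
  \<open>f g\<close> given in the interior.\<close>

definition extends_conformal ::
  "('a, ('m::finite) option) mfd \<Rightarrow> 'a set \<Rightarrow> ('a \<Rightarrow> real) \<Rightarrow> ('a, 'm option) tensor2
    \<Rightarrow> ('a, 'm option) tensor2 \<Rightarrow> bool" where
  "extends_conformal N W f g h \<longleftrightarrow>
     riemannian_metric_on N W h \<and>
     (\<forall>c\<in>atlas N. \<forall>p\<in>fst c \<inter> W \<inter> inner_pts N. h c p = f p *\<^sub>R g c p)"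

definition conformally_compact ::
  "('a, ('m::finite) option) mfd \<Rightarrow> ('a, 'm option) tensor2 \<Rightarrow> bool" where
  "conformally_compact N g \<longleftrightarrow>
     compact_manifold_with_boundary N \<and> riemannian_metric_on N (inner_pts N) g \<and>
     (\<exists>x h. defining_function_on N (topspace (mtop N)) x \<and>
        extends_conformal N (topspace (mtop N)) (\<lambda>p. (x p)\<^sup>2) g h)"

definition conformal_infinity ::
  "('a, ('m::finite) option) mfd \<Rightarrow> ('a, 'm option) tensor2 \<Rightarrow> ('a, 'm) tensor2 set" where
  "conformal_infinity N g =
     {gh. riemannian_metric_on (bdry_mfd N) (bdry N) gh \<and>
        (\<exists>x h. defining_function_on N (topspace (mtop N)) x \<and>
           extends_conformal N (topspace (mtop N)) (\<lambda>p. (x p)\<^sup>2) g h \<and>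
           (\<forall>c\<in>atlas N. \<forall>p\<in>fst c \<inter> bdry N. gh (bchart N c) p = tang (h c p)))}"

definition conformally_compact_einstein ::
  "('a, ('m::finite) option) mfd \<Rightarrow> ('a, 'm option) tensor2 \<Rightarrow> bool" where
  "conformally_compact_einstein N g \<longleftrightarrow>
     conformally_compact N g \<and>
     (\<forall>c\<in>atlas N. \<forall>p\<in>fst c \<inter> inner_pts N. \<forall>i j.
        ricci (model N) (g c \<circ> coord_inv c) i j (snd c p) = - real CARD('m) * g c p $ i $ j)"

section \<open>Special defining functions\<close>

definition warp :: "real ^ 'm ^ 'm \<Rightarrow> real ^ ('m::finite option) ^ ('m option)" where
  "warp G = (\<chi> i j. case (i, j) of (None, None) \<Rightarrow> 1 | (Some \<alpha>, Some \<beta>) \<Rightarrow> G $ \<alpha> $ \<beta> | _ \<Rightarrow> 0)"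

text \<open>\<open>x\<close> is the special defining function near the boundary determined by \<open>gh\<close>, and \<open>\<Phi>\<close> is the
  identification of \<open>M \<times> [0,\<epsilon>)\<close> with a neighbourhood of \<open>M\<close> under which \<open>x\<close> is the projection to
  \<open>[0,\<epsilon>)\<close> and \<open>x\<^sup>2 g = dx\<^sup>2 + g\<^sub>x\<close> with \<open>g\<^sub>0 = gh\<close>.\<close>

definition special_defining_function ::
  "('a, ('m::finite) option) mfd \<Rightarrow> ('a, 'm option) tensor2 \<Rightarrow> ('a, 'm) tensor2
    \<Rightarrow> ('a \<Rightarrow> real) \<Rightarrow> real \<Rightarrow> ('a \<times> real \<Rightarrow> 'a) \<Rightarrow> bool" where
  "special_defining_function N g gh x \<epsilon> \<Phi> \<longleftrightarrow>
     0 < \<epsilon> \<and>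
     (let W = \<Phi> ` (bdry N \<times> {0..<\<epsilon>}); P = bdry_mfd N in
        diffeo_onto_open (cylinder P \<epsilon>) N W \<Phi> \<and>
        (\<forall>p\<in>bdry N. \<Phi> (p, 0) = p) \<and>
        (\<forall>p\<in>bdry N. \<forall>t\<in>{0..<\<epsilon>}. x (\<Phi> (p, t)) = t) \<and>
        defining_function_on N W x \<and>
        (\<exists>h gx. extends_conformal N W (\<lambda>p. (x p)\<^sup>2) g h \<and>
           (\<forall>t\<in>{0..<\<epsilon>}. riemannian_metric_on P (bdry N) (gx t)) \<and>
           (\<forall>c\<in>atlas P. \<forall>p\<in>fst c. gx 0 c p = gh c p) \<and>
           (\<forall>c\<in>atlas P. \<forall>c'\<in>atlas N. \<forall>p\<in>fst c. \<forall>t\<in>{0..<\<epsilon>}. \<Phi> (p, t) \<in> fst c' \<longrightarrow>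
              pullback halfspace \<Phi> h (cyl_chart \<epsilon> c) c' (p, t) = warp (gx t c p))))"

section \<open>The function v and the Q-curvature of Fefferman and Graham\<close>

definition solves_v_equation ::
  "('a, ('m::finite) option) mfd \<Rightarrow> ('a, 'm option) tensor2 \<Rightarrow> ('a \<Rightarrow> real) \<Rightarrow> bool" where
  "solves_v_equation N g v \<longleftrightarrow>
     smooth_fun N (inner_pts N) v \<and>
     (\<forall>c\<in>atlas N. \<forall>p\<in>fst c \<inter> inner_pts N.
        - laplacian (model N) (g c \<circ> coord_inv c) (v \<circ> coord_inv c) (snd c p) = real CARD('m))"

definition right_deriv :: "(real \<Rightarrow> real) \<Rightarrow> real \<Rightarrow> real" where
  "right_deriv f t = vector_derivative f (at t within {0..})"

definition even_at_0 :: "(real \<Rightarrow> real) \<Rightarrow> bool" where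
  "even_at_0 f \<longleftrightarrow> (\<forall>k. odd k \<longrightarrow> (right_deriv ^^ k) f 0 = 0)"

definition v_expansion ::
  "('a, ('m::finite) option) mfd \<Rightarrow> ('a \<Rightarrow> real) \<Rightarrow> real \<Rightarrow> ('a \<times> real \<Rightarrow> 'a)
    \<Rightarrow> ('a \<Rightarrow> real) \<Rightarrow> ('a \<Rightarrow> real) \<Rightarrow> ('a \<Rightarrow> real) \<Rightarrow> bool" where
  "v_expansion N x \<epsilon> \<Phi> v A B \<longleftrightarrow>
     (\<exists>W. openin (mtop N) W \<and> bdry N \<subseteq> W \<and> W \<subseteq> \<Phi> ` (bdry N \<times> {0..<\<epsilon>}) \<and>
        smooth_fun N W A \<and> smooth_fun N W B \<and>
        (\<forall>p\<in>W \<inter> inner_pts N. v p = ln (x p) + A p + B p * x p ^ CARD('m))) \<and>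
     (\<forall>p\<in>bdry N. even_at_0 (\<lambda>t. A (\<Phi> (p, t))) \<and> even_at_0 (\<lambda>t. B (\<Phi> (p, t)))) \<and>
     (\<forall>p\<in>bdry N. A p = 0)"

definition k_const :: "nat \<Rightarrow> real" where
  "k_const n = 2 ^ n * Gamma (real n / 2) / Gamma (- (real n / 2))"

text \<open>\<open>Q\<^sub>n\<close> of \<open>(g, gh)\<close>, for n odd. The value \<open>B p\<close> is determined by \<open>g\<close> and \<open>gh\<close>, which
  justifies the definite description.\<close>

definition FG_Q ::
  "('a, ('m::finite) option) mfd \<Rightarrow> ('a, 'm option) tensor2 \<Rightarrow> ('a, 'm) tensor2 \<Rightarrow> 'a \<Rightarrow> real" where
  "FG_Q N g gh p = k_const CARD('m) *
     (THE b. \<exists>x \<epsilon> \<Phi> v A B. special_defining_function N g gh x \<epsilon> \<Phi> \<and> solves_v_equation N g v \<and>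
               v_expansion N x \<epsilon> \<Phi> v A B \<and> b = B p)"

end

theory Submission
  imports Defs
begin

text \<open>
  Put \<open>\<rho> = e\<^sup>v\<close> and \<open>G = \<rho>\<^sup>2 g\<close>. The Einstein equation and \<open>- \<Delta> v = n\<close> give, in terms of \<open>G\<close>,
  \<open>\<rho> Ric = - (n - 1) Hess \<rho>\<close> and \<open>R = n (n - 1) \<rho>\<^sup>-\<^sup>2 (1 - |d v|\<^sub>g\<^sup>2)\<close>. The first equation, continued to
  \<open>\<rho> = 0\<close>, shows that the boundary is totally geodesic, so \<open>T\<close> reduces to the normal derivative of
  \<open>R / 12\<close>. With \<open>v = log x + A + B x\<^sup>3\<close> and \<open>A\<close> even, the second one gives
  \<open>R = R\<^sub>0 - 36 B x + o(x)\<close> along the curves \<open>t \<mapsto> \<Phi> (p, t)\<close>, hence \<open>T = 3 B\<close>; and \<open>k\<^sub>3 = 3\<close>.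

  That \<open>B\<close> on the boundary does not depend on the choices follows from \<open>T = 3 B\<close> once \<open>v\<close> is known to be
  unique. The difference of two solutions is harmonic and tends to \<open>0\<close> at the boundary, because both
  compactified metrics induce the same boundary metric; the maximum principle applies.
\<close>

subsection \<open>Calculus on the half-space\<close>

text \<open>The metric \<open>g\<close> and the function \<open>v\<close> are singular at the
  boundary, so every equation is known only where the transverse coordinate is positive. Each one is
  rewritten until all its terms are smooth up to the boundary, and only then continued. At
  \<open>\<rho> = 0\<close> the equation for the Hessian of \<open>\<rho>\<close> leaves, on
  tangential vectors, a multiple of the second fundamental form, because \<open>\<rho>\<close>
  vanishes on the boundary while its transverse derivative does not. The normal form
  \<open>x\<^sup>2 g = dx\<^sup>2 + g\<^sub>x\<close> says that the curves in t have the gradient of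
  \<open>x\<close> as velocity. With Z = A + B \<open>x\<^sup>3\<close> and Z' its derivative along
  such a curve, the squared length of dv in \<open>g\<close> is 1 + 2 x Z' +
  \<open>x\<^sup>2\<close> times the squared length of dZ in \<open>x\<^sup>2 g\<close>, so the
  factor 1 - \<open>|d v|\<^sub>g\<^sup>2\<close> loses its constant term and only derivatives of
  one real variable matter. The constant 36 is 6 * 2 * 3: the factor n (n - 1), the cross term, and
  the exponent of \<open>x\<close> in Z. Evenness of A keeps A out of the linear term of R. The
  outer normal is minus the velocity, which turns -36 B into 36 B, and 36 / 12 = 3.\<close>

abbreviation pdh :: "'m::finite option \<Rightarrow> (real ^ ('m option) \<Rightarrow> 'b::real_normed_vector) \<Rightarrow> real ^ ('m option) \<Rightarrow> 'b"
  where "pdh \<equiv> pd halfspace"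

lemma openin_halfspaceD:
  assumes "openin (top_of_set D) S"
  shows "S \<subseteq> D" "y \<in> S \<Longrightarrow> \<exists>e>0. \<forall>z\<in>D. dist z y < e \<longrightarrow> z \<in> S"
  using assms by (auto simp: openin_euclidean_subtopology_iff)

lemma at_within_openin_eq:
  assumes "openin (top_of_set D) S" "y \<in> S"
  shows "at y within D = at y within S"
proof -
  obtain U where "open U" "S = D \<inter> U" using assms(1) by (auto simp: openin_open)
  then show ?thesis using assms(2) by (intro at_within_nhd[of y U]) auto
qed

text \<open>Even at a point of the boundary, small positive steps along every coordinate axis stay
  in the half-space, and these determine the derivative.\<close>

lemma has_derivative_unique_halfspace:
  fixes f :: "real ^ ('m::finite option) \<Rightarrow> 'b::real_normed_vector"
  assumes "(f has_derivative f') (at y within halfspace)" "(f has_derivative f'') (at y within halfspace)"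
    and "y \<in> halfspace"
  shows "f' = f''"
proof (rule frechet_derivative_unique_within[OF assms(1,2)])
  fix i :: "real ^ ('m option)" and e :: real
  assume "i \<in> Basis" "e > 0"
  then obtain k where "i = axis k 1" by (auto simp: Basis_vec_def)
  then show "\<exists>d. 0 < \<bar>d\<bar> \<and> \<bar>d\<bar> < e \<and> y + d *\<^sub>R i \<in> halfspace"
    using \<open>e > 0\<close> \<open>y \<in> halfspace\<close> by (intro exI[of _ "e/2"]) (auto simp: halfspace_def axis_def)
qed

lemma pd_eqI:
  assumes "(f has_derivative f') (at y within halfspace)" "y \<in> halfspace"
  shows "pdh i f y = f' (axis i 1)"
proof -
  have "(f has_derivative frechet_derivative f (at y within halfspace)) (at y within halfspace)"
    using assms(1) differentiableI frechet_derivative_works by blast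
  then show ?thesis
    unfolding pd_def using has_derivative_unique_halfspace[OF assms(1) _ assms(2)] by simp
qed

lemma has_derivative_pd:
  fixes f :: "real ^ 'i \<Rightarrow> 'b::real_normed_vector"
  assumes "f differentiable (at y within D)"
  shows "(f has_derivative (\<lambda>u. \<Sum>i\<in>UNIV. u $ i *\<^sub>R pd D i f y)) (at y within D)"
proof -
  let ?f' = "frechet_derivative f (at y within D)"
  have f: "(f has_derivative ?f') (at y within D)" using assms frechet_derivative_works by blast
  interpret linear ?f' using f by (rule has_derivative_linear)
  have "?f' u = (\<Sum>i\<in>UNIV. u $ i *\<^sub>R pd D i f y)" for u
  proof -
    have "?f' u = ?f' (\<Sum>i\<in>UNIV. u $ i *\<^sub>R axis i 1)"
      using basis_expansion[of u] by (simp add: scalar_mult_eq_scaleR)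
    then show ?thesis by (simp add: sum scaleR pd_def)
  qed
  then show ?thesis using f by presburger
qed

text \<open>Derivatives depend only on the germ of the function within \<open>D\<close>. Since
  \<open>pd\<close> is a choice made from the derivative relation, the third part holds for
  arbitrary functions, differentiable or not; it is the device for replacing a function by a formula
  valid on a patch.\<close>

lemma differentiable_cong_openin:
  assumes "openin (top_of_set D) S" "y \<in> S" "\<And>z. z \<in> S \<Longrightarrow> f z = g z"
  shows "f differentiable (at y within D) \<longleftrightarrow> g differentiable (at y within D)"
    and "(f has_derivative f') (at y within D) \<longleftrightarrow> (g has_derivative f') (at y within D)"
    and "pd D i f y = pd D i g y"
proof -
  obtain e where e: "e > 0" "\<And>z. z \<in> D \<Longrightarrow> dist z y < e \<Longrightarrow> z \<in> S" and "y \<in> D"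
    using openin_halfspaceD[OF assms(1)] assms(2) by blast
  have *: "(f has_derivative f') (at y within D) \<longleftrightarrow> (g has_derivative f') (at y within D)" for f'
    using e assms(3) \<open>y \<in> D\<close> has_derivative_transform_within[of f f' y D e g]
      has_derivative_transform_within[of g f' y D e f] by metis
  then show "(f has_derivative f') (at y within D) \<longleftrightarrow> (g has_derivative f') (at y within D)" .
  show "f differentiable (at y within D) \<longleftrightarrow> g differentiable (at y within D)"
    unfolding differentiable_def * ..
  show "pd D i f y = pd D i g y" unfolding pd_def frechet_derivative_def * ..
qed

lemma Ck_on_cong:
  assumes "openin (top_of_set D) S" "\<And>z. z \<in> S \<Longrightarrow> f z = g z"
  shows "Ck_on D S k f \<longleftrightarrow> Ck_on D S k g"
  using assms(2)
proof (induction k arbitrary: f g)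
  case (Suc k)
  have "Ck_on D S k (pd D i f) \<longleftrightarrow> Ck_on D S k (pd D i g)" for i
    by (rule Suc.IH) (use differentiable_cong_openin(3)[OF assms(1)] Suc.prems in blast)
  then show ?case using differentiable_cong_openin(1)[OF assms(1) _ Suc.prems] by auto
qed (auto intro: continuous_on_cong)

lemma Ck_on_SucD:
  assumes "openin (top_of_set D) S" "Ck_on D S (Suc k) f"
  shows "Ck_on D S k f"
  using assms(2)
proof (induction k arbitrary: f)
  case 0
  then show ?case using openin_halfspaceD(1)[OF assms(1)]
    by (auto simp: continuous_on_eq_continuous_within
        intro: continuous_within_subset[OF differentiable_imp_continuous_within])
qed auto

lemma Ck_on_subset:
  assumes "Ck_on D S k f" "T \<subseteq> S"
  shows "Ck_on D T k f"
  using assms by (induction k arbitrary: f) (auto intro: continuous_on_subset)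

lemma smooth_on_subset: "smooth_on D S f \<Longrightarrow> T \<subseteq> S \<Longrightarrow> smooth_on D T f"
  unfolding smooth_on_def by (blast intro: Ck_on_subset)

lemma smooth_on_cong:
  assumes "openin (top_of_set D) S" "\<And>z. z \<in> S \<Longrightarrow> f z = g z"
  shows "smooth_on D S f \<longleftrightarrow> smooth_on D S g"
  unfolding smooth_on_def using Ck_on_cong[of D S f g] assms by blast

lemma smooth_on_pd: "smooth_on D S f \<Longrightarrow> smooth_on D S (pd D i f)"
  unfolding smooth_on_def using Ck_on.simps(2) by blast

lemma smooth_on_differentiable: "smooth_on D S f \<Longrightarrow> y \<in> S \<Longrightarrow> f differentiable (at y within D)"
  unfolding smooth_on_def by (metis Ck_on.simps(2))

lemma smooth_on_continuous_on: "smooth_on D S f \<Longrightarrow> continuous_on S f"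
  unfolding smooth_on_def by (metis Ck_on.simps(1))

lemma Ck_on_locally:
  assumes "\<And>y. y \<in> S \<Longrightarrow> \<exists>T. openin (top_of_set D) T \<and> y \<in> T \<and> Ck_on D T k f" "S \<subseteq> D"
  shows "Ck_on D S k f"
  using assms
proof (induction k arbitrary: f)
  case 0
  have "continuous (at y within S) f" if "y \<in> S" for y
  proof -
    obtain T where T: "openin (top_of_set D) T" "y \<in> T" "continuous_on T f"
      using "0.prems" \<open>y \<in> S\<close> by auto
    then have "continuous (at y within D) f"
      using at_within_openin_eq[OF T(1,2)] by (simp add: continuous_on_eq_continuous_within)
    then show ?thesis using "0.prems"(2) continuous_within_subset by blast
  qed
  then show ?case by (simp add: continuous_on_eq_continuous_within)
next
  case (Suc k)
  have "Ck_on D S k (pd D i f)" for i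
    by (rule Suc.IH) (use Suc.prems in fastforce)+
  moreover have "f differentiable (at y within D)" if "y \<in> S" for y
    using Suc.prems(1)[OF that] by auto
  ultimately show ?case by simp
qed

section \<open>Rules for partial derivatives within the half-space\<close>

lemma pd_const: "y \<in> halfspace \<Longrightarrow> pdh i (\<lambda>_. c) y = 0"
  by (rule pd_eqI[OF has_derivative_const])

lemma pd_nth: "y \<in> halfspace \<Longrightarrow> pdh i (\<lambda>y. y $ j) y = (if i = j then 1 else 0)"
  by (subst pd_eqI[OF bounded_linear.has_derivative[OF bounded_linear_vec_nth has_derivative_ident]])
    (auto simp: axis_def)

context
  fixes y :: "real ^ ('m::finite option)"
  assumes y: "y \<in> halfspace"
begin

lemma pd_add:
  assumes "f differentiable (at y within halfspace)" "g differentiable (at y within halfspace)"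
  shows "pdh i (\<lambda>z. f z + g z) y = pdh i f y + pdh i g y"
  using pd_eqI[OF has_derivative_add[OF assms[unfolded frechet_derivative_works]] y] by (simp add: pd_def)

lemma pd_diff:
  assumes "f differentiable (at y within halfspace)" "g differentiable (at y within halfspace)"
  shows "pdh i (\<lambda>z. f z - g z) y = pdh i f y - pdh i g y"
  using pd_eqI[OF has_derivative_diff[OF assms[unfolded frechet_derivative_works]] y] by (simp add: pd_def)

lemma pd_bounded_linear:
  assumes "bounded_linear L" "f differentiable (at y within halfspace)"
  shows "pdh i (\<lambda>z. L (f z)) y = L (pdh i f y)"
  using pd_eqI[OF bounded_linear.has_derivative[OF assms(1) assms(2)[unfolded frechet_derivative_works]] y]
  by (simp add: pd_def)

lemma pd_sum:
  assumes "\<And>a. a \<in> A \<Longrightarrow> f a differentiable (at y within halfspace)"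
  shows "pdh i (\<lambda>z. \<Sum>a\<in>A. f a z) y = (\<Sum>a\<in>A. pdh i (f a) y)"
  using pd_eqI[OF has_derivative_sum[OF assms[unfolded frechet_derivative_works]] y] by (simp add: pd_def)

lemma pd_scaleR:
  assumes "f differentiable (at y within halfspace)" "g differentiable (at y within halfspace)"
  shows "pdh i (\<lambda>z. f z *\<^sub>R g z) y = f y *\<^sub>R pdh i g y + pdh i f y *\<^sub>R g y"
  using pd_eqI[OF has_derivative_scaleR[OF assms[unfolded frechet_derivative_works]] y] by (simp add: pd_def)

lemma pd_mult:
  fixes f g :: "real ^ ('m option) \<Rightarrow> real"
  assumes "f differentiable (at y within halfspace)" "g differentiable (at y within halfspace)"
  shows "pdh i (\<lambda>z. f z * g z) y = f y * pdh i g y + pdh i f y * g y"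
  using pd_scaleR[OF assms] by simp

lemma pd_exp:
  fixes f :: "real ^ ('m option) \<Rightarrow> real"
  assumes "f differentiable (at y within halfspace)"
  shows "pdh i (\<lambda>z. exp (f z)) y = pdh i f y * exp (f y)"
  using pd_eqI[OF has_derivative_exp[OF assms[unfolded frechet_derivative_works]] y] by (simp add: pd_def)

lemma pd_inverse:
  fixes f :: "real ^ ('m option) \<Rightarrow> real"
  assumes "f differentiable (at y within halfspace)" "f y \<noteq> 0"
  shows "pdh i (\<lambda>z. inverse (f z)) y = - (inverse (f y) * pdh i f y * inverse (f y))"
  using pd_eqI[OF Deriv.has_derivative_inverse[OF assms(2) assms(1)[unfolded frechet_derivative_works]] y]
  by (simp add: pd_def)

lemma pd_compose:
  fixes F :: "real ^ ('m option) \<Rightarrow> real ^ 'j" and f :: "real ^ 'j \<Rightarrow> 'b::real_normed_vector"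
  assumes "openin (top_of_set halfspace) S" "y \<in> S" "F ` S \<subseteq> D"
    and F: "F differentiable (at y within halfspace)" and f: "f differentiable (at (F y) within D)"
  shows "(\<lambda>z. f (F z)) differentiable (at y within halfspace)"
    and "pdh i (\<lambda>z. f (F z)) y = (\<Sum>j\<in>UNIV. pdh i F y $ j *\<^sub>R pd D j f (F y))"
proof -
  \<comment> \<open>\<open>F\<close> is only known to map \<open>S\<close>, not the whole
    half-space, into \<open>D\<close>; the chain rule is therefore applied within \<open>S\<close>,
    and the result is carried back because \<open>S\<close> is relatively open.\<close>
  have "(F has_derivative frechet_derivative F (at y within halfspace)) (at y within S)"
    using F frechet_derivative_works at_within_openin_eq[OF assms(1,2)] by metis
  moreover have "(f has_derivative (\<lambda>u. \<Sum>j\<in>UNIV. u $ j *\<^sub>R pd D j f (F y))) (at (F y) within F ` S)"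
    using has_derivative_pd[OF f] assms(3) has_derivative_subset by blast
  ultimately have "((\<lambda>z. f (F z)) has_derivative
      (\<lambda>u. \<Sum>j\<in>UNIV. frechet_derivative F (at y within halfspace) u $ j *\<^sub>R pd D j f (F y))) (at y within S)"
    by (rule has_derivative_in_compose)
  then have *: "((\<lambda>z. f (F z)) has_derivative
      (\<lambda>u. \<Sum>j\<in>UNIV. frechet_derivative F (at y within halfspace) u $ j *\<^sub>R pd D j f (F y))) (at y within halfspace)"
    using at_within_openin_eq[OF assms(1,2)] by metis
  then show "(\<lambda>z. f (F z)) differentiable (at y within halfspace)" by (rule differentiableI)
  show "pdh i (\<lambda>z. f (F z)) y = (\<Sum>j\<in>UNIV. pdh i F y $ j *\<^sub>R pd D j f (F y))"
    using pd_eqI[OF * y] by (simp add: pd_def)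
qed

end

section \<open>Closure properties of functions smooth up to the boundary\<close>

context
  fixes S :: "(real ^ ('m::finite option)) set"
  assumes S: "openin (top_of_set halfspace) S"
begin

lemma in_halfspace: "y \<in> S \<Longrightarrow> y \<in> halfspace"
  using openin_halfspaceD(1)[OF S] by blast

lemma Ck_on_const: "Ck_on halfspace S k (\<lambda>_. c)"
proof (induction k arbitrary: c)
  case (Suc k)
  have "Ck_on halfspace S k (pdh i (\<lambda>_. c))" for i
    using Ck_on_cong[OF S, of "pdh i (\<lambda>_. c)" "\<lambda>_. 0" k] Suc.IH[of 0] pd_const in_halfspace by blast
  then show ?case by simp
qed simp

lemma Ck_on_add:
  "Ck_on halfspace S k f \<Longrightarrow> Ck_on halfspace S k g \<Longrightarrow> Ck_on halfspace S k (\<lambda>z. f z + g z)"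
proof (induction k arbitrary: f g)
  case (Suc k)
  have "Ck_on halfspace S k (pdh i (\<lambda>z. f z + g z))" for i
  proof (subst Ck_on_cong[OF S])
    show "pdh i (\<lambda>z. f z + g z) z = pdh i f z + pdh i g z"
      if "z \<in> S" for z by (rule pd_add) (use that Suc.prems in_halfspace in auto)
    show "Ck_on halfspace S k (\<lambda>z. pdh i f z + pdh i g z)"
      using Suc.prems by (intro Suc.IH) auto
  qed
  then show ?case using Suc.prems by simp
qed (auto intro: continuous_intros)

lemma Ck_on_sum:
  "(\<And>a. a \<in> A \<Longrightarrow> Ck_on halfspace S k (f a)) \<Longrightarrow> Ck_on halfspace S k (\<lambda>z. \<Sum>a\<in>A. f a z)"
  by (induction A rule: infinite_finite_induct) (auto intro: Ck_on_const Ck_on_add)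

lemma Ck_on_bounded_linear:
  assumes "bounded_linear L"
  shows "Ck_on halfspace S k f \<Longrightarrow> Ck_on halfspace S k (\<lambda>z. L (f z))"
proof (induction k arbitrary: f)
  case 0
  then show ?case using bounded_linear.continuous_on[OF assms] by simp
next
  case (Suc k)
  have "Ck_on halfspace S k (pdh i (\<lambda>z. L (f z)))" for i
  proof (subst Ck_on_cong[OF S])
    show "pdh i (\<lambda>z. L (f z)) z = L (pdh i f z)"
      if "z \<in> S" for z using that Suc.prems in_halfspace assms by (intro pd_bounded_linear) auto
    show "Ck_on halfspace S k (\<lambda>z. L (pdh i f z))"
      using Suc.prems by (intro Suc.IH) auto
  qed
  moreover have "(\<lambda>z. L (f z)) differentiable (at y within halfspace)" if "y \<in> S" for y
  proof -
    have "f differentiable (at y within halfspace)" using Suc.prems that by simp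
    then show ?thesis unfolding differentiable_def by (blast intro: bounded_linear.has_derivative[OF assms])
  qed
  ultimately show ?case by simp
qed

lemma Ck_on_scaleR:
  "Ck_on halfspace S k f \<Longrightarrow> Ck_on halfspace S k g \<Longrightarrow> Ck_on halfspace S k (\<lambda>z. f z *\<^sub>R g z)"
proof (induction k arbitrary: f g)
  case (Suc k)
  have fg: "Ck_on halfspace S k f" "Ck_on halfspace S k g" using Suc.prems Ck_on_SucD[OF S] by blast+
  have "Ck_on halfspace S k (pdh i (\<lambda>z. f z *\<^sub>R g z))" for i
  proof (subst Ck_on_cong[OF S])
    show "pdh i (\<lambda>z. f z *\<^sub>R g z) z = f z *\<^sub>R pdh i g z + pdh i f z *\<^sub>R g z"
      if "z \<in> S" for z by (rule pd_scaleR) (use that Suc.prems in_halfspace in auto)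
    show "Ck_on halfspace S k (\<lambda>z. f z *\<^sub>R pdh i g z + pdh i f z *\<^sub>R g z)"
      using Suc.prems fg by (auto intro!: Ck_on_add Suc.IH)
  qed
  then show ?case using Suc.prems by simp
qed (auto intro: continuous_intros)

lemma Ck_on_mult:
  fixes f g :: "real ^ ('m option) \<Rightarrow> real"
  shows "Ck_on halfspace S k f \<Longrightarrow> Ck_on halfspace S k g \<Longrightarrow> Ck_on halfspace S k (\<lambda>z. f z * g z)"
  using Ck_on_scaleR by fastforce

lemma Ck_on_inverse:
  fixes f :: "real ^ ('m option) \<Rightarrow> real"
  assumes "\<And>y. y \<in> S \<Longrightarrow> f y \<noteq> 0"
  shows "Ck_on halfspace S k f \<Longrightarrow> Ck_on halfspace S k (\<lambda>z. inverse (f z))"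
proof (induction k)
  case (Suc k)
  have f: "Ck_on halfspace S k (\<lambda>z. inverse (f z))" using Suc Ck_on_SucD[OF S] by blast
  have "Ck_on halfspace S k (pdh i (\<lambda>z. inverse (f z)))" for i
  proof (subst Ck_on_cong[OF S])
    show "pdh i (\<lambda>z. inverse (f z)) z = (-1) * (inverse (f z) * pdh i f z * inverse (f z))"
      if "z \<in> S" for z using that Suc.prems in_halfspace assms by (subst pd_inverse) auto
    show "Ck_on halfspace S k (\<lambda>z. (-1) * (inverse (f z) * pdh i f z * inverse (f z)))"
      using Suc.prems f by (intro Ck_on_mult Ck_on_const) auto
  qed
  then show ?case using Suc.prems assms by (auto intro: differentiable_inverse)
qed (use assms in \<open>auto intro: continuous_intros\<close>)

lemma Ck_on_exp:
  fixes f :: "real ^ ('m option) \<Rightarrow> real"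
  shows "Ck_on halfspace S k f \<Longrightarrow> Ck_on halfspace S k (\<lambda>z. exp (f z))"
proof (induction k)
  case (Suc k)
  have f: "Ck_on halfspace S k (\<lambda>z. exp (f z))" using Suc Ck_on_SucD[OF S] by blast
  have "Ck_on halfspace S k (pdh i (\<lambda>z. exp (f z)))" for i
  proof (subst Ck_on_cong[OF S])
    show "pdh i (\<lambda>z. exp (f z)) z = pdh i f z * exp (f z)"
      if "z \<in> S" for z by (rule pd_exp) (use that Suc.prems in_halfspace in auto)
    show "Ck_on halfspace S k (\<lambda>z. pdh i f z * exp (f z))"
      using Suc.prems f by (auto intro!: Ck_on_mult)
  qed
  moreover have "(\<lambda>z. exp (f z)) differentiable (at y within halfspace)" if "y \<in> S" for y
  proof -
    have "f differentiable (at y within halfspace)" using Suc.prems that by simp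
    then show ?thesis unfolding differentiable_def by (blast intro: has_derivative_exp)
  qed
  ultimately show ?case by simp
qed (auto intro: continuous_intros)

text \<open>By the chain rule the partial derivatives of the composite are sums of products of
  partial derivatives of \<open>F\<close> with partial derivatives of \<open>f\<close> composed with
  the same \<open>F\<close>. The induction therefore varies \<open>f\<close> and keeps
  \<open>F\<close>.\<close>

lemma Ck_on_compose:
  fixes F :: "real ^ ('m option) \<Rightarrow> real ^ 'j" and f :: "real ^ 'j \<Rightarrow> 'b::real_normed_vector"
  assumes T: "F ` S \<subseteq> T" "T \<subseteq> D"
  shows "Ck_on halfspace S k F \<Longrightarrow> Ck_on D T k f \<Longrightarrow> Ck_on halfspace S k (\<lambda>z. f (F z))"
proof (induction k arbitrary: f)
  case 0
  then show ?case using T by (auto intro: continuous_on_compose2)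
next
  case (Suc k)
  have FD: "F ` S \<subseteq> D" using T by blast
  have F: "Ck_on halfspace S k F" using Suc.prems Ck_on_SucD[OF S] by blast
  have dF: "F differentiable (at y within halfspace)" and df: "f differentiable (at (F y) within D)"
    if "y \<in> S" for y
    using Suc.prems that T(1) by auto
  have "Ck_on halfspace S k (pdh i (\<lambda>z. f (F z)))" for i
  proof (subst Ck_on_cong[OF S])
    show "pdh i (\<lambda>z. f (F z)) z = (\<Sum>j\<in>UNIV. pdh i F z $ j *\<^sub>R pd D j f (F z))"
      if "z \<in> S" for z by (rule pd_compose(2)[OF in_halfspace[OF that] S that FD dF[OF that] df[OF that]])
    have "Ck_on halfspace S k (\<lambda>z. pdh i F z $ j)" for j
      using Suc.prems(1) Ck_on_bounded_linear[OF bounded_linear_vec_nth, of k "pdh i F" j] by simp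
    moreover have "Ck_on halfspace S k (\<lambda>z. pd D j f (F z))" for j
      by (rule Suc.IH[OF F]) (use Suc.prems(2) in simp)
    ultimately show "Ck_on halfspace S k (\<lambda>z. \<Sum>j\<in>UNIV. pdh i F z $ j *\<^sub>R pd D j f (F z))"
      by (intro Ck_on_sum Ck_on_scaleR)
  qed
  moreover have "(\<lambda>z. f (F z)) differentiable (at y within halfspace)" if "y \<in> S" for y
    by (rule pd_compose(1)[OF in_halfspace[OF that] S that FD dF[OF that] df[OF that]])
  ultimately show ?case by simp
qed

lemma smooth_on_compose:
  assumes "smooth_on halfspace S F" "smooth_on D T f" "F ` S \<subseteq> T" "T \<subseteq> D"
  shows "smooth_on halfspace S (\<lambda>z. f (F z))"
proof -
  have "Ck_on halfspace S k (\<lambda>z. f (F z))" for k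
    by (rule Ck_on_compose[OF assms(3,4)]) (use assms(1,2) in \<open>simp_all add: smooth_on_def\<close>)
  then show ?thesis unfolding smooth_on_def by blast
qed

lemma smooth_on_bounded_linear:
  "bounded_linear L \<Longrightarrow> smooth_on halfspace S f \<Longrightarrow> smooth_on halfspace S (\<lambda>z. L (f z))"
  unfolding smooth_on_def by (simp add: Ck_on_bounded_linear)

lemma smooth_on_const: "smooth_on halfspace S (\<lambda>_. c)"
  and smooth_on_add:
    "smooth_on halfspace S f \<Longrightarrow> smooth_on halfspace S g \<Longrightarrow> smooth_on halfspace S (\<lambda>z. f z + g z)"
  and smooth_on_sum:
    "(\<And>a. a \<in> A \<Longrightarrow> smooth_on halfspace S (F a)) \<Longrightarrow> smooth_on halfspace S (\<lambda>z. \<Sum>a\<in>A. F a z)"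
  and smooth_on_scaleR:
    "smooth_on halfspace S h \<Longrightarrow> smooth_on halfspace S f \<Longrightarrow> smooth_on halfspace S (\<lambda>z. h z *\<^sub>R f z)"
  for f g :: "real ^ ('m option) \<Rightarrow> 'b::real_normed_vector"
  unfolding smooth_on_def by (simp_all add: Ck_on_const Ck_on_add Ck_on_sum Ck_on_scaleR)

lemma smooth_on_mult:
    "smooth_on halfspace S f \<Longrightarrow> smooth_on halfspace S g \<Longrightarrow> smooth_on halfspace S (\<lambda>z. f z * g z)"
  and smooth_on_inverse:
    "(\<And>y. y \<in> S \<Longrightarrow> f y \<noteq> 0) \<Longrightarrow> smooth_on halfspace S f \<Longrightarrow> smooth_on halfspace S (\<lambda>z. inverse (f z))"
  and smooth_on_exp: "smooth_on halfspace S f \<Longrightarrow> smooth_on halfspace S (\<lambda>z. exp (f z))"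
  for f g :: "real ^ ('m option) \<Rightarrow> real"
  unfolding smooth_on_def by (simp_all add: Ck_on_mult Ck_on_inverse Ck_on_exp)

lemma smooth_on_diff:
  fixes f g :: "real ^ ('m option) \<Rightarrow> real"
  assumes "smooth_on halfspace S f" "smooth_on halfspace S g"
  shows "smooth_on halfspace S (\<lambda>z. f z - g z)"
  using smooth_on_add[OF assms(1) smooth_on_mult[OF smooth_on_const[of "-1"] assms(2)]] by simp

lemma smooth_on_prod:
  fixes F :: "'a \<Rightarrow> real ^ ('m option) \<Rightarrow> real"
  shows "(\<And>a. a \<in> A \<Longrightarrow> smooth_on halfspace S (F a)) \<Longrightarrow> smooth_on halfspace S (\<lambda>z. \<Prod>a\<in>A. F a z)"
  by (induction A rule: infinite_finite_induct) (simp_all add: smooth_on_const smooth_on_mult)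

lemma smooth_on_power:
  fixes f :: "real ^ ('m option) \<Rightarrow> real"
  shows "smooth_on halfspace S f \<Longrightarrow> smooth_on halfspace S (\<lambda>z. f z ^ n)"
  by (induction n) (simp_all add: smooth_on_const smooth_on_mult)

lemma smooth_on_nth:
  "smooth_on halfspace S f \<Longrightarrow> smooth_on halfspace S (\<lambda>z. f z $ i)" for f :: "_ \<Rightarrow> 'b::real_normed_vector ^ 'j"
  by (rule smooth_on_bounded_linear[OF bounded_linear_vec_nth])

lemma smooth_on_nth_nth:
  "smooth_on halfspace S f \<Longrightarrow> smooth_on halfspace S (\<lambda>z. f z $ i $ j)" for f :: "_ \<Rightarrow> real ^ 'j ^ 'k"
  by (rule smooth_on_nth[OF smooth_on_nth])

end

text \<open>Used for the compactified metric, whose smoothness comes from one formula near the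
  boundary and from another in the interior.\<close>

lemma smooth_on_locally:
  assumes "\<And>y. y \<in> S \<Longrightarrow> \<exists>T. openin (top_of_set D) T \<and> y \<in> T \<and> smooth_on D T f" "S \<subseteq> D"
  shows "smooth_on D S f"
  unfolding smooth_on_def
proof
  show "Ck_on D S k f" for k
    by (rule Ck_on_locally[OF _ assms(2)]) (use assms(1) in \<open>unfold smooth_on_def, blast\<close>)
qed

subsection \<open>Positive definite matrices\<close>

text \<open>The pointwise condition inside \<open>riemannian_metric_on\<close>, separated from
  smoothness and from the transformation rule.\<close>

definition posdef :: "real ^ 'i ^ 'i \<Rightarrow> bool" where
  "posdef M \<longleftrightarrow> transpose M = M \<and> (\<forall>w. w \<noteq> 0 \<longrightarrow> 0 < w \<bullet> (M *v w))"

lemma posdef_sym: "posdef M \<Longrightarrow> M $ i $ j = M $ j $ i"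
  unfolding posdef_def by (metis transpose_def vec_lambda_beta)

lemma posdef_diag: "posdef M \<Longrightarrow> 0 < M $ i $ i"
proof -
  assume "posdef M"
  moreover have "axis i (1::real) \<noteq> 0" by (simp add: axis_eq_0_iff)
  ultimately have "0 < axis i 1 \<bullet> (M *v axis i 1)" unfolding posdef_def by blast
  then show ?thesis by (simp add: inner_axis' matrix_vector_mul_component inner_axis)
qed

lemma posdef_invertible: "posdef M \<Longrightarrow> invertible M"
  unfolding posdef_def invertible_left_inverse matrix_left_invertible_ker
  by (metis inner_zero_right less_irrefl)

lemma matrix_inv_left: "invertible M \<Longrightarrow> matrix_inv M ** M = mat 1"
  and matrix_inv_right: "invertible M \<Longrightarrow> M ** matrix_inv M = mat 1"
  for M :: "real ^ 'i ^ 'i"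
  unfolding invertible_def matrix_inv_def by (metis (mono_tags, lifting) someI_ex)+

lemma posdef_inv_mult:
  assumes "posdef M"
  shows "(\<Sum>l\<in>UNIV. matrix_inv M $ k $ l * M $ l $ j) = (if k = j then 1 else 0)"
    and "(\<Sum>l\<in>UNIV. M $ k $ l * matrix_inv M $ l $ j) = (if k = j then 1 else 0)"
proof -
  have "(matrix_inv M ** M) $ k $ j = mat 1 $ k $ j" "(M ** matrix_inv M) $ k $ j = mat 1 $ k $ j"
    using matrix_inv_left matrix_inv_right posdef_invertible[OF assms] by metis+
  then show "(\<Sum>l\<in>UNIV. matrix_inv M $ k $ l * M $ l $ j) = (if k = j then 1 else 0)"
    "(\<Sum>l\<in>UNIV. M $ k $ l * matrix_inv M $ l $ j) = (if k = j then 1 else 0)"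
    by (simp_all add: matrix_matrix_mult_def mat_def)
qed

lemma posdef_matrix_inv:
  assumes "posdef M"
  shows "posdef (matrix_inv M)"
  unfolding posdef_def
proof (intro conjI allI impI)
  let ?I = "matrix_inv M"
  have inv: "invertible M" and tM: "transpose M = M"
    using assms posdef_invertible by (auto simp: posdef_def)
  have "transpose ?I ** M = mat 1"
    using matrix_inv_right[OF inv] tM by (metis matrix_transpose_mul transpose_mat)
  then show sym: "transpose ?I = ?I"
    using matrix_inv_right[OF inv] by (metis matrix_mul_assoc matrix_mul_lid matrix_mul_rid)
  fix w :: "real ^ 'a" assume "w \<noteq> 0"
  have w: "M *v (?I *v w) = w"
    using matrix_inv_right[OF inv] by (simp add: matrix_vector_mul_assoc)
  then have "?I *v w \<noteq> 0" using \<open>w \<noteq> 0\<close> by auto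
  then have "0 < (?I *v w) \<bullet> (M *v (?I *v w))" using assms unfolding posdef_def by blast
  then show "0 < w \<bullet> (?I *v w)" by (simp add: w inner_commute)
qed

lemma matrix_inv_eqI:
  fixes M N :: "real ^ 'i ^ 'i"
  assumes "invertible M" "N ** M = mat 1"
  shows "matrix_inv M = N"
  using matrix_inv_right[OF assms(1)] assms(2)
  by (metis matrix_mul_assoc matrix_mul_lid matrix_mul_rid)

lemma posdef_scaleR: "posdef M \<Longrightarrow> 0 < r \<Longrightarrow> posdef (r *\<^sub>R M)"
  unfolding posdef_def by (auto simp: transpose_scalar scaleR_matrix_vector_assoc[symmetric])

lemma matrix_inv_scaleR:
  fixes M :: "real ^ 'i ^ 'i"
  assumes "posdef M" "0 < r"
  shows "matrix_inv (r *\<^sub>R M) = inverse r *\<^sub>R matrix_inv M"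
proof (rule matrix_inv_eqI)
  show "invertible (r *\<^sub>R M)" using assms posdef_invertible posdef_scaleR by blast
  show "(inverse r *\<^sub>R matrix_inv M) ** (r *\<^sub>R M) = mat 1"
    using assms(2) matrix_inv_left[OF posdef_invertible[OF assms(1)]]
    by (simp add: scalar_matrix_assoc[symmetric] matrix_scalar_ac)
qed

text \<open>Cramer's rule for the solution of \<open>M w = axis j 1\<close>. It writes the inverse
  entries with sums, products and the reciprocal of a nonvanishing function, the operations under
  which smoothness is preserved.\<close>

lemma matrix_inv_cramer:
  fixes M :: "real ^ 'i ^ 'i"
  assumes "invertible M"
  shows "matrix_inv M $ i $ j = det (\<chi> a b. if b = i then axis j 1 $ a else M $ a $ b) * inverse (det M)"
proof -
  have "M *v (matrix_inv M *v axis j 1) = axis j 1"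
    using matrix_inv_right[OF assms] by (simp add: matrix_vector_mul_assoc)
  then have "matrix_inv M *v axis j 1 = (\<chi> k. det (\<chi> a b. if b = k then axis j 1 $ a else M $ a $ b) / det M)"
    using cramer[of M] assms invertible_det_nz by blast
  moreover have "(matrix_inv M *v axis j 1) $ i = matrix_inv M $ i $ j"
    by (simp add: matrix_vector_mul_component inner_axis)
  ultimately show ?thesis by (simp add: divide_inverse)
qed

lemma sum_delta_mult: "(\<Sum>k\<in>UNIV. (if i = k then 1 else 0) * f k) = f i"
  for f :: "'i::finite \<Rightarrow> real"
  by (simp add: if_distrib[of "\<lambda>x. x * c" for c :: real] cong: if_cong)

subsection \<open>Smoothness of the curvature\<close>

text \<open>Serves both the compactified metric, on a patch that may reach the boundary, and the
  singular metric \<open>g\<close>, on a patch of interior points.\<close>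

locale metric_patch =
  fixes S :: "(real ^ ('m::finite option)) set" and \<gamma> :: "real ^ ('m option) \<Rightarrow> real ^ ('m option) ^ ('m option)"
  assumes open_S: "openin (top_of_set halfspace) S"
    and smooth_metric: "smooth_on halfspace S \<gamma>"
    and posdef_metric: "y \<in> S \<Longrightarrow> posdef (\<gamma> y)"
begin

lemma smooth_comp: "smooth_on halfspace S (\<lambda>y. \<gamma> y $ i $ j)"
  by (rule smooth_on_nth_nth[OF open_S smooth_metric])

lemma smooth_matrix_inv: "smooth_on halfspace S (\<lambda>y. matrix_inv (\<gamma> y) $ i $ j)"
proof (subst smooth_on_cong[OF open_S])
  show "matrix_inv (\<gamma> z) $ i $ j
      = det (\<chi> a b. if b = i then axis j 1 $ a else \<gamma> z $ a $ b) * inverse (det (\<gamma> z))" if "z \<in> S" for z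
    using matrix_inv_cramer posdef_invertible posdef_metric that by blast
  have "smooth_on halfspace S (\<lambda>z. if b = i then axis j 1 $ a else \<gamma> z $ a $ b)" for a b
    by (cases "b = i") (simp_all add: smooth_on_const[OF open_S] smooth_comp)
  moreover have "det (\<gamma> z) \<noteq> 0" if "z \<in> S" for z
    using that posdef_metric posdef_invertible invertible_det_nz by blast
  ultimately show "smooth_on halfspace S
      (\<lambda>z. det (\<chi> a b. if b = i then axis j 1 $ a else \<gamma> z $ a $ b) * inverse (det (\<gamma> z)))"
    unfolding det_def
    by (intro smooth_on_mult[OF open_S] smooth_on_inverse[OF open_S] smooth_on_sum[OF open_S] smooth_on_prod[OF open_S])
      (simp_all add: smooth_on_const[OF open_S] smooth_comp)
qed

lemma smooth_christoffel: "smooth_on halfspace S (christoffel halfspace \<gamma> k i j)"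
  unfolding christoffel_def[abs_def]
  by (intro smooth_on_mult[OF open_S] smooth_on_sum[OF open_S] smooth_on_diff[OF open_S] smooth_on_add[OF open_S]
      smooth_on_const[OF open_S] smooth_matrix_inv smooth_on_pd[OF smooth_comp])

lemma smooth_riemann: "smooth_on halfspace S (riemann halfspace \<gamma> l k i j)"
  unfolding riemann_def[abs_def]
  by (intro smooth_on_mult[OF open_S] smooth_on_sum[OF open_S] smooth_on_diff[OF open_S] smooth_on_add[OF open_S]
      smooth_christoffel smooth_on_pd[OF smooth_christoffel])

lemma smooth_ricci: "smooth_on halfspace S (ricci halfspace \<gamma> i j)"
  unfolding ricci_def[abs_def] by (intro smooth_on_sum[OF open_S] smooth_riemann)

lemma smooth_scalar_curv: "smooth_on halfspace S (scalar_curv halfspace \<gamma>)"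
  unfolding scalar_curv_def[abs_def]
  by (intro smooth_on_mult[OF open_S] smooth_on_sum[OF open_S] smooth_matrix_inv smooth_ricci)

end

subsection \<open>Conformal change of the metric\<close>

text \<open>The conformal change of the Ricci tensor at a single point, with derivatives replaced by
  arrays: \<open>dg\<close> for the derivatives of the metric, \<open>u\<close> for the gradient of
  the conformal exponent and \<open>U\<close> for its derivatives, \<open>W\<close> for the second
  derivatives of the exponent, \<open>C\<close> for the difference of the Christoffel symbols and
  \<open>dC\<close> for its derivatives. Expressing everything through \<open>u\<close> keeps
  derivatives of the inverse metric out of the computation.\<close>

lemma conformal_ricci_algebra:
  fixes g W U :: "'i::finite \<Rightarrow> 'i \<Rightarrow> real" and \<Gamma> C :: "'i \<Rightarrow> 'i \<Rightarrow> 'i \<Rightarrow> real"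
    and dg :: "'i \<Rightarrow> 'i \<Rightarrow> 'i \<Rightarrow> real" and dC :: "'i \<Rightarrow> 'i \<Rightarrow> 'i \<Rightarrow> 'i \<Rightarrow> real" and v u :: "'i \<Rightarrow> real"
  assumes g: "\<And>i j. g i j = g j i" and \<Gamma>: "\<And>k i j. \<Gamma> k i j = \<Gamma> k j i"
    and v: "\<And>i. v i = (\<Sum>m\<in>UNIV. g i m * u m)"
    and dg: "\<And>i j k. dg i j k = (\<Sum>m\<in>UNIV. g k m * \<Gamma> m i j) + (\<Sum>m\<in>UNIV. g j m * \<Gamma> m i k)"
    and W: "\<And>i k. W i k = (\<Sum>m\<in>UNIV. dg i k m * u m) + (\<Sum>m\<in>UNIV. g k m * U i m)"
    and C: "\<And>k i j. C k i j = (if k = i then v j else 0) + (if k = j then v i else 0) - g i j * u k"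
    and dC: "\<And>i l j k. dC i l j k =
      (if l = j then W i k else 0) + (if l = k then W i j else 0) - (dg i j k * u l + g j k * U i l)"
  shows "(\<Sum>i\<in>UNIV. dC i i j k - dC j i i k
      + (\<Sum>m\<in>UNIV. (\<Gamma> i i m + C i i m) * (\<Gamma> m j k + C m j k) - (\<Gamma> i j m + C i j m) * (\<Gamma> m i k + C m i k)))
    = (\<Sum>i\<in>UNIV. \<Sum>m\<in>UNIV. \<Gamma> i i m * \<Gamma> m j k - \<Gamma> i j m * \<Gamma> m i k)
      + W k j + (1 - real CARD('i)) * W j k + (real CARD('i) - 2) * (\<Sum>m\<in>UNIV. v m * \<Gamma> m j k)
      - g j k * ((\<Sum>i\<in>UNIV. U i i) + (\<Sum>i\<in>UNIV. \<Sum>m\<in>UNIV. \<Gamma> i i m * u m))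
      + (real CARD('i) - 2) * (v j * v k - g j k * (\<Sum>m\<in>UNIV. v m * u m))"
proof -
  let ?d = "real CARD('i)"
  define N where "N = (\<Sum>m\<in>UNIV. v m * u m)"
  define \<tau> where "\<tau> m = (\<Sum>i\<in>UNIV. \<Gamma> i i m)" for m
  define K where "K j k = (\<Sum>m\<in>UNIV. v m * \<Gamma> m j k)" for j k
  note sums = sum.distrib sum_subtractf sum_distrib_left[symmetric] sum_distrib_right[symmetric]
  have vg: "(\<Sum>m\<in>UNIV. g m i * u m) = v i" "(\<Sum>m\<in>UNIV. u m * g i m) = v i" "(\<Sum>m\<in>UNIV. u m * g m i) = v i" for i
    using v g by (simp_all add: mult.commute)
  have dC1: "(\<Sum>i\<in>UNIV. dC i i j k) = W j k + W k j - (\<Sum>i\<in>UNIV. dg i j k * u i) - g j k * (\<Sum>i\<in>UNIV. U i i)"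
    by (simp add: dC sums)
  have Ws: "W j k = (\<Sum>m\<in>UNIV. dg j m k * u m) + (\<Sum>m\<in>UNIV. g m k * U j m)" for j k
    unfolding W using g dg by (simp add: add.commute)
  have dC2: "(\<Sum>i\<in>UNIV. dC j i i k) = ?d * W j k"
    using Ws[of j k] by (simp add: dC sums)
  have C1: "(\<Sum>m\<in>UNIV. X m * C m i k) = X i * v k + X k * v i - g i k * (\<Sum>m\<in>UNIV. X m * u m)" for X i k
  proof -
    have "X m * C m i k = (if m = i then X m * v k else 0) + (if m = k then X m * v i else 0) - g i k * (X m * u m)" for m
      by (simp add: C algebra_simps)
    then show ?thesis by (simp add: sums)
  qed
  have C2: "(\<Sum>m\<in>UNIV. C i j m * X m)
      = (if i = j then \<Sum>m\<in>UNIV. v m * X m else 0) + v j * X i - u i * (\<Sum>m\<in>UNIV. g j m * X m)" for X i j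
  proof -
    have "C i j m * X m = (if i = j then v m * X m else 0) + (if i = m then v j * X m else 0) - u i * (g j m * X m)" for m
      by (simp add: C algebra_simps)
    then show ?thesis by (simp add: sums)
  qed
  have Ct: "(\<Sum>i\<in>UNIV. C i i m) = ?d * v m" for m
    using vg(1)[of m] by (simp add: C sums)
  have t1: "(\<Sum>i\<in>UNIV. \<Sum>m\<in>UNIV. \<Gamma> i i m * C m j k) = \<tau> j * v k + \<tau> k * v j - g j k * (\<Sum>m\<in>UNIV. \<tau> m * u m)"
    unfolding C1[symmetric] unfolding \<tau>_def sum_distrib_right by (rule sum.swap)
  have t2: "(\<Sum>i\<in>UNIV. \<Sum>m\<in>UNIV. C i i m * \<Gamma> m j k) = ?d * K j k"
    by (subst sum.swap) (simp add: K_def sum_distrib_right[symmetric] Ct sum_distrib_left mult.assoc)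
  have t3: "(\<Sum>i\<in>UNIV. \<Sum>m\<in>UNIV. \<Gamma> i j m * C m i k)
      = \<tau> j * v k + K j k - (\<Sum>m\<in>UNIV. (\<Sum>i\<in>UNIV. g k i * \<Gamma> i m j) * u m)"
  proof -
    have "(\<Sum>i\<in>UNIV. g i k * (\<Sum>m\<in>UNIV. \<Gamma> i j m * u m)) = (\<Sum>m\<in>UNIV. (\<Sum>i\<in>UNIV. g k i * \<Gamma> i m j) * u m)"
      unfolding sum_distrib_left sum_distrib_right by (subst sum.swap) (simp add: g[of k] \<Gamma>[of _ j] mult.assoc)
    then show ?thesis
      unfolding C1 by (simp add: sums \<Gamma>[of _ j] K_def \<tau>_def mult.commute)
  qed
  have t4: "(\<Sum>i\<in>UNIV. \<Sum>m\<in>UNIV. C i j m * \<Gamma> m i k)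
      = K j k + \<tau> k * v j - (\<Sum>i\<in>UNIV. (\<Sum>m\<in>UNIV. g j m * \<Gamma> m i k) * u i)"
    by (simp add: C2 sums K_def \<tau>_def mult.commute)
  have t5: "(\<Sum>i\<in>UNIV. \<Sum>m\<in>UNIV. C i i m * C m j k) = ?d * (2 * v j * v k - g j k * N)"
    by (subst sum.swap)
      (simp add: sum_distrib_right[symmetric] Ct mult.assoc sum_distrib_left[symmetric] C1 N_def)
  have gC: "(\<Sum>m\<in>UNIV. g j m * C m i k) = g j i * v k + g j k * v i - g i k * v j" for i
    using C1[of "g j" i k] v[of j] by simp
  have t6: "(\<Sum>i\<in>UNIV. \<Sum>m\<in>UNIV. C i j m * C m i k) = (?d + 2) * v j * v k - 2 * g j k * N"
  proof -
    have "(\<Sum>i\<in>UNIV. u i * (g j i * v k + g j k * v i - g i k * v j)) = g j k * N"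
    proof -
      have "u i * (g j i * v k + g j k * v i - g i k * v j)
          = (u i * g j i) * v k + g j k * (v i * u i) - (u i * g i k) * v j" for i
        by (simp add: algebra_simps)
      then show ?thesis by (simp add: sums vg N_def)
    qed
    moreover have "(\<Sum>m\<in>UNIV. v m * C m j k) = 2 * v j * v k - g j k * N"
      by (simp add: C1 N_def)
    ultimately have "(\<Sum>i\<in>UNIV. \<Sum>m\<in>UNIV. C i j m * C m i k)
        = (2 * v j * v k - g j k * N) + v j * (?d * v k) - g j k * N"
      by (simp add: C2 gC sums Ct)
    then show ?thesis by (simp add: algebra_simps)
  qed
  \<comment> \<open>By metric compatibility the remainders containing \<open>u\<close> in
    \<open>t3\<close> and \<open>t4\<close> add up to the contracted derivative of the metric in
    \<open>dC1\<close>, and cancel it.\<close>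
  have dgu: "(\<Sum>i\<in>UNIV. dg i j k * u i) = (\<Sum>m\<in>UNIV. (\<Sum>i\<in>UNIV. g k i * \<Gamma> i m j) * u m)
      + (\<Sum>i\<in>UNIV. (\<Sum>m\<in>UNIV. g j m * \<Gamma> m i k) * u i)"
    by (simp add: dg distrib_right sum.distrib)
  have \<tau>u: "(\<Sum>i\<in>UNIV. \<Sum>m\<in>UNIV. \<Gamma> i i m * u m) = (\<Sum>m\<in>UNIV. \<tau> m * u m)"
    unfolding \<tau>_def sum_distrib_right by (rule sum.swap)
  have "(\<Sum>i\<in>UNIV. dC i i j k - dC j i i k
      + (\<Sum>m\<in>UNIV. (\<Gamma> i i m + C i i m) * (\<Gamma> m j k + C m j k) - (\<Gamma> i j m + C i j m) * (\<Gamma> m i k + C m i k)))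
    = (\<Sum>i\<in>UNIV. dC i i j k) - (\<Sum>i\<in>UNIV. dC j i i k)
      + (\<Sum>i\<in>UNIV. \<Sum>m\<in>UNIV. \<Gamma> i i m * \<Gamma> m j k - \<Gamma> i j m * \<Gamma> m i k)
      + (\<Sum>i\<in>UNIV. \<Sum>m\<in>UNIV. \<Gamma> i i m * C m j k) + (\<Sum>i\<in>UNIV. \<Sum>m\<in>UNIV. C i i m * \<Gamma> m j k)
      - (\<Sum>i\<in>UNIV. \<Sum>m\<in>UNIV. \<Gamma> i j m * C m i k) - (\<Sum>i\<in>UNIV. \<Sum>m\<in>UNIV. C i j m * \<Gamma> m i k)
      + (\<Sum>i\<in>UNIV. \<Sum>m\<in>UNIV. C i i m * C m j k) - (\<Sum>i\<in>UNIV. \<Sum>m\<in>UNIV. C i j m * C m i k)"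
    by (simp add: sum.distrib sum_subtractf distrib_left distrib_right)
  then show ?thesis
    unfolding dC1 dC2 t1 t2 t3 t4 t5 t6 \<tau>u dgu N_def[symmetric] K_def[symmetric]
    by (simp add: algebra_simps)
qed

text \<open>Metric compatibility turns the Hessian into the lowered covariant derivative
  \<open>Y\<close> of the gradient, and the inverse metric undoes the lowering. The trace term of
  the conformal change of Ricci appears as a divergence, and this identifies it with the
  Laplacian.\<close>

lemma laplacian_divergence_algebra:
  fixes g gi W U :: "'i::finite \<Rightarrow> 'i \<Rightarrow> real" and \<Gamma> :: "'i \<Rightarrow> 'i \<Rightarrow> 'i \<Rightarrow> real"
    and dg :: "'i \<Rightarrow> 'i \<Rightarrow> 'i \<Rightarrow> real" and v u :: "'i \<Rightarrow> real"
  assumes g: "\<And>i j. g i j = g j i" and gi: "\<And>i j. (\<Sum>l\<in>UNIV. gi i l * g l j) = (if i = j then 1 else 0)"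
    and v: "\<And>i. v i = (\<Sum>m\<in>UNIV. g i m * u m)"
    and dg: "\<And>i j k. dg i j k = (\<Sum>m\<in>UNIV. g k m * \<Gamma> m i j) + (\<Sum>m\<in>UNIV. g j m * \<Gamma> m i k)"
    and W: "\<And>i k. W i k = (\<Sum>m\<in>UNIV. dg i k m * u m) + (\<Sum>m\<in>UNIV. g k m * U i m)"
  shows "(\<Sum>i\<in>UNIV. \<Sum>j\<in>UNIV. gi i j * (W i j - (\<Sum>k\<in>UNIV. \<Gamma> k i j * v k)))
    = (\<Sum>i\<in>UNIV. U i i) + (\<Sum>i\<in>UNIV. \<Sum>m\<in>UNIV. \<Gamma> i i m * u m)"
proof -
  define Y where "Y i p = U i p + (\<Sum>m\<in>UNIV. \<Gamma> p i m * u m)" for i p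
  have "W i j - (\<Sum>k\<in>UNIV. \<Gamma> k i j * v k) = (\<Sum>p\<in>UNIV. g j p * Y i p)" for i j
  proof -
    have "(\<Sum>m\<in>UNIV. (\<Sum>p\<in>UNIV. g m p * \<Gamma> p i j) * u m) = (\<Sum>k\<in>UNIV. \<Gamma> k i j * v k)"
      unfolding v sum_distrib_left sum_distrib_right
      by (subst sum.swap) (simp add: g mult_ac)
    moreover have "(\<Sum>m\<in>UNIV. (\<Sum>p\<in>UNIV. g j p * \<Gamma> p i m) * u m) = (\<Sum>p\<in>UNIV. g j p * (\<Sum>m\<in>UNIV. \<Gamma> p i m * u m))"
      unfolding sum_distrib_left sum_distrib_right by (subst sum.swap) (simp add: mult_ac)
    ultimately show ?thesis
      unfolding W dg Y_def by (simp add: distrib_left distrib_right sum.distrib)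
  qed
  moreover have "(\<Sum>j\<in>UNIV. gi i j * (\<Sum>p\<in>UNIV. g j p * Y i p)) = Y i i" for i
  proof -
    have "(\<Sum>j\<in>UNIV. gi i j * (\<Sum>p\<in>UNIV. g j p * Y i p)) = (\<Sum>p\<in>UNIV. (\<Sum>j\<in>UNIV. gi i j * g j p) * Y i p)"
      unfolding sum_distrib_left sum_distrib_right by (subst sum.swap) (simp add: mult_ac)
    then show ?thesis by (simp add: gi sum_delta_mult)
  qed
  ultimately show ?thesis by (simp add: Y_def sum.distrib)
qed

section \<open>Identities of the Levi-Civita connection\<close>

context metric_patch
begin

lemma pd_metric_sym:
  assumes "y \<in> S"
  shows "pdh i (\<lambda>z. \<gamma> z $ j $ k) y = pdh i (\<lambda>z. \<gamma> z $ k $ j) y"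
  by (rule differentiable_cong_openin(3)[OF open_S assms]) (rule posdef_sym[OF posdef_metric])

lemma christoffel_sym: "y \<in> S \<Longrightarrow> christoffel halfspace \<gamma> k i j y = christoffel halfspace \<gamma> k j i y"
  unfolding christoffel_def using pd_metric_sym[of y _ i j] by (simp add: add.commute)

lemma christoffel_lower:
  assumes "y \<in> S"
  shows "(\<Sum>m\<in>UNIV. \<gamma> y $ k $ m * christoffel halfspace \<gamma> m i j y)
    = (1/2) * (pdh i (\<lambda>z. \<gamma> z $ j $ k) y + pdh j (\<lambda>z. \<gamma> z $ i $ k) y
        - pdh k (\<lambda>z. \<gamma> z $ i $ j) y)"
proof -
  define X where "X l = pdh i (\<lambda>z. \<gamma> z $ j $ l) y + pdh j (\<lambda>z. \<gamma> z $ i $ l) y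
        - pdh l (\<lambda>z. \<gamma> z $ i $ j) y" for l
  have "(\<Sum>m\<in>UNIV. \<gamma> y $ k $ m * (\<Sum>l\<in>UNIV. matrix_inv (\<gamma> y) $ m $ l * X l))
      = (\<Sum>l\<in>UNIV. (\<Sum>m\<in>UNIV. \<gamma> y $ k $ m * matrix_inv (\<gamma> y) $ m $ l) * X l)"
    unfolding sum_distrib_left sum_distrib_right by (subst sum.swap) (simp add: mult_ac)
  also have "\<dots> = X k"
    unfolding posdef_inv_mult[OF posdef_metric[OF assms]]
    by (simp add: sum_delta_mult)
  finally show ?thesis
    unfolding christoffel_def X_def by (simp add: sum_divide_distrib[symmetric])
qed

lemma metric_compatible:
  assumes "y \<in> S"
  shows "pdh i (\<lambda>z. \<gamma> z $ j $ k) y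
    = (\<Sum>m\<in>UNIV. \<gamma> y $ k $ m * christoffel halfspace \<gamma> m i j y)
      + (\<Sum>m\<in>UNIV. \<gamma> y $ j $ m * christoffel halfspace \<gamma> m i k y)"
  unfolding christoffel_lower[OF assms] using pd_metric_sym[OF assms] by (simp add: field_simps)

end

definition grad :: "(real ^ ('m::finite option) \<Rightarrow> real ^ ('m option) ^ ('m option)) \<Rightarrow> (real ^ ('m option) \<Rightarrow> real)
    \<Rightarrow> 'm option \<Rightarrow> real ^ ('m option) \<Rightarrow> real" where
  "grad \<gamma> v l y = (\<Sum>m\<in>UNIV. matrix_inv (\<gamma> y) $ l $ m * pdh m v y)"

definition grad_sq :: "(real ^ ('m::finite option) \<Rightarrow> real ^ ('m option) ^ ('m option)) \<Rightarrow> (real ^ ('m option) \<Rightarrow> real)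
    \<Rightarrow> real ^ ('m option) \<Rightarrow> real" where
  "grad_sq \<gamma> v y = (\<Sum>m\<in>UNIV. pdh m v y * grad \<gamma> v m y)"

text \<open>\<open>G\<close> is a parameter tied to the product only on \<open>S\<close>: it will be
  the compactified metric, which lives on a larger patch reaching the boundary, where the product
  has no meaning.\<close>

locale conformal_patch = metric_patch S \<gamma>
  for S :: "(real ^ ('m::finite option)) set" and \<gamma> +
  fixes v :: "real ^ ('m option) \<Rightarrow> real" and G
  assumes smooth_v: "smooth_on halfspace S v"
    and G_eq: "y \<in> S \<Longrightarrow> G y = exp (2 * v y) *\<^sub>R \<gamma> y"
begin

lemma smooth_grad: "smooth_on halfspace S (grad \<gamma> v l)"
  unfolding grad_def[abs_def]
  by (intro smooth_on_sum[OF open_S] smooth_on_mult[OF open_S] smooth_matrix_inv smooth_on_pd[OF smooth_v])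

lemma pd_eq_sum_grad:
  assumes "y \<in> S"
  shows "pdh i v y = (\<Sum>m\<in>UNIV. \<gamma> y $ i $ m * grad \<gamma> v m y)"
proof -
  have "(\<Sum>m\<in>UNIV. \<gamma> y $ i $ m * grad \<gamma> v m y)
      = (\<Sum>l\<in>UNIV. (\<Sum>m\<in>UNIV. \<gamma> y $ i $ m * matrix_inv (\<gamma> y) $ m $ l) * pdh l v y)"
    unfolding grad_def sum_distrib_left sum_distrib_right by (subst sum.swap) (simp add: mult_ac)
  then show ?thesis
    unfolding posdef_inv_mult[OF posdef_metric[OF assms]]
    by (simp add: sum_delta_mult)
qed

text \<open>Differentiates the lowered form \<open>pd_eq_sum_grad\<close> of the gradient, which
  yields the relation between \<open>W\<close> and \<open>U\<close> required by the algebraic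
  identities.\<close>

lemma pd_pd_eq_sum_grad:
  assumes "y \<in> S"
  shows "pdh i (pdh k v) y
    = (\<Sum>m\<in>UNIV. pdh i (\<lambda>z. \<gamma> z $ k $ m) y * grad \<gamma> v m y)
      + (\<Sum>m\<in>UNIV. \<gamma> y $ k $ m * pdh i (grad \<gamma> v m) y)"
proof -
  have y: "y \<in> halfspace" using in_halfspace[OF open_S assms] .
  have "pdh i (pdh k v) y = pdh i (\<lambda>z. \<Sum>m\<in>UNIV. \<gamma> z $ k $ m * grad \<gamma> v m z) y"
    by (rule differentiable_cong_openin(3)[OF open_S assms]) (rule pd_eq_sum_grad)
  also have "\<dots> = (\<Sum>m\<in>UNIV. pdh i (\<lambda>z. \<gamma> z $ k $ m * grad \<gamma> v m z) y)"
    by (rule pd_sum[OF y])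
      (rule smooth_on_differentiable[OF smooth_on_mult[OF open_S smooth_comp smooth_grad] assms])
  also have "\<dots> = (\<Sum>m\<in>UNIV. \<gamma> y $ k $ m * pdh i (grad \<gamma> v m) y
      + pdh i (\<lambda>z. \<gamma> z $ k $ m) y * grad \<gamma> v m y)"
    by (intro sum.cong refl pd_mult[OF y] smooth_on_differentiable[OF _ assms] smooth_comp smooth_grad)
  finally show ?thesis by (simp add: sum.distrib add.commute)
qed

lemma pd_G:
  assumes "y \<in> S"
  shows "pdh i (\<lambda>z. G z $ j $ k) y
    = exp (2 * v y) * (2 * pdh i v y * \<gamma> y $ j $ k + pdh i (\<lambda>z. \<gamma> z $ j $ k) y)"
proof -
  have y: "y \<in> halfspace" using in_halfspace[OF open_S assms] .
  have 2: "smooth_on halfspace S (\<lambda>z. 2 * v z)"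
    by (intro smooth_on_mult[OF open_S] smooth_on_const[OF open_S] smooth_v)
  have "pdh i (\<lambda>z. G z $ j $ k) y = pdh i (\<lambda>z. exp (2 * v z) * \<gamma> z $ j $ k) y"
    by (rule differentiable_cong_openin(3)[OF open_S assms]) (simp add: G_eq)
  also have "\<dots> = exp (2 * v y) * pdh i (\<lambda>z. \<gamma> z $ j $ k) y + pdh i (\<lambda>z. exp (2 * v z)) y * \<gamma> y $ j $ k"
    by (intro pd_mult[OF y] smooth_on_differentiable[OF _ assms] smooth_comp smooth_on_exp[OF open_S] 2)
  also have "pdh i (\<lambda>z. exp (2 * v z)) y = pdh i (\<lambda>z. 2 * v z) y * exp (2 * v y)"
    by (intro pd_exp[OF y] smooth_on_differentiable[OF _ assms] 2)
  also have "pdh i (\<lambda>z. 2 * v z) y = 2 * pdh i v y"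
    by (rule pd_bounded_linear[OF y bounded_linear_mult_right smooth_on_differentiable[OF smooth_v assms]])
  finally show ?thesis by (simp add: algebra_simps)
qed

lemma matrix_inv_G: "y \<in> S \<Longrightarrow> matrix_inv (G y) $ i $ j = exp (- (2 * v y)) * matrix_inv (\<gamma> y) $ i $ j"
  by (simp add: G_eq matrix_inv_scaleR posdef_metric exp_minus)

lemma christoffel_G:
  assumes "y \<in> S"
  shows "christoffel halfspace G k i j y = christoffel halfspace \<gamma> k i j y
    + ((if k = i then pdh j v y else 0) + (if k = j then pdh i v y else 0) - \<gamma> y $ i $ j * grad \<gamma> v k y)"
proof -
  let ?I = "\<lambda>k l. matrix_inv (\<gamma> y) $ k $ l" and ?v = "\<lambda>i. pdh i v y"
  have I: "(\<Sum>l\<in>UNIV. ?I k l * \<gamma> y $ j $ l) = (if k = j then 1 else 0)" for j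
    using posdef_inv_mult(1)[OF posdef_metric[OF assms], of k j] posdef_sym[OF posdef_metric[OF assms], of j] by simp
  have "christoffel halfspace G k i j y - christoffel halfspace \<gamma> k i j y
      = (\<Sum>l\<in>UNIV. ?I k l * (?v i * \<gamma> y $ j $ l + ?v j * \<gamma> y $ i $ l - ?v l * \<gamma> y $ i $ j))"
    unfolding christoffel_def sum_distrib_left sum_subtractf[symmetric]
    by (rule sum.cong) (simp_all add: pd_G[OF assms] matrix_inv_G[OF assms] exp_minus field_simps)
  also have "\<dots> = ?v i * (\<Sum>l\<in>UNIV. ?I k l * \<gamma> y $ j $ l) + ?v j * (\<Sum>l\<in>UNIV. ?I k l * \<gamma> y $ i $ l)
      - \<gamma> y $ i $ j * (\<Sum>l\<in>UNIV. ?I k l * ?v l)"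
    unfolding sum_distrib_left sum.distrib[symmetric] sum_subtractf[symmetric]
    by (rule sum.cong) (simp_all add: algebra_simps)
  finally show ?thesis unfolding I grad_def by (cases "k = i"; cases "k = j") auto
qed

lemma pd_christoffel_G:
  assumes "y \<in> S"
  shows "pdh l (christoffel halfspace G k i j) y = pdh l (christoffel halfspace \<gamma> k i j) y
    + ((if k = i then pdh l (pdh j v) y else 0) + (if k = j then pdh l (pdh i v) y else 0)
      - (pdh l (\<lambda>z. \<gamma> z $ i $ j) y * grad \<gamma> v k y + \<gamma> y $ i $ j * pdh l (grad \<gamma> v k) y))"
proof -
  have y: "y \<in> halfspace" using in_halfspace[OF open_S assms] .
  let ?v = "\<lambda>i. pdh i v"
  let ?P = "\<lambda>z. (if k = i then ?v j z else 0) + (if k = j then ?v i z else 0)"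
  note diff = smooth_on_differentiable[OF _ assms]
  have pv: "smooth_on halfspace S (\<lambda>z. if P then ?v j z else 0)" for P j
    by (cases P) (simp_all add: smooth_on_const[OF open_S] smooth_on_pd[OF smooth_v])
  have pdif: "pdh l (\<lambda>z. if P then ?v j z else 0) y = (if P then pdh l (?v j) y else 0)" for P j
    by (cases P) (simp_all add: pd_const[OF y])
  have gu: "smooth_on halfspace S (\<lambda>z. \<gamma> z $ i $ j * grad \<gamma> v k z)"
    by (intro smooth_on_mult[OF open_S] smooth_comp smooth_grad)
  have pp: "smooth_on halfspace S (\<lambda>z. ?P z)"
    by (intro smooth_on_add[OF open_S] pv)
  have "pdh l (christoffel halfspace G k i j) y = pdh l (\<lambda>z. christoffel halfspace \<gamma> k i j z
      + (?P z - \<gamma> z $ i $ j * grad \<gamma> v k z)) y"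
    by (rule differentiable_cong_openin(3)[OF open_S assms]) (rule christoffel_G)
  also have "\<dots> = pdh l (christoffel halfspace \<gamma> k i j) y + pdh l
      (\<lambda>z. ?P z - \<gamma> z $ i $ j * grad \<gamma> v k z) y"
    by (rule pd_add[OF y]) (intro diff smooth_christoffel smooth_on_diff[OF open_S] pp gu)+
  also have "pdh l
      (\<lambda>z. ?P z - \<gamma> z $ i $ j * grad \<gamma> v k z) y
      = pdh l (\<lambda>z. ?P z) y
        - pdh l (\<lambda>z. \<gamma> z $ i $ j * grad \<gamma> v k z) y"
    by (rule pd_diff[OF y]) (intro diff pp gu)+
  also have "pdh l (\<lambda>z. ?P z) y
      = pdh l (\<lambda>z. if k = i then ?v j z else 0) y + pdh l (\<lambda>z. if k = j then ?v i z else 0) y"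
    by (rule pd_add[OF y]) (intro diff pv)+
  also have "pdh l (\<lambda>z. \<gamma> z $ i $ j * grad \<gamma> v k z) y
      = \<gamma> y $ i $ j * pdh l (grad \<gamma> v k) y + pdh l (\<lambda>z. \<gamma> z $ i $ j) y * grad \<gamma> v k y"
    by (rule pd_mult[OF y]) (intro diff smooth_comp smooth_grad)+
  finally show ?thesis by (simp only: pdif)
qed

lemma laplacian_eq_divergence:
  assumes "y \<in> S"
  shows "laplacian halfspace \<gamma> v y = (\<Sum>i\<in>UNIV. pdh i (grad \<gamma> v i) y)
    + (\<Sum>i\<in>UNIV. \<Sum>m\<in>UNIV. christoffel halfspace \<gamma> i i m y * grad \<gamma> v m y)"
  unfolding laplacian_def
  by (rule laplacian_divergence_algebra[where g = "\<lambda>i j. \<gamma> y $ i $ j"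
        and dg = "\<lambda>i j k. pdh i (\<lambda>z. \<gamma> z $ j $ k) y"])
    (rule posdef_sym[OF posdef_metric[OF assms]] posdef_inv_mult[OF posdef_metric[OF assms]]
      pd_eq_sum_grad[OF assms] metric_compatible[OF assms] pd_pd_eq_sum_grad[OF assms])+

text \<open>With both orders of differentiation identified this is the classical formula Ric - (n -
  1) (Hess v - dv dv) - (Laplacian of v + (n - 1) |dv|^2) times the metric, n =
  \<open>CARD('m)\<close>. The dimension is n + 1, so the coefficients 1 - d and d - 2 of the
  algebraic identity become - n and n - 1.\<close>

lemma ricci_G:
  assumes "y \<in> S"
  shows "ricci halfspace G j k y = ricci halfspace \<gamma> j k y
    + pdh k (pdh j v) y - real CARD('m) * pdh j (pdh k v) y
    + (real CARD('m) - 1) * (\<Sum>m\<in>UNIV. christoffel halfspace \<gamma> m j k y * pdh m v y)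
    - \<gamma> y $ j $ k * laplacian halfspace \<gamma> v y
    + (real CARD('m) - 1) * (pdh j v y * pdh k v y - \<gamma> y $ j $ k * grad_sq \<gamma> v y)"
proof -
  let ?\<Gamma> = "\<lambda>k i j. christoffel halfspace \<gamma> k i j y" and ?\<Gamma>' = "\<lambda>k i j. christoffel halfspace G k i j y"
  let ?v = "\<lambda>i. pdh i v y" and ?u = "\<lambda>i. grad \<gamma> v i y"
  define C where "C k i j = ?\<Gamma>' k i j - ?\<Gamma> k i j" for k i j
  define dC where "dC i l j k
    = pdh i (christoffel halfspace G l j k) y - pdh i (christoffel halfspace \<gamma> l j k) y" for i l j k
  have C: "?\<Gamma>' k i j = ?\<Gamma> k i j + C k i j" for k i j by (simp add: C_def)
  note alg = conformal_ricci_algebra[where g = "\<lambda>i j. \<gamma> y $ i $ j" and W = "\<lambda>i k. pdh i (pdh k v) y"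
      and U = "\<lambda>i k. pdh i (grad \<gamma> v k) y" and \<Gamma> = ?\<Gamma> and C = C
      and dg = "\<lambda>i j k. pdh i (\<lambda>z. \<gamma> z $ j $ k) y" and dC = dC and v = ?v and u = ?u and j = j and k = k]
  have "ricci halfspace G j k y - ricci halfspace \<gamma> j k y
    = (\<Sum>i\<in>UNIV. dC i i j k - dC j i i k
      + (\<Sum>m\<in>UNIV. (?\<Gamma> i i m + C i i m) * (?\<Gamma> m j k + C m j k) - (?\<Gamma> i j m + C i j m) * (?\<Gamma> m i k + C m i k)))
    - (\<Sum>i\<in>UNIV. \<Sum>m\<in>UNIV. ?\<Gamma> i i m * ?\<Gamma> m j k - ?\<Gamma> i j m * ?\<Gamma> m i k)"
    unfolding ricci_def riemann_def C[symmetric] dC_def sum_subtractf[symmetric]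
    by (rule sum.cong) (simp_all add: sum_subtractf)
  moreover have "C k i j = (if k = i then ?v j else 0) + (if k = j then ?v i else 0) - \<gamma> y $ i $ j * ?u k" for k i j
    by (simp add: C_def christoffel_G[OF assms])
  moreover have "dC i l j k = (if l = j then pdh i (pdh k v) y else 0)
      + (if l = k then pdh i (pdh j v) y else 0)
      - (pdh i (\<lambda>z. \<gamma> z $ j $ k) y * ?u l + \<gamma> y $ j $ k * pdh i (grad \<gamma> v l) y)" for i l j k
    by (simp add: dC_def pd_christoffel_G[OF assms])
  note alg = alg[OF posdef_sym[OF posdef_metric[OF assms]] christoffel_sym[OF assms] pd_eq_sum_grad[OF assms]
      metric_compatible[OF assms] pd_pd_eq_sum_grad[OF assms] calculation(2) this]
  show ?thesis
    using calculation(1) unfolding alg laplacian_eq_divergence[OF assms] grad_sq_def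
    by (simp add: card_option mult.commute algebra_simps)
qed

end

context conformal_patch
begin

text \<open>The terms proportional to \<open>\<gamma>\<close> cancel because \<open>v\<close> solves \<open>\<Delta> v = - n\<close>. The two orders of
  differentiation are kept apart, so that the symmetry of second derivatives is never needed.\<close>

lemma scaled_einstein_ricci:
  assumes "y \<in> S" and ric: "\<And>i j. ricci halfspace \<gamma> i j y = - real CARD('m) * \<gamma> y $ i $ j"
    and lap: "laplacian halfspace \<gamma> v y = - real CARD('m)"
  shows "ricci halfspace G j k y = pdh k (pdh j v) y
    - real CARD('m) * pdh j (pdh k v) y
    + (real CARD('m) - 1) * (\<Sum>m\<in>UNIV. christoffel halfspace G m j k y * pdh m v y)
    - (real CARD('m) - 1) * (pdh j v y * pdh k v y)"
proof -
  \<comment> \<open>The Christoffel symbols of \<open>G\<close> will be smooth up to the boundary,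
    hence the change from those of \<gamma>. The change also produces the term that cancels
    \<open>grad_sq\<close>.\<close>
  have "(\<Sum>m\<in>UNIV. christoffel halfspace G m j k y * pdh m v y)
      = (\<Sum>m\<in>UNIV. christoffel halfspace \<gamma> m j k y * pdh m v y
          + (if m = j then pdh k v y * pdh j v y else 0)
          + (if m = k then pdh j v y * pdh k v y else 0)
          - \<gamma> y $ j $ k * (pdh m v y * grad \<gamma> v m y))"
    by (rule sum.cong) (simp_all add: christoffel_G[OF assms(1)] algebra_simps)
  also have "\<dots> = (\<Sum>m\<in>UNIV. christoffel halfspace \<gamma> m j k y * pdh m v y)
      + 2 * (pdh j v y * pdh k v y) - \<gamma> y $ j $ k * grad_sq \<gamma> v y"
    by (simp add: sum.distrib sum_subtractf sum_distrib_left[symmetric] grad_sq_def)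
  finally have eq: "(\<Sum>m\<in>UNIV. christoffel halfspace \<gamma> m j k y * pdh m v y)
      = (\<Sum>m\<in>UNIV. christoffel halfspace G m j k y * pdh m v y)
        - 2 * (pdh j v y * pdh k v y) + \<gamma> y $ j $ k * grad_sq \<gamma> v y"
    by simp
  show ?thesis
    unfolding ricci_G[OF assms(1)] ric lap eq by (simp add: algebra_simps)
qed

text \<open>The trace of the conformal formula. The Einstein term cancels the Laplacian term, the
  Hessian contributes (1 - n) (- n), and the squared gradient has coefficient (n - 1) - (n - 1) (n +
  1) = - n (n - 1), the trace of the metric being n + 1.\<close>

lemma scaled_einstein_scalar_curv:
  assumes "y \<in> S" and ric: "\<And>i j. ricci halfspace \<gamma> i j y = - real CARD('m) * \<gamma> y $ i $ j"
    and lap: "laplacian halfspace \<gamma> v y = - real CARD('m)"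
  shows "scalar_curv halfspace G y
    = real CARD('m) * (real CARD('m) - 1) * exp (- (2 * v y)) * (1 - grad_sq \<gamma> v y)"
proof -
  let ?n = "real CARD('m)"
  let ?I = "\<lambda>k l. matrix_inv (\<gamma> y) $ k $ l" and ?v = "\<lambda>i. pdh i v y"
  let ?W = "\<lambda>i j. pdh i (pdh j v) y"
  let ?K = "\<lambda>j k. \<Sum>m\<in>UNIV. christoffel halfspace \<gamma> m j k y * ?v m"
  have sym: "?I j k = ?I k j" for j k using posdef_sym[OF posdef_matrix_inv[OF posdef_metric[OF assms(1)]]] .
  have "(\<Sum>j\<in>UNIV. \<Sum>k\<in>UNIV. ?I j k * \<gamma> y $ j $ k) = (\<Sum>j\<in>UNIV. \<Sum>k\<in>UNIV. ?I j k * \<gamma> y $ k $ j)"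
    using posdef_sym[OF posdef_metric[OF assms(1)]] by simp
  also have "\<dots> = ?n + 1" unfolding posdef_inv_mult[OF posdef_metric[OF assms(1)]] by (simp add: card_option)
  finally have tr: "(\<Sum>j\<in>UNIV. \<Sum>k\<in>UNIV. ?I j k * \<gamma> y $ j $ k) = ?n + 1" .
  have sq: "(\<Sum>j\<in>UNIV. \<Sum>k\<in>UNIV. ?I j k * (?v j * ?v k)) = grad_sq \<gamma> v y"
    unfolding grad_sq_def grad_def sum_distrib_left by (simp add: mult_ac)
  \<comment> \<open>Contraction with the symmetric inverse metric makes the two orders of
    differentiation agree.\<close>
  have W: "(\<Sum>j\<in>UNIV. \<Sum>k\<in>UNIV. ?I j k * ?W k j) = (\<Sum>j\<in>UNIV. \<Sum>k\<in>UNIV. ?I j k * ?W j k)"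
    by (subst sum.swap) (simp add: sym)
  have lap': "(\<Sum>j\<in>UNIV. \<Sum>k\<in>UNIV. ?I j k * ?W j k) - (\<Sum>j\<in>UNIV. \<Sum>k\<in>UNIV. ?I j k * ?K j k) = - ?n"
    using lap unfolding laplacian_def by (simp add: right_diff_distrib sum_subtractf)
  have "scalar_curv halfspace G y = (\<Sum>j\<in>UNIV. \<Sum>k\<in>UNIV. exp (- (2 * v y)) *
      (?I j k * ?W k j - ?n * (?I j k * ?W j k) + (?n - 1) * (?I j k * ?K j k)
       + (?n - 1) * (?I j k * (?v j * ?v k)) - (?n - 1) * grad_sq \<gamma> v y * (?I j k * \<gamma> y $ j $ k)))"
    unfolding scalar_curv_def
    by (intro sum.cong refl) (simp add: matrix_inv_G[OF assms(1)] ricci_G[OF assms(1)] ric lap algebra_simps)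
  also have "\<dots> = exp (- (2 * v y)) *
      ((\<Sum>j\<in>UNIV. \<Sum>k\<in>UNIV. ?I j k * ?W k j) - ?n * (\<Sum>j\<in>UNIV. \<Sum>k\<in>UNIV. ?I j k * ?W j k)
       + (?n - 1) * (\<Sum>j\<in>UNIV. \<Sum>k\<in>UNIV. ?I j k * ?K j k)
       + (?n - 1) * (\<Sum>j\<in>UNIV. \<Sum>k\<in>UNIV. ?I j k * (?v j * ?v k))
       - (?n - 1) * grad_sq \<gamma> v y * (\<Sum>j\<in>UNIV. \<Sum>k\<in>UNIV. ?I j k * \<gamma> y $ j $ k))"
    by (simp only: sum_distrib_left[symmetric] sum.distrib sum_subtractf)
  also have "\<dots> = exp (- (2 * v y)) * ((1 - ?n) * (- ?n) + (?n - 1) * grad_sq \<gamma> v y - (?n - 1) * grad_sq \<gamma> v y * (?n + 1))"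
    unfolding tr sq W lap'[symmetric] by (simp add: algebra_simps)
  finally show ?thesis by (simp add: algebra_simps)
qed

end

subsection \<open>Boundary values\<close>

lemma has_vector_derivative_pd:
  fixes f :: "real ^ 'i \<Rightarrow> 'b::real_normed_vector"
  assumes "f differentiable (at (c t) within D)" "(c has_vector_derivative w) (at t within T)" "c ` T \<subseteq> D"
  shows "((\<lambda>s. f (c s)) has_vector_derivative (\<Sum>i\<in>UNIV. w $ i *\<^sub>R pd D i f (c t))) (at t within T)"
proof -
  have "(f has_derivative (\<lambda>u. \<Sum>i\<in>UNIV. u $ i *\<^sub>R pd D i f (c t))) (at (c t) within c ` T)"
    using has_derivative_pd[OF assms(1)] assms(3) has_derivative_subset by blast
  from has_derivative_in_compose[OF assms(2)[unfolded has_vector_derivative_def] this]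
  show ?thesis unfolding has_vector_derivative_def by (simp add: scaleR_right.sum)
qed

lemma add_axis_simps:
  fixes y :: "real ^ 'i"
  shows "dist (y + s *\<^sub>R axis i 1) y = \<bar>s\<bar>" "(y + s *\<^sub>R axis i 1) $ j = y $ j + (if i = j then s else 0)"
  by (auto simp: dist_norm axis_def) (simp add: norm_axis_1[unfolded axis_def])

lemma sum_axis_scaleR: "(\<Sum>i\<in>UNIV. axis k (1::real) $ i *\<^sub>R f i) = f k" for f :: "'i::finite \<Rightarrow> 'b::real_vector"
proof -
  have "axis k (1::real) $ i *\<^sub>R f i = (if i = k then f i else 0)" for i by (simp add: axis_def)
  then show ?thesis by simp
qed

lemma halfspace_ray:
  assumes "openin (top_of_set halfspace) S" "y \<in> S"
  obtains e where "e > 0" "\<And>s. 0 \<le> s \<Longrightarrow> s < e \<Longrightarrow> y + s *\<^sub>R axis None 1 \<in> S"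
proof -
  obtain e where e: "e > 0" "\<forall>z\<in>halfspace. dist z y < e \<longrightarrow> z \<in> S" and "y \<in> halfspace"
    using openin_halfspaceD[OF assms(1)] assms(2) by blast
  show ?thesis
  proof (rule that[OF e(1)])
    fix s :: real assume "0 \<le> s" "s < e"
    then show "y + s *\<^sub>R axis None 1 \<in> S"
      using e(2) \<open>y \<in> halfspace\<close> by (auto simp: halfspace_def add_axis_simps simp del: vector_add_component)
  qed
qed

text \<open>A tangential line through a boundary point stays in the boundary for a while in both
  directions, and \<open>f\<close> vanishes along it.\<close>

lemma pd_tangential_eq_0:
  assumes "openin (top_of_set halfspace) S" "y \<in> S" "y $ None = 0"
    and "f differentiable (at y within halfspace)" "\<And>z. z \<in> S \<Longrightarrow> z $ None = 0 \<Longrightarrow> f z = 0"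
  shows "pdh (Some \<alpha>) f y = 0"
proof -
  obtain e where e: "e > 0" "\<forall>z\<in>halfspace. dist z y < e \<longrightarrow> z \<in> S" and "y \<in> halfspace"
    using openin_halfspaceD[OF assms(1)] assms(2) by blast
  let ?c = "\<lambda>s. y + s *\<^sub>R axis (Some \<alpha>) (1::real)"
  have c: "(?c has_vector_derivative axis (Some \<alpha>) 1) (at 0 within ball 0 e)"
    by (auto intro!: derivative_eq_intros)
  have cS: "?c s \<in> S" "?c s $ None = 0" if "s \<in> ball 0 e" for s
    using that e(2) \<open>y \<in> halfspace\<close> assms(3)
    by (auto simp: halfspace_def add_axis_simps simp del: vector_add_component)
  have "((\<lambda>s. f (?c s)) has_vector_derivative (\<Sum>i\<in>UNIV. axis (Some \<alpha>) 1 $ i *\<^sub>R pdh i f (?c 0)))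
      (at 0 within ball 0 e)"
    using cS openin_halfspaceD(1)[OF assms(1)] by (intro has_vector_derivative_pd[OF _ c]) (auto simp: assms(4))
  moreover have "((\<lambda>s. f (?c s)) has_vector_derivative 0) (at 0 within ball 0 e)"
    by (rule has_vector_derivative_transform[OF _ _ has_vector_derivative_const[of 0]]) (use e cS assms(5) in auto)
  ultimately have "(\<Sum>i\<in>UNIV. axis (Some \<alpha>) 1 $ i *\<^sub>R pdh i f (?c 0)) = 0"
    by (rule vector_derivative_unique_within[rotated]) (use e(1) at_within_open[of "0::real" "ball 0 e"] in simp)
  then show ?thesis unfolding sum_axis_scaleR by simp
qed

lemma at_within_Ico_neq_bot:
  fixes a b t :: real
  assumes "a \<le> t" "t < b"
  shows "at t within {a..<b} \<noteq> bot"
proof -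
  have "at t within {t..<b} = at_right t"
    by (rule at_within_nhd[of t "{..<b}"]) (use assms in auto)
  moreover have "at t within {t..<b} \<le> at t within {a..<b}"
    by (rule at_le) (use assms in auto)
  ultimately show ?thesis by (metis bot.extremum_uniqueI trivial_limit_at_right_real)
qed

text \<open>Every point of the patch is a limit, along the inward axis, of points with positive
  transverse coordinate. This is how identities proved in the interior reach the boundary.\<close>

lemma eq_0_on_boundary:
  fixes f :: "real ^ ('m::finite option) \<Rightarrow> 'b::real_normed_vector"
  assumes "openin (top_of_set halfspace) S" "continuous_on S f" "\<And>z. z \<in> S \<Longrightarrow> 0 < z $ None \<Longrightarrow> f z = 0" "y \<in> S"
  shows "f y = 0"
proof -
  obtain e where e: "e > 0" "\<And>s. 0 \<le> s \<Longrightarrow> s < e \<Longrightarrow> y + s *\<^sub>R axis None 1 \<in> S"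
    using halfspace_ray[OF assms(1,4)] by blast
  have y: "0 \<le> y $ None" using openin_halfspaceD(1)[OF assms(1)] assms(4) by (auto simp: halfspace_def)
  have "continuous_on {0..<e} (\<lambda>s. f (y + s *\<^sub>R axis None 1))"
    by (rule continuous_on_compose2[OF assms(2)]) (use e in \<open>auto intro!: continuous_intros\<close>)
  then have "((\<lambda>s. f (y + s *\<^sub>R axis None 1)) \<longlongrightarrow> f (y + 0 *\<^sub>R axis None 1)) (at 0 within {0..<e})"
    unfolding continuous_on_def by (rule bspec) (use e(1) in simp)
  moreover have "((\<lambda>s. f (y + s *\<^sub>R axis None 1)) \<longlongrightarrow> 0) (at 0 within {0..<e})"
  proof (rule tendsto_eventually)
    have "f (y + s *\<^sub>R axis None 1) = 0" if "s \<in> {0..<e}" "s \<noteq> 0" for s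
      by (rule assms(3)) (use that e y in \<open>auto simp: add_axis_simps simp del: vector_add_component\<close>)
    then show "\<forall>\<^sub>F s in at 0 within {0..<e}. f (y + s *\<^sub>R axis None 1) = 0"
      by (auto simp: eventually_at_filter intro!: always_eventually)
  qed
  ultimately show ?thesis using tendsto_unique[OF at_within_Ico_neq_bot[OF order_refl e(1)]] by fastforce
qed

text \<open>A chart near the boundary. \<open>G\<close>, \<open>x\<close> and \<open>Z\<close> are
  smooth up to the boundary, whereas \<open>g\<close> and \<open>v\<close> are constrained only at
  positive transverse coordinate. \<open>Z\<close> stands for A + B \<open>x\<^sup>n\<close>; its
  special form enters only when the normal derivative of R is computed.\<close>

locale boundary_patch = metric_patch S G
  for S :: "(real ^ ('m::finite option)) set" and G +
  fixes x Z v :: "real ^ ('m option) \<Rightarrow> real" and g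
  assumes smooth_x: "smooth_on halfspace S x" and smooth_Z: "smooth_on halfspace S Z"
    and x_bdry: "y \<in> S \<Longrightarrow> y $ None = 0 \<Longrightarrow> x y = 0"
    and x_pos: "y \<in> S \<Longrightarrow> 0 < y $ None \<Longrightarrow> 0 < x y"
    and dx_nonzero: "y \<in> S \<Longrightarrow> y $ None = 0 \<Longrightarrow> \<exists>i. pdh i x y \<noteq> 0"
    and v_eq: "y \<in> S \<Longrightarrow> 0 < y $ None \<Longrightarrow> v y = ln (x y) + Z y"
    and conf: "conformal_patch (S \<inter> {y. 0 < y $ None}) g v G"
    and einstein: "y \<in> S \<Longrightarrow> 0 < y $ None \<Longrightarrow> ricci halfspace g i j y = - real CARD('m) * g y $ i $ j"
    and laplace: "y \<in> S \<Longrightarrow> 0 < y $ None \<Longrightarrow> laplacian halfspace g v y = - real CARD('m)"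
begin

sublocale int: conformal_patch "S \<inter> {y. 0 < y $ None}" g v G by (rule conf)

text \<open>Written through \<open>x\<close> and \<open>Z\<close>, so that it extends exp v smoothly
  to the boundary.\<close>

definition \<rho> where "\<rho> y = x y * exp (Z y)"

lemma smooth_\<rho>: "smooth_on halfspace S \<rho>"
  unfolding \<rho>_def[abs_def] by (intro smooth_on_mult[OF open_S] smooth_on_exp[OF open_S] smooth_x smooth_Z)

lemma \<rho>_eq: "y \<in> S \<inter> {y. 0 < y $ None} \<Longrightarrow> \<rho> y = exp (v y)"
  using v_eq x_pos by (simp add: \<rho>_def exp_add)

lemma \<rho>_bdry: "y \<in> S \<Longrightarrow> y $ None = 0 \<Longrightarrow> \<rho> y = 0"
  by (simp add: \<rho>_def x_bdry)

text \<open>\<open>x\<close> is constant on the boundary, so its nonzero differential must be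
  transverse; the sign comes from difference quotients, since \<open>x\<close> is positive
  inside.\<close>

lemma dx_pos:
  assumes "y \<in> S" "y $ None = 0"
  shows "0 < pdh None x y" "pdh (Some \<alpha>) x y = 0"
proof -
  have tang: "pdh (Some \<alpha>) x y = 0" for \<alpha>
    by (rule pd_tangential_eq_0[OF open_S assms smooth_on_differentiable[OF smooth_x assms(1)] x_bdry])
  then show "pdh (Some \<alpha>) x y = 0" .
  have "pdh None x y \<noteq> 0"
    using dx_nonzero[OF assms] tang by (metis not_None_eq)
  moreover have "0 \<le> pdh None x y"
  proof -
    obtain e where e: "e > 0" "\<And>s. 0 \<le> s \<Longrightarrow> s < e \<Longrightarrow> y + s *\<^sub>R axis None 1 \<in> S"
      using halfspace_ray[OF open_S assms(1)] by blast
    let ?c = "\<lambda>s. y + s *\<^sub>R axis None (1::real)"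
    have c: "(?c has_vector_derivative axis None 1) (at 0 within {0..<e})"
      by (auto intro!: derivative_eq_intros)
    have "((\<lambda>s. x (?c s)) has_vector_derivative (\<Sum>i\<in>UNIV. axis None 1 $ i *\<^sub>R pdh i x (?c 0)))
        (at 0 within {0..<e})"
      using e in_halfspace[OF open_S] smooth_on_differentiable[OF smooth_x assms(1)]
      by (intro has_vector_derivative_pd[OF _ c]) auto
    then have "((\<lambda>s. x (?c s)) has_real_derivative pdh None x y) (at 0 within {0..<e})"
      unfolding sum_axis_scaleR by (simp add: has_real_derivative_iff_has_vector_derivative)
    then have "((\<lambda>s. (x (?c s) - x y) / s) \<longlongrightarrow> pdh None x y) (at 0 within {0..<e})"
      by (simp add: has_field_derivative_iff)
    moreover have "(x (?c s) - x y) / s \<ge> 0" if "s \<in> {0..<e}" "s \<noteq> 0" for s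
    proof -
      have "0 < x (?c s)"
        by (rule x_pos) (use that e assms in \<open>auto simp: add_axis_simps simp del: vector_add_component\<close>)
      then show ?thesis using that x_bdry[OF assms] by simp
    qed
    then have "\<forall>\<^sub>F s in at 0 within {0..<e}. (x (?c s) - x y) / s \<ge> 0"
      by (auto simp: eventually_at_filter intro!: always_eventually)
    ultimately show ?thesis using tendsto_lowerbound[OF _ _ at_within_Ico_neq_bot[OF order_refl e(1)]] by blast
  qed
  ultimately show "0 < pdh None x y" by simp
qed

lemma pd_\<rho>_bdry:
  assumes "y \<in> S" "y $ None = 0"
  shows "0 < pdh None \<rho> y" "pdh (Some \<alpha>) \<rho> y = 0"
proof -
  note y = in_halfspace[OF open_S assms(1)] and diff = smooth_on_differentiable[OF _ assms(1)]
  have "pdh i \<rho> y = x y * pdh i (\<lambda>z. exp (Z z)) y + pdh i x y * exp (Z y)" for i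
    unfolding \<rho>_def[abs_def] by (intro pd_mult[OF y] diff smooth_x smooth_on_exp[OF open_S] smooth_Z)
  then have "pdh i \<rho> y = pdh i x y * exp (Z y)" for i
    by (simp add: x_bdry[OF assms])
  then show "0 < pdh None \<rho> y" "pdh (Some \<alpha>) \<rho> y = 0"
    using dx_pos[OF assms] by simp_all
qed

text \<open>Second derivatives of exp v produce exp v times the second derivatives of
  \<open>v\<close> plus the product of its first derivatives; this absorbs the quadratic term of
  \<open>scaled_einstein_ricci\<close>. After multiplication by \<open>\<rho>\<close> every term is
  smooth up to the boundary, and the identity extends.\<close>

lemma hessian_\<rho>:
  assumes "y \<in> S"
  shows "\<rho> y * ricci halfspace G j k y = pdh k (pdh j \<rho>) y
    - real CARD('m) * pdh j (pdh k \<rho>) y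
    + (real CARD('m) - 1) * (\<Sum>m\<in>UNIV. christoffel halfspace G m j k y * pdh m \<rho> y)"
proof -
  let ?R = "\<lambda>y. \<rho> y * ricci halfspace G j k y - (pdh k (pdh j \<rho>) y
    - real CARD('m) * pdh j (pdh k \<rho>) y
    + (real CARD('m) - 1) * (\<Sum>m\<in>UNIV. christoffel halfspace G m j k y * pdh m \<rho> y))"
  have "?R y = 0"
  proof (rule eq_0_on_boundary[OF open_S _ _ assms])
    show "continuous_on S ?R"
      by (rule smooth_on_continuous_on[of halfspace])
        (intro smooth_on_diff[OF open_S] smooth_on_add[OF open_S] smooth_on_mult[OF open_S] smooth_on_sum[OF open_S]
          smooth_on_const[OF open_S] smooth_ricci smooth_christoffel smooth_on_pd smooth_\<rho>)
    fix z assume "z \<in> S" "0 < z $ None"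
    then have z: "z \<in> S \<inter> {y. 0 < y $ None}" by simp
    note zh = in_halfspace[OF int.open_S z] and diff = smooth_on_differentiable[OF _ z]
    have p1: "pdh i \<rho> w = exp (v w) * pdh i v w" if "w \<in> S \<inter> {y. 0 < y $ None}" for i w
    proof -
      have "pdh i \<rho> w = pdh i (\<lambda>z. exp (v z)) w"
        by (rule differentiable_cong_openin(3)[OF int.open_S that]) (rule \<rho>_eq)
      also have "\<dots> = pdh i v w * exp (v w)"
        by (rule pd_exp[OF in_halfspace[OF int.open_S that] smooth_on_differentiable[OF int.smooth_v that]])
      finally show ?thesis by simp
    qed
    have p2: "pdh i (pdh l \<rho>) z
        = exp (v z) * (pdh i (pdh l v) z + pdh i v z * pdh l v z)" for i l
    proof -
      have "pdh i (pdh l \<rho>) z = pdh i (\<lambda>z. exp (v z) * pdh l v z) z"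
        by (rule differentiable_cong_openin(3)[OF int.open_S z]) (rule p1)
      also have "\<dots> = exp (v z) * pdh i (pdh l v) z + pdh i (\<lambda>z. exp (v z)) z * pdh l v z"
        by (rule pd_mult[OF zh]) (intro diff smooth_on_exp[OF int.open_S] int.smooth_v smooth_on_pd)+
      also have "pdh i (\<lambda>z. exp (v z)) z = pdh i v z * exp (v z)"
        by (rule pd_exp[OF zh diff[OF int.smooth_v]])
      finally show ?thesis by (simp add: algebra_simps)
    qed
    have \<Gamma>: "(\<Sum>m\<in>UNIV. christoffel halfspace G m j k z * pdh m \<rho> z)
        = exp (v z) * (\<Sum>m\<in>UNIV. christoffel halfspace G m j k z * pdh m v z)"
      unfolding sum_distrib_left by (simp add: p1[OF z] mult_ac)
    have ein: "ricci halfspace g i j z = - real CARD('m) * g z $ i $ j" for i j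
      using einstein z by blast
    have lap: "laplacian halfspace g v z = - real CARD('m)" using laplace z by blast
    show "?R z = 0"
      unfolding p2 \<rho>_eq[OF z] \<Gamma> int.scaled_einstein_ricci[OF z ein lap] by (simp add: algebra_simps)
  qed
  then show ?thesis by simp
qed

text \<open>At the boundary the left side of \<open>hessian_\<rho>\<close> vanishes, and so do the
  tangential second derivatives, because the tangential first derivatives of \<open>\<rho>\<close>
  vanish along the boundary. What remains is n - 1 times the symbol times the positive transverse
  derivative of \<open>\<rho>\<close>; n = 1 would make the equation empty.\<close>

lemma christoffel_bdry:
  assumes "y \<in> S" "y $ None = 0" "CARD('m) \<noteq> 1"
  shows "christoffel halfspace G None (Some \<alpha>) (Some \<beta>) y = 0"
proof -
  have tt: "pdh (Some \<alpha>) (pdh (Some \<beta>) \<rho>) y = 0" for \<alpha> \<beta>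
    by (rule pd_tangential_eq_0[OF open_S assms(1,2)])
      (auto intro: smooth_on_differentiable[OF smooth_on_pd[OF smooth_\<rho>] assms(1)] pd_\<rho>_bdry(2))
  have "(\<Sum>m\<in>UNIV. christoffel halfspace G m (Some \<alpha>) (Some \<beta>) y * pdh m \<rho> y) = 0"
    using hessian_\<rho>[OF assms(1), of "Some \<alpha>" "Some \<beta>"] \<rho>_bdry[OF assms(1,2)] tt assms(3) by simp
  moreover have "(\<Sum>m\<in>UNIV. christoffel halfspace G m (Some \<alpha>) (Some \<beta>) y * pdh m \<rho> y)
      = christoffel halfspace G None (Some \<alpha>) (Some \<beta>) y * pdh None \<rho> y"
    using pd_\<rho>_bdry(2)[OF assms(1,2)] by (simp add: UNIV_option_conv sum.reindex)
  ultimately show ?thesis using pd_\<rho>_bdry(1)[OF assms(1,2)] by simp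
qed

text \<open>The lowered normal is a multiple of the conormal, so the second fundamental form sees
  only the Christoffel symbols with upper index \<open>None\<close>.\<close>

lemma outer_normal_lower:
  assumes "y \<in> S"
  shows "(\<Sum>k\<in>UNIV. G y $ k $ l * outer_normal G y $ k)
    = (if l = None then - 1 / sqrt (matrix_inv (G y) $ None $ None) else 0)"
proof -
  have "(\<Sum>k\<in>UNIV. G y $ k $ l * outer_normal G y $ k)
      = - (\<Sum>k\<in>UNIV. G y $ l $ k * matrix_inv (G y) $ k $ None) / sqrt (matrix_inv (G y) $ None $ None)"
    using posdef_sym[OF posdef_metric[OF assms], of l]
    by (simp add: outer_normal_def sum_divide_distrib sum_negf)
  then show ?thesis by (simp add: posdef_inv_mult[OF posdef_metric[OF assms]])
qed

lemma second_ff_eq_0: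
  assumes "bemb z \<in> S" "CARD('m) \<noteq> 1"
  shows "second_ff G z = 0"
proof -
  have b: "bemb z $ None = 0" by (simp add: bemb_def)
  have "(\<Sum>k\<in>UNIV. \<Sum>l\<in>UNIV. G (bemb z) $ k $ l * outer_normal G (bemb z) $ k
        * christoffel halfspace G l (Some \<alpha>) (Some \<beta>) (bemb z)) = 0" for \<alpha> \<beta>
    by (subst sum.swap)
      (simp add: sum_distrib_right[symmetric] outer_normal_lower[OF assms(1)] christoffel_bdry[OF assms(1) b assms(2)]
        if_distrib[of "\<lambda>x. x * c" for c :: real] cong: if_cong)
  then show ?thesis by (simp add: second_ff_def vec_eq_iff)
qed

end

subsection \<open>The boundary curvature in a chart\<close>

lemma pd_UNIV_locally_0:
  assumes "open U" "z \<in> U" "\<And>w. w \<in> U \<Longrightarrow> f w = 0"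
  shows "pd UNIV i f z = 0"
proof -
  have "pd UNIV i f z = pd UNIV i (\<lambda>_. 0) z"
    by (rule differentiable_cong_openin(3)[of _ U]) (use assms in auto)
  then show ?thesis by (simp add: pd_def)
qed

text \<open>Vanishing is assumed on an open set because T contains the boundary Laplacian of the
  mean curvature. The other terms that drop out have a factor L or H at the point itself.\<close>

lemma T_curv_totally_geodesic:
  assumes "open U" "z \<in> U" "\<And>w. w \<in> U \<Longrightarrow> second_ff G w = 0"
  shows "T_curv G z = (1/12) * (\<Sum>i\<in>UNIV. outer_normal G (bemb z) $ i
                  * pdh i (scalar_curv halfspace G) (bemb z))"
proof -
  have shape: "shape_op G w = 0" if "w \<in> U" for w
    using assms(3)[OF that] by (simp add: shape_op_def)
  then have H: "mean_curv G w = 0" if "w \<in> U" for w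
    using that by (simp add: mean_curv_def trace_def)
  have 1: "pd UNIV j (mean_curv G) w = 0" if "w \<in> U" for w j
    by (rule pd_UNIV_locally_0[OF assms(1) that H])
  have "pd UNIV i (pd UNIV j (mean_curv G)) z = 0" for i j
    by (rule pd_UNIV_locally_0[OF assms(1,2) 1])
  then have "laplacian UNIV (bmetric G) (mean_curv G) z = 0"
    using 1[OF assms(2)] by (simp add: laplacian_def)
  then show ?thesis
    unfolding T_curv_def using shape[OF assms(2)] H[OF assms(2)] assms(3)[OF assms(2)]
    by (simp add: trace_def)
qed

text \<open>By the mean value theorem \<open>f t - a * t\<close> is \<open>(f' s - a) * t\<close>
  for some s between 0 and t, and \<open>f' s - a\<close> is o(s). For \<open>f\<close> the first
  derivative of A along a curve, the conditions at 0 are the vanishing of the first and third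
  derivatives, which is what evenness of A supplies.\<close>

lemma quadratic_remainder:
  fixes f f' :: "real \<Rightarrow> real"
  assumes "0 < \<delta>" and f: "\<And>t. t \<in> {0..<\<delta>} \<Longrightarrow> (f has_real_derivative f' t) (at t within {0..<\<delta>})"
    and "f 0 = 0" "f' 0 = a" and f': "(f' has_real_derivative 0) (at 0 within {0..<\<delta>})"
  shows "((\<lambda>t. (f t - a * t) / t\<^sup>2) \<longlongrightarrow> 0) (at 0 within {0..<\<delta>})"
proof (rule tendstoI)
  fix e :: real assume "e > 0"
  have "((\<lambda>t. (f' t - a) / t) \<longlongrightarrow> 0) (at 0 within {0..<\<delta>})"
    using f' assms(4) by (simp add: has_field_derivative_iff)
  then have "\<forall>\<^sub>F t in at 0 within {0..<\<delta>}. dist ((f' t - a) / t) 0 < e"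
    using tendstoD \<open>e > 0\<close> by blast
  then obtain d where d: "d > 0" "\<And>t. t \<in> {0..<\<delta>} \<Longrightarrow> t \<noteq> 0 \<Longrightarrow> dist t 0 < d \<Longrightarrow> \<bar>f' t - a\<bar> / \<bar>t\<bar> < e"
    unfolding eventually_at by (auto simp: abs_divide)
  have "\<bar>(f t - a * t) / t\<^sup>2\<bar> < e" if t: "t \<in> {0..<\<delta>}" "t \<noteq> 0" "dist t 0 < d" for t
  proof -
    have "0 < t" using t by simp
    let ?k = "\<lambda>s. f s - a * s"
    have k: "(?k has_real_derivative (f' s - a)) (at s within {0..t})" if "s \<in> {0..t}" for s
    proof -
      have "(f has_real_derivative f' s) (at s within {0..t})"
        by (rule DERIV_subset[OF f]) (use that t in auto)
      then show ?thesis by (auto intro!: derivative_eq_intros)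
    qed
    obtain s where s: "s \<in> {0<..<t}" "?k t - ?k 0 = (f' s - a) * (t - 0)"
      using mvt_simple[OF \<open>0 < t\<close>, of ?k "\<lambda>s h. (f' s - a) * h"] k
      unfolding has_field_derivative_def by fastforce
    then have "\<bar>f' s - a\<bar> < e * s" using d(2)[of s] t by (auto simp: field_simps)
    also have "e * s \<le> e * t" using s \<open>e > 0\<close> by simp
    finally have "\<bar>f t - a * t\<bar> < e * t * t"
      using s assms(3) \<open>0 < t\<close> by (simp add: abs_mult)
    then show ?thesis using \<open>0 < t\<close> by (simp add: abs_divide power2_eq_square field_simps)
  qed
  then show "\<forall>\<^sub>F t in at 0 within {0..<\<delta>}. dist ((f t - a * t) / t\<^sup>2) 0 < e"
    unfolding eventually_at using d(1) by (auto intro!: exI[of _ d])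
qed

section \<open>Expansion of the scalar curvature along the collar curves\<close>

context boundary_patch
begin

lemma scalar_curv_int:
  assumes "y \<in> S" "0 < y $ None"
  shows "scalar_curv halfspace G y * (\<rho> y)\<^sup>2
    = real CARD('m) * (real CARD('m) - 1) * (1 - (\<rho> y)\<^sup>2
        * (\<Sum>i\<in>UNIV. pdh i v y * (\<Sum>j\<in>UNIV. matrix_inv (G y) $ i $ j * pdh j v y)))"
proof -
  have y: "y \<in> S \<inter> {y. 0 < y $ None}" using assms by simp
  have r: "(\<rho> y)\<^sup>2 = exp (2 * v y)" by (simp add: \<rho>_eq[OF y] exp_double)
  have "grad_sq g v y = exp (2 * v y)
      * (\<Sum>i\<in>UNIV. pdh i v y * (\<Sum>j\<in>UNIV. matrix_inv (G y) $ i $ j * pdh j v y))"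
    unfolding grad_sq_def grad_def sum_distrib_left
    by (simp add: int.matrix_inv_G[OF y] exp_minus field_simps)
  moreover have "scalar_curv halfspace G y
    = real CARD('m) * (real CARD('m) - 1) * exp (- (2 * v y)) * (1 - grad_sq g v y)"
    using einstein laplace y by (intro int.scaled_einstein_scalar_curv[OF y]) auto
  ultimately show ?thesis unfolding r by (simp add: exp_minus field_simps)
qed

text \<open>Comes from differentiating \<open>\<rho>\<close> both as exp v and as x exp Z and
  cancelling exp Z.\<close>

lemma pd_v_int:
  assumes "y \<in> S" "0 < y $ None"
  shows "pdh i v y = pdh i x y / x y + pdh i Z y"
proof -
  have y: "y \<in> S \<inter> {y. 0 < y $ None}" using assms by simp
  note yh = in_halfspace[OF open_S assms(1)] and diff = smooth_on_differentiable[OF _ assms(1)]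
  have "pdh i \<rho> y = pdh i (\<lambda>z. exp (v z)) y"
    by (rule differentiable_cong_openin(3)[OF int.open_S y]) (rule \<rho>_eq)
  also have "\<dots> = pdh i v y * exp (v y)"
    by (rule pd_exp[OF yh smooth_on_differentiable[OF int.smooth_v y]])
  finally have 1: "pdh i \<rho> y = pdh i v y * (x y * exp (Z y))"
    using \<rho>_eq[OF y] by (simp add: \<rho>_def)
  have "pdh i \<rho> y = x y * pdh i (\<lambda>z. exp (Z z)) y + pdh i x y * exp (Z y)"
    unfolding \<rho>_def[abs_def] by (intro pd_mult[OF yh] diff smooth_x smooth_on_exp[OF open_S] smooth_Z)
  also have "pdh i (\<lambda>z. exp (Z z)) y = pdh i Z y * exp (Z y)"
    by (rule pd_exp[OF yh diff[OF smooth_Z]])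
  finally have "pdh i v y * x y * exp (Z y) = (x y * pdh i Z y + pdh i x y) * exp (Z y)"
    using 1 by (simp add: algebra_simps)
  then have "pdh i v y * x y = x y * pdh i Z y + pdh i x y" by simp
  then show ?thesis using x_pos[OF assms] by (simp add: field_simps)
qed

text \<open>Here \<open>w\<close> is the gradient of \<open>x\<close> in the metric \<open>x\<^sup>2 g = exp (-2 Z) G\<close>. It is the velocity of
  the curves \<open>t \<mapsto> \<Phi> (p, t)\<close>, so the sum over \<open>w $ i\<close> becomes a derivative in \<open>t\<close>.\<close>

lemma scalar_curv_along:
  assumes "y \<in> S" "0 < y $ None" "x y = t"
    and flow: "\<And>i. (\<Sum>j\<in>UNIV. G y $ i $ j * w $ j) = exp (2 * Z y) * pdh i x y"
    and unit: "(\<Sum>i\<in>UNIV. w $ i * pdh i x y) = 1"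
  shows "scalar_curv halfspace G y * exp (2 * Z y) = - real CARD('m) * (real CARD('m) - 1) *
    (2 * (\<Sum>i\<in>UNIV. w $ i * pdh i Z y) / t + exp (2 * Z y) *
      (\<Sum>i\<in>UNIV. pdh i Z y * (\<Sum>j\<in>UNIV. matrix_inv (G y) $ i $ j * pdh j Z y)))"
proof -
  let ?x = "\<lambda>i. pdh i x y" and ?Z = "\<lambda>i. pdh i Z y" and ?I = "\<lambda>i j. matrix_inv (G y) $ i $ j"
  have t: "t > 0" using x_pos assms(1-3) by blast
  note pd = posdef_metric[OF assms(1)]
  have w: "(\<Sum>j\<in>UNIV. ?I i j * ?x j) = exp (- (2 * Z y)) * w $ i" for i
  proof -
    have "(\<Sum>j\<in>UNIV. ?I i j * (exp (2 * Z y) * ?x j)) = (\<Sum>k\<in>UNIV. (\<Sum>j\<in>UNIV. ?I i j * G y $ j $ k) * w $ k)"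
      unfolding flow[symmetric] sum_distrib_left sum_distrib_right by (subst sum.swap) (simp add: mult_ac)
    also have "\<dots> = w $ i"
      unfolding posdef_inv_mult[OF pd] by (simp add: sum_delta_mult)
    finally have "exp (2 * Z y) * (\<Sum>j\<in>UNIV. ?I i j * ?x j) = w $ i"
      unfolding sum_distrib_left by (simp add: mult_ac)
    then show ?thesis by (simp add: exp_minus field_simps)
  qed
  have sym: "?I i j = ?I j i" for i j by (rule posdef_sym[OF posdef_matrix_inv[OF pd]])
  \<comment> \<open>By \<open>unit\<close> the differential of \<open>x\<close> has length one in
    the metric exp (-2 Z) \<open>G\<close>; in \<open>G\<close> itself its squared length acquires
    the factor exp (-2 Z).\<close>
  have xx: "(\<Sum>i\<in>UNIV. ?x i * (\<Sum>j\<in>UNIV. ?I i j * ?x j)) = exp (- (2 * Z y))"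
  proof -
    have "(\<Sum>i\<in>UNIV. ?x i * (exp (- (2 * Z y)) * w $ i)) = exp (- (2 * Z y)) * (\<Sum>i\<in>UNIV. w $ i * ?x i)"
      unfolding sum_distrib_left by (simp add: mult_ac)
    then show ?thesis unfolding w using unit by simp
  qed
  have Zx: "(\<Sum>i\<in>UNIV. ?Z i * (\<Sum>j\<in>UNIV. ?I i j * ?x j)) = exp (- (2 * Z y)) * (\<Sum>i\<in>UNIV. w $ i * ?Z i)"
    unfolding w sum_distrib_left by (simp add: mult_ac)
  have xZ: "(\<Sum>i\<in>UNIV. ?x i * (\<Sum>j\<in>UNIV. ?I i j * ?Z j)) = exp (- (2 * Z y)) * (\<Sum>i\<in>UNIV. w $ i * ?Z i)"
  proof -
    have "?x i * (?I i j * ?Z j) = ?Z j * (?I j i * ?x i)" for i j using sym[of i j] by simp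
    then show ?thesis unfolding Zx[symmetric] unfolding sum_distrib_left by (subst sum.swap, intro sum.cong refl)
  qed
  have "(\<Sum>i\<in>UNIV. pdh i v y * (\<Sum>j\<in>UNIV. ?I i j * pdh j v y))
      = (\<Sum>i\<in>UNIV. ?x i * (\<Sum>j\<in>UNIV. ?I i j * ?x j)) / t\<^sup>2
        + (\<Sum>i\<in>UNIV. ?Z i * (\<Sum>j\<in>UNIV. ?I i j * ?x j)) / t
        + (\<Sum>i\<in>UNIV. ?x i * (\<Sum>j\<in>UNIV. ?I i j * ?Z j)) / t
        + (\<Sum>i\<in>UNIV. ?Z i * (\<Sum>j\<in>UNIV. ?I i j * ?Z j))"
    unfolding pd_v_int[OF assms(1,2)] assms(3) sum_divide_distrib sum_distrib_left sum.distrib[symmetric]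
    by (intro sum.cong refl) (simp add: power2_eq_square add_divide_distrib algebra_simps)
  also have "\<dots> = exp (- (2 * Z y)) / t\<^sup>2 + 2 * exp (- (2 * Z y)) * (\<Sum>i\<in>UNIV. w $ i * ?Z i) / t
      + (\<Sum>i\<in>UNIV. ?Z i * (\<Sum>j\<in>UNIV. ?I i j * ?Z j))"
    unfolding xx Zx xZ by simp
  finally have dv: "(\<Sum>i\<in>UNIV. pdh i v y * (\<Sum>j\<in>UNIV. ?I i j * pdh j v y)) = \<dots>" .
  have "(\<rho> y)\<^sup>2 = t\<^sup>2 * exp (2 * Z y)"
    by (simp add: \<rho>_def assms(3) power_mult_distrib exp_double)
  moreover define E W q where "E = exp (2 * Z y)" and "W = (\<Sum>i\<in>UNIV. w $ i * ?Z i)"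
    and "q = (\<Sum>i\<in>UNIV. ?Z i * (\<Sum>j\<in>UNIV. ?I i j * ?Z j))"
  \<comment> \<open>The part of the squared gradient of order \<open>t\<^sup>-\<^sup>2\<close>
    contributes exactly 1. This cancels the 1 in 1 - \<open>|d v|\<^sub>g\<^sup>2\<close>, and the
    factor \<open>t\<^sup>2\<close> can be divided out.\<close>
  moreover have "t\<^sup>2 * E * (inverse E / t\<^sup>2 + 2 * inverse E * W / t + q) = 1 + t\<^sup>2 * (2 * W / t + E * q)"
    using t by (simp add: E_def field_simps power2_eq_square)
  ultimately have "scalar_curv halfspace G y * (t\<^sup>2 * E)
      = real CARD('m) * (real CARD('m) - 1) * - (t\<^sup>2 * (2 * W / t + E * q))"
    using scalar_curv_int[OF assms(1,2)] unfolding dv by (simp add: exp_minus)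
  then have "t\<^sup>2 * (scalar_curv halfspace G y * E)
      = t\<^sup>2 * (- real CARD('m) * (real CARD('m) - 1) * (2 * W / t + E * q))"
    by (simp add: mult_ac)
  then show ?thesis
    unfolding E_def[symmetric] W_def[symmetric] q_def[symmetric] by (rule mult_left_cancel[THEN iffD1, rotated]) (use t in simp)
qed

end

lemma bounded_linear_bemb: "bounded_linear bemb"
  by (auto intro!: linear_conv_bounded_linear[THEN iffD1] linearI simp: bemb_def vec_eq_iff split: option.splits)

lemma continuous_on_bemb: "continuous_on U bemb"
  by (rule linear_continuous_on[OF bounded_linear_bemb])

lemma bemb_in_halfspace: "bemb z \<in> halfspace"
  by (simp add: bemb_def halfspace_def)

lemma open_vimage_bemb:
  assumes "openin (top_of_set halfspace) S"
  shows "open (bemb -` S)"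
proof -
  obtain T where "open T" "S = halfspace \<inter> T" using assms by (auto simp: openin_open)
  then have "bemb -` S = bemb -` T" using bemb_in_halfspace by auto
  then show ?thesis by (simp add: open_vimage[OF \<open>open T\<close> continuous_on_bemb])
qed

text \<open>Where \<open>Z\<close> vanishes, \<open>w\<close> is the gradient of \<open>x\<close>
  for \<open>G\<close>. It is orthogonal to the boundary because \<open>x\<close> is constant there,
  it has length one by \<open>unit\<close>, and it points inward because the transverse derivative
  of \<open>x\<close> is positive.\<close>

lemma outer_normal_flow:
  assumes "boundary_patch S G x Z v g" "y \<in> S" "y $ None = 0" "Z y = 0"
    and flow: "\<And>i. (\<Sum>j\<in>UNIV. G y $ i $ j * w $ j) = exp (2 * Z y) * pdh i x y"
    and unit: "(\<Sum>i\<in>UNIV. w $ i * pdh i x y) = 1"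
  shows "outer_normal G y = - w"
proof -
  interpret boundary_patch S G x Z v g by fact
  note dx = dx_pos[OF assms(2,3)]
  let ?I = "\<lambda>i j. matrix_inv (G y) $ i $ j"
  have w: "w $ i = ?I i None * pdh None x y" for i
  proof -
    have "(\<Sum>j\<in>UNIV. ?I i j * pdh j x y) = (\<Sum>k\<in>UNIV. (\<Sum>j\<in>UNIV. ?I i j * G y $ j $ k) * w $ k)"
      using flow assms(4) unfolding sum_distrib_left sum_distrib_right
      by (subst sum.swap) (simp add: mult.assoc sum_distrib_left[symmetric])
    also have "\<dots> = w $ i"
      unfolding posdef_inv_mult[OF posdef_metric[OF assms(2)]]
      by (simp add: sum_delta_mult)
    finally show ?thesis using dx(2) by (simp add: UNIV_option_conv sum.reindex)
  qed
  have "w $ None * pdh None x y = 1"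
    using unit dx(2) by (simp add: UNIV_option_conv sum.reindex)
  then have "?I None None * (pdh None x y)\<^sup>2 = 1" by (simp add: w power2_eq_square mult.assoc)
  then have "?I None None = (1 / pdh None x y)\<^sup>2"
    using dx(1) by (simp add: field_simps power2_eq_square)
  then have "sqrt (?I None None) = 1 / pdh None x y"
    using dx(1) by (simp add: real_sqrt_unique)
  then show ?thesis by (simp add: outer_normal_def vec_eq_iff w)
qed

theorem T_curv_boundary:
  fixes S :: "(real ^ (3 option)) set"
  assumes bp: "boundary_patch S G x Z v g"
    and Z: "\<And>y. y \<in> S \<Longrightarrow> Z y = A y + B y * x y ^ 3"
    and A0: "\<And>y. y \<in> S \<Longrightarrow> y $ None = 0 \<Longrightarrow> A y = 0"
    and "0 < \<delta>" and cS: "\<And>t. t \<in> {0..<\<delta>} \<Longrightarrow> c t \<in> S" and xc: "\<And>t. t \<in> {0..<\<delta>} \<Longrightarrow> x (c t) = t"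
    and c0: "c 0 = bemb z"
    and c': "\<And>t. t \<in> {0..<\<delta>} \<Longrightarrow> (c has_vector_derivative c' t) (at t within {0..<\<delta>})"
    and flow: "\<And>t i. t \<in> {0..<\<delta>} \<Longrightarrow>
      (\<Sum>j\<in>UNIV. G (c t) $ i $ j * c' t $ j) = exp (2 * Z (c t)) * pdh i x (c t)"
    and a1: "\<And>t. t \<in> {0..<\<delta>} \<Longrightarrow> ((\<lambda>s. A (c s)) has_real_derivative a1 t) (at t within {0..<\<delta>})"
    and a2: "\<And>t. t \<in> {0..<\<delta>} \<Longrightarrow> (a1 has_real_derivative a2 t) (at t within {0..<\<delta>})"
    and a3: "(a2 has_real_derivative 0) (at 0 within {0..<\<delta>})" and a10: "a1 0 = 0"
    and b1: "\<And>t. t \<in> {0..<\<delta>} \<Longrightarrow> ((\<lambda>s. B (c s)) has_real_derivative b1 t) (at t within {0..<\<delta>})"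
    and b1': "(b1 \<longlongrightarrow> b1 0) (at 0 within {0..<\<delta>})"
  shows "T_curv G z = 3 * B (bemb z)"
proof -
  interpret boundary_patch S G x Z v g by fact
  let ?F = "at (0::real) within {0..<\<delta>}" and ?y = "bemb z" and ?R = "scalar_curv halfspace G"
  have bot: "?F \<noteq> bot" using at_within_Ico_neq_bot[OF order_refl \<open>0 < \<delta>\<close>] .
  have 0: "(0::real) \<in> {0..<\<delta>}" using \<open>0 < \<delta>\<close> by simp
  have y: "?y \<in> S" "?y $ None = 0" using cS[OF 0] c0 by (simp_all add: bemb_def)
  have cH: "c ` {0..<\<delta>} \<subseteq> halfspace" using cS in_halfspace[OF open_S] by blast
  have along: "((\<lambda>s. f (c s)) has_real_derivative (\<Sum>i\<in>UNIV. c' t $ i * pdh i f (c t))) (at t within {0..<\<delta>})"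
    if "smooth_on halfspace S f" "t \<in> {0..<\<delta>}" for f :: "real ^ (3 option) \<Rightarrow> real" and t
    using has_vector_derivative_pd[OF smooth_on_differentiable[OF that(1) cS[OF that(2)]] c'[OF that(2)] cH]
    by (simp add: has_real_derivative_iff_has_vector_derivative)
  have uniq: "d = e" if "(f has_real_derivative d) (at t within {0..<\<delta>})" "(f has_real_derivative e) (at t within {0..<\<delta>})"
    "t \<in> {0..<\<delta>}" for f :: "real \<Rightarrow> real" and d e t
    using that at_within_Ico_neq_bot[of 0 t \<delta>] vector_derivative_unique_within
    by (auto simp: has_real_derivative_iff_has_vector_derivative)
  have unit: "(\<Sum>i\<in>UNIV. c' t $ i * pdh i x (c t)) = 1" if "t \<in> {0..<\<delta>}" for t
  proof (rule uniq[OF along[OF smooth_x that] _ that])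
    show "((\<lambda>s. x (c s)) has_real_derivative 1) (at t within {0..<\<delta>})"
      by (rule has_field_derivative_transform_within[OF DERIV_ident zero_less_one that]) (use xc in auto)
  qed
  have int: "0 < c t $ None" if "t \<in> {0..<\<delta>}" "t \<noteq> 0" for t
  proof -
    have "c t $ None \<noteq> 0" using x_bdry[OF cS[OF that(1)]] xc[OF that(1)] that(2) by auto
    then show ?thesis using in_halfspace[OF open_S cS[OF that(1)]] by (simp add: halfspace_def)
  qed
  \<comment> \<open>The derivative of A + B \<open>t\<^sup>3\<close> along the curve, where
    \<open>x\<close> has the value t.\<close>
  define Z1 where "Z1 t = a1 t + 3 * t\<^sup>2 * B (c t) + t ^ 3 * b1 t" for t
  have Z1: "(\<Sum>i\<in>UNIV. c' t $ i * pdh i Z (c t)) = Z1 t" if t: "t \<in> {0..<\<delta>}" for t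
  proof (rule uniq[OF along[OF smooth_Z t] _ t])
    have "((\<lambda>s. A (c s) + B (c s) * s ^ 3) has_real_derivative Z1 t) (at t within {0..<\<delta>})"
      unfolding Z1_def by (auto intro!: derivative_eq_intros a1[OF t] b1[OF t])
    then show "((\<lambda>s. Z (c s)) has_real_derivative Z1 t) (at t within {0..<\<delta>})"
      by (rule has_field_derivative_transform_within[OF _ zero_less_one t]) (use xc cS Z in auto)
  qed
  have Zbd: "Z w = 0" if "w \<in> S" "w $ None = 0" for w using Z A0 x_bdry that by simp
  \<comment> \<open>Tangential derivatives vanish because \<open>Z\<close> is zero on the boundary.
    The derivative along the curve vanishes because \<open>a1 0 = 0\<close>, and the curve is
    transverse, so the remaining derivative vanishes too. Consequently the quadratic term
    \<open>Q\<close> is o(t).\<close>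
  have dZ0: "pdh i Z ?y = 0" for i
  proof -
    have tang: "pdh (Some \<alpha>) Z ?y = 0" for \<alpha>
      by (rule pd_tangential_eq_0[OF open_S y smooth_on_differentiable[OF smooth_Z y(1)] Zbd])
    have "c' 0 $ None * pdh None x ?y = 1"
      using unit[OF 0] dx_pos(2)[OF y] by (simp add: c0 UNIV_option_conv sum.reindex)
    moreover have "c' 0 $ None * pdh None Z ?y = 0"
      using Z1[OF 0] tang a10 by (simp add: c0 UNIV_option_conv sum.reindex Z1_def)
    ultimately have "pdh None Z ?y = 0" by auto
    then show ?thesis using tang by (cases i) auto
  qed
  define Q where "Q t = (\<Sum>i\<in>UNIV. pdh i Z (c t)
      * (\<Sum>j\<in>UNIV. matrix_inv (G (c t)) $ i $ j * pdh j Z (c t)))" for t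
  have lim: "((\<lambda>s. f (c s)) \<longlongrightarrow> f ?y) ?F" if "smooth_on halfspace S f" for f :: "real ^ (3 option) \<Rightarrow> real"
    using DERIV_continuous[OF along[OF that 0]] by (simp add: continuous_within c0)
  have "((\<lambda>t. Q t / t) \<longlongrightarrow> (\<Sum>i\<in>UNIV. (\<Sum>k\<in>UNIV. c' 0 $ k * pdh k (pdh i Z) ?y)
      * (\<Sum>j\<in>UNIV. matrix_inv (G ?y) $ i $ j * pdh j Z ?y))) ?F"
  proof -
    have "((\<lambda>t. \<Sum>i\<in>UNIV. pdh i Z (c t) / t * (\<Sum>j\<in>UNIV. matrix_inv (G (c t)) $ i $ j * pdh j Z (c t)))
      \<longlongrightarrow> (\<Sum>i\<in>UNIV. (\<Sum>k\<in>UNIV. c' 0 $ k * pdh k (pdh i Z) ?y)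
      * (\<Sum>j\<in>UNIV. matrix_inv (G ?y) $ i $ j * pdh j Z ?y))) ?F"
    proof (intro tendsto_sum tendsto_mult)
      show "((\<lambda>t. pdh i Z (c t) / t) \<longlongrightarrow> (\<Sum>k\<in>UNIV. c' 0 $ k * pdh k (pdh i Z) ?y)) ?F" for i
        using along[OF smooth_on_pd[OF smooth_Z] 0, of i] by (simp add: has_field_derivative_iff c0 dZ0)
    qed (intro lim smooth_matrix_inv smooth_on_pd smooth_Z)+
    then show ?thesis unfolding Q_def by (simp add: sum_divide_distrib)
  qed
  then have Qlim: "((\<lambda>t. Q t / t) \<longlongrightarrow> 0) ?F" by (simp add: dZ0)
  \<comment> \<open>Since \<open>Z\<close> and its derivative along the curve vanish at t = 0, the
    factor exp (2 Z) changes neither the value nor the first derivative of R there.\<close>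
  define m where "m t = ?R (c t) * exp (2 * Z (c t))" for t
  define r1 where "r1 = (\<Sum>i\<in>UNIV. c' 0 $ i * pdh i ?R ?y)"
  have m': "(m has_real_derivative r1) ?F"
  proof -
    have "((\<lambda>t. Z (c t)) has_real_derivative 0) ?F"
      using along[OF smooth_Z 0] by (simp add: c0 dZ0)
    moreover have "((\<lambda>t. ?R (c t)) has_real_derivative r1) ?F"
      using along[OF smooth_scalar_curv 0] by (simp add: c0 r1_def)
    ultimately show ?thesis
      unfolding m_def by (auto intro!: derivative_eq_intros simp: c0 Zbd[OF y])
  qed
  have m_eq: "m t = - 12 * (Z1 t / t) - 6 * (exp (2 * Z (c t)) * Q t)" if "t \<in> {0..<\<delta>}" "t \<noteq> 0" for t
    unfolding m_def
    using scalar_curv_along[OF cS[OF that(1)] int[OF that] xc[OF that(1)] flow[OF that(1)] unit[OF that(1)]]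
    by (simp add: Z1[OF that(1)] Q_def algebra_simps)
  \<comment> \<open>Here 12 = 2 n (n - 1) for n = 3, and 36 = 12 * 3 with 3 from the derivative of
    \<open>t\<^sup>3\<close>. The linear part of \<open>a1\<close> gives the constant - 12 *
    \<open>a2 0\<close>; its next term would compete with B and is excluded by
    \<open>quadratic_remainder\<close>.\<close>
  have lim36: "((\<lambda>t. (m t + 12 * a2 0) / t) \<longlongrightarrow> - 36 * B ?y) ?F"
  proof (rule Lim_transform_eventually)
    let ?L = "\<lambda>t. - 12 * ((a1 t - a2 0 * t) / t\<^sup>2) - 36 * B (c t) - 12 * (t * b1 t) - 6 * (exp (2 * Z (c t)) * (Q t / t))"
    have LB: "((\<lambda>t. B (c t)) \<longlongrightarrow> B ?y) ?F"
      using DERIV_continuous[OF b1[OF 0]] by (simp add: continuous_within c0)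
    have La: "((\<lambda>t. (a1 t - a2 0 * t) / t\<^sup>2) \<longlongrightarrow> 0) ?F"
      by (rule quadratic_remainder[OF \<open>0 < \<delta>\<close> a2 a10 refl a3])
    have Le: "((\<lambda>t. exp (2 * Z (c t))) \<longlongrightarrow> exp (2 * Z ?y)) ?F"
      by (intro tendsto_intros lim smooth_Z)
    have "(?L \<longlongrightarrow> - 12 * 0 - 36 * B ?y - 12 * (0 * b1 0) - 6 * (exp (2 * Z ?y) * 0)) ?F"
      by (intro tendsto_diff tendsto_mult tendsto_const tendsto_ident_at LB La Le Qlim b1')
    then show "(?L \<longlongrightarrow> - 36 * B ?y) ?F"
      by simp
    show "\<forall>\<^sub>F t in ?F. ?L t
        = (m t + 12 * a2 0) / t"
      unfolding eventually_at_filter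
      by (rule always_eventually)
        (auto simp: m_eq Z1_def field_simps power2_eq_square power3_eq_cube)
  qed
  \<comment> \<open>The quotient has a finite limit, so its numerator tends to zero. This determines
    \<open>m 0\<close>, and the quotient becomes the difference quotient of
    \<open>m\<close>.\<close>
  have "((\<lambda>t. (m t + 12 * a2 0) / t * t) \<longlongrightarrow> - 36 * B ?y * 0) ?F"
    by (intro tendsto_mult lim36 tendsto_ident_at)
  then have "((\<lambda>t. m t + 12 * a2 0) \<longlongrightarrow> 0) ?F"
    by (simp add: Lim_transform_eventually eventually_at_filter)
  moreover have "((\<lambda>t. m t + 12 * a2 0) \<longlongrightarrow> m 0 + 12 * a2 0) ?F"
    using DERIV_continuous[OF m'] by (intro tendsto_intros) (simp add: continuous_within)
  ultimately have m0: "m 0 = - 12 * a2 0" using tendsto_unique[OF bot] by fastforce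
  have "((\<lambda>t. (m t + 12 * a2 0) / t) \<longlongrightarrow> r1) ?F"
    using m' by (simp add: has_field_derivative_iff m0)
  then have r1: "r1 = - 36 * B ?y" using tendsto_unique[OF bot _ lim36] by blast
  have "outer_normal G ?y = - c' 0"
    by (rule outer_normal_flow[OF bp y Zbd[OF y]])
      (use flow[OF 0] unit[OF 0] in \<open>simp_all add: c0\<close>)
  moreover have "T_curv G z = (1/12) * (\<Sum>i\<in>UNIV. outer_normal G ?y $ i * pdh i ?R ?y)"
  proof (rule T_curv_totally_geodesic)
    show "open (bemb -` S :: (real ^ 3) set)" by (rule open_vimage_bemb[OF open_S])
  qed (use y second_ff_eq_0 in auto)
  ultimately show ?thesis
    using r1 unfolding r1_def by (simp add: sum_negf)
qed

subsection \<open>Charts of a manifold with boundary\<close>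

lemma open_halfspace_int:
  assumes "openin (top_of_set halfspace) S"
  shows "open (S \<inter> {y. 0 < y $ None})"
proof -
  obtain T where "open T" "S = halfspace \<inter> T" using assms by (auto simp: openin_open)
  then have "S \<inter> {y. 0 < y $ None} = T \<inter> {y. 0 < y $ None}" by (auto simp: halfspace_def)
  moreover have "open {y :: real ^ ('a option). 0 < y $ None}"
    by (intro open_Collect_less continuous_intros)
  ultimately show ?thesis using \<open>open T\<close> by auto
qed

lemma bcoord_bemb: "bcoord (bemb z) = z"
  by (simp add: bcoord_def bemb_def vec_eq_iff)

lemma bemb_bcoord: "y $ None = 0 \<Longrightarrow> bemb (bcoord y) = y"
  by (auto simp: bcoord_def bemb_def vec_eq_iff split: option.splits)

lemma riemannian_metric_onD: "riemannian_metric_on N U h \<Longrightarrow> c \<in> atlas N \<Longrightarrow> p \<in> fst c \<inter> U \<Longrightarrow> posdef (h c p)"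
  unfolding riemannian_metric_on_def posdef_def by blast

locale compact_mfd =
  fixes N :: "('a, ('m::finite) option) mfd"
  assumes mfd: "compact_manifold_with_boundary N"
begin

lemma model_eq [simp]: "model N = halfspace"
  using mfd by (simp add: compact_manifold_with_boundary_def)

lemma chart_open:
  assumes "c \<in> atlas N"
  shows "openin (mtop N) (fst c)" "fst c \<subseteq> topspace (mtop N)"
  using mfd assms openin_subset by (auto simp: compact_manifold_with_boundary_def)

lemma chart_homeo:
  "c \<in> atlas N \<Longrightarrow> homeomorphic_map (subtopology (mtop N) (fst c)) (top_of_set (snd c ` fst c)) (snd c)"
  using mfd by (simp add: compact_manifold_with_boundary_def)

lemma chart_image_open:
  assumes c: "c \<in> atlas N" and U: "openin (mtop N) U"
  shows "openin (top_of_set halfspace) (snd c ` (fst c \<inter> U))"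
proof -
  have "openin (top_of_set (snd c ` fst c)) (snd c ` (fst c \<inter> U))"
    using homeomorphic_imp_open_map[OF chart_homeo[OF c]] openin_subtopology_Int2[OF U, of "fst c"]
    by (auto simp: open_map_def)
  moreover have "openin (top_of_set halfspace) (snd c ` fst c)"
    using mfd c by (simp add: compact_manifold_with_boundary_def)
  ultimately show ?thesis by (rule openin_trans)
qed

lemma chart_inj: "c \<in> atlas N \<Longrightarrow> inj_on (snd c) (fst c)"
  using homeomorphic_imp_injective_map[OF chart_homeo, of c] chart_open(2)[of c]
  by (simp add: Int_absorb1)

lemma coord_inv_chart: "c \<in> atlas N \<Longrightarrow> p \<in> fst c \<Longrightarrow> coord_inv c (snd c p) = p"
  unfolding coord_inv_def using chart_inj inv_into_f_f by metis

lemma chart_coord_inv: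
  assumes "y \<in> snd c ` fst c"
  shows "snd c (coord_inv c y) = y" "coord_inv c y \<in> fst c"
  unfolding coord_inv_def using assms by (auto intro: f_inv_into_f inv_into_into)

lemma chart_halfspace: "c \<in> atlas N \<Longrightarrow> p \<in> fst c \<Longrightarrow> snd c p \<in> halfspace"
  using openin_halfspaceD(1)[OF chart_image_open[of c "fst c"]] chart_open(1) by auto

lemma chart_continuous: "c \<in> atlas N \<Longrightarrow> continuous_map (subtopology (mtop N) (fst c)) euclidean (snd c)"
  using homeomorphic_imp_continuous_map[OF chart_homeo] continuous_map_in_subtopology by blast

lemma continuous_coord_inv:
  assumes c: "c \<in> atlas N"
  shows "continuous_map (top_of_set (snd c ` fst c)) (mtop N) (coord_inv c)"
proof -
  obtain k where k: "homeomorphic_maps (subtopology (mtop N) (fst c)) (top_of_set (snd c ` fst c)) (snd c) k"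
    using chart_homeo[OF c] homeomorphic_map_maps by blast
  then have "continuous_map (top_of_set (snd c ` fst c)) (mtop N) k"
    unfolding homeomorphic_maps_def using continuous_map_in_subtopology by blast
  moreover have "k y = coord_inv c y" if "y \<in> snd c ` fst c" for y
    using k that coord_inv_chart[OF c] chart_open(2)[OF c] unfolding homeomorphic_maps_def by fastforce
  ultimately show ?thesis by (rule continuous_map_eq) simp
qed

text \<open>Invariance of the boundary. If a point were interior in one chart and on the face of
  another, invariance of domain would make the image of the transition map contain a full ball
  around the boundary coordinate, yet all images lie in the half-space.\<close>

lemma bdry_iff:
  assumes c: "c \<in> atlas N" and p: "p \<in> fst c"
  shows "p \<in> bdry N \<longleftrightarrow> snd c p $ None = 0"
proof
  show "snd c p $ None = 0 \<Longrightarrow> p \<in> bdry N"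
    unfolding bdry_def using c p chart_open(2) by blast
  assume "p \<in> bdry N"
  then obtain d where d: "d \<in> atlas N" "p \<in> fst d" "snd d p $ None = 0" by (auto simp: bdry_def)
  show "snd c p $ None = 0"
  proof (rule ccontr)
    assume "snd c p $ None \<noteq> 0"
    then have pos: "0 < snd c p $ None" using chart_halfspace[OF c p] by (simp add: halfspace_def)
    define U where "U = snd c ` (fst c \<inter> fst d) \<inter> {y. 0 < y $ None}"
    let ?f = "snd d \<circ> coord_inv c"
    have U: "open U"
      unfolding U_def by (rule open_halfspace_int[OF chart_image_open[OF c chart_open(1)[OF d(1)]]])
    have sub: "U \<subseteq> snd c ` (fst c \<inter> fst d)" by (auto simp: U_def)
    have "continuous_map (top_of_set (snd c ` (fst c \<inter> fst d))) (subtopology (mtop N) (fst d)) (coord_inv c)"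
      unfolding continuous_map_in_subtopology
      using continuous_map_from_subtopology_mono[OF continuous_coord_inv[OF c], of "snd c ` (fst c \<inter> fst d)"]
        coord_inv_chart[OF c] by auto
    then have "continuous_map (top_of_set (snd c ` (fst c \<inter> fst d))) euclidean ?f"
      using chart_continuous[OF d(1)] by (rule continuous_map_compose)
    then have "continuous_on U ?f" using sub continuous_on_subset by auto
    moreover have "inj_on ?f U"
    proof (rule inj_onI)
      fix y z assume "y \<in> U" "z \<in> U" and eq: "?f y = ?f z"
      then obtain q r where "y = snd c q" "q \<in> fst c" "q \<in> fst d" "z = snd c r" "r \<in> fst c" "r \<in> fst d"
        using sub by blast
      then show "y = z" using eq coord_inv_chart[OF c] inj_onD[OF chart_inj[OF d(1)]] by auto
    qed
    ultimately have "open (?f ` U)" using U invariance_of_domain by blast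
    moreover have "snd d p \<in> ?f ` U"
      using p d(2) pos coord_inv_chart[OF c p] unfolding U_def by force
    ultimately obtain e where e: "e > 0" "ball (snd d p) e \<subseteq> ?f ` U" by (rule openE)
    \<comment> \<open>A point of the ball strictly below the face of the half-space.\<close>
    have "snd d p + (- (e/2)) *\<^sub>R axis None 1 \<in> ball (snd d p) e"
      using e(1) add_axis_simps(1)[of "snd d p" "- (e/2)" None] by (simp add: dist_commute)
    then obtain y where y: "y \<in> U" "?f y = snd d p + (- (e/2)) *\<^sub>R axis None 1" using e(2) by (metis (no_types, lifting) imageE subset_iff)
    then have "coord_inv c y \<in> fst d" using sub coord_inv_chart[OF c] by auto
    then have "0 \<le> ?f y $ None" using chart_halfspace[OF d(1)] by (simp add: halfspace_def)
    then show False
      unfolding y(2) add_axis_simps(2) using d(3) e(1) by simp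
  qed
qed

lemma inner_iff:
  assumes "c \<in> atlas N" "p \<in> fst c"
  shows "p \<in> inner_pts N \<longleftrightarrow> 0 < snd c p $ None"
  using bdry_iff[OF assms] chart_halfspace[OF assms] chart_open(2)[OF assms(1)] assms(2)
  by (auto simp: inner_pts_def halfspace_def)

lemma chart_cover:
  assumes "p \<in> topspace (mtop N)"
  obtains c where "c \<in> atlas N" "p \<in> fst c"
  using assms mfd unfolding compact_manifold_with_boundary_def by blast

lemma inner_open: "openin (mtop N) (inner_pts N)"
proof (subst openin_subopen, clarify)
  fix p assume p: "p \<in> inner_pts N"
  then obtain c where c: "c \<in> atlas N" "p \<in> fst c" using chart_cover by (auto simp: inner_pts_def)
  let ?T = "{q \<in> topspace (subtopology (mtop N) (fst c)). snd c q \<in> {y. 0 < y $ None}}"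
  have "open {y :: real ^ ('m option). 0 < y $ None}"
    by (intro open_Collect_less continuous_intros)
  then have "openin (subtopology (mtop N) (fst c)) ?T"
    using openin_continuous_map_preimage[OF chart_continuous[OF c(1)], of "{y. 0 < y $ None}"] by simp
  then have "openin (mtop N) ?T" using chart_open(1)[OF c(1)] openin_trans_full by blast
  moreover have "p \<in> ?T" using c p inner_iff chart_open(2)[OF c(1)] by auto
  moreover have "?T \<subseteq> inner_pts N" using inner_iff[OF c(1)] by auto
  ultimately show "\<exists>T. openin (mtop N) T \<and> p \<in> T \<and> T \<subseteq> inner_pts N" by blast
qed

lemma bdry_subset: "bdry N \<subseteq> topspace (mtop N)"
  by (auto simp: bdry_def)

lemma chart_inner_image:
  assumes "c \<in> atlas N"
  shows "snd c ` (fst c \<inter> U) \<inter> {y. 0 < y $ None} = snd c ` (fst c \<inter> (U \<inter> inner_pts N))"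
  using inner_iff[OF assms] by blast

lemma metric_patch_chart:
  assumes "riemannian_metric_on N U h" "openin (mtop N) U" "c \<in> atlas N"
  shows "metric_patch (snd c ` (fst c \<inter> U)) (h c \<circ> coord_inv c)"
proof
  show "openin (top_of_set halfspace) (snd c ` (fst c \<inter> U))" using chart_image_open assms by blast
  show "smooth_on halfspace (snd c ` (fst c \<inter> U)) (h c \<circ> coord_inv c)"
    using assms(1,3) unfolding riemannian_metric_on_def by simp
  fix y assume "y \<in> snd c ` (fst c \<inter> U)"
  then obtain p where "p \<in> fst c \<inter> U" "y = snd c p" by blast
  then show "posdef ((h c \<circ> coord_inv c) y)"
    using riemannian_metric_onD[OF assms(1,3)] coord_inv_chart[OF assms(3)] by simp
qed

end

subsection \<open>The collar of a special defining function\<close>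

lemma sum_option: "(\<Sum>i\<in>UNIV. f i) = f None + (\<Sum>\<alpha>\<in>UNIV. f (Some \<alpha>))" for f :: "'m::finite option \<Rightarrow> 'b::comm_monoid_add"
  by (simp add: UNIV_option_conv sum.reindex)

lemma posdef_warp:
  assumes "posdef M"
  shows "posdef (warp M)"
  unfolding posdef_def
proof (intro conjI allI impI)
  show "transpose (warp M) = warp M"
    using posdef_sym[OF assms] by (auto simp: transpose_def warp_def vec_eq_iff split: option.splits)
  fix w :: "real ^ ('a option)" assume "w \<noteq> 0"
  have wM: "w \<bullet> (warp M *v w) = (w $ None)\<^sup>2 + bcoord w \<bullet> (M *v bcoord w)"
    by (simp add: inner_vec_def matrix_vector_mult_def sum_option warp_def bcoord_def power2_eq_square)
  show "0 < w \<bullet> (warp M *v w)"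
  proof (cases "bcoord w = 0")
    case True
    then have "w $ None \<noteq> 0"
      using \<open>w \<noteq> 0\<close> unfolding bcoord_def vec_eq_iff by (metis option.exhaust vec_lambda_beta zero_index)
    then show ?thesis using True wM by simp
  next
    case False
    then have "0 < bcoord w \<bullet> (M *v bcoord w)" using assms unfolding posdef_def by blast
    then show ?thesis unfolding wM by (simp add: add_nonneg_pos)
  qed
qed

lemma warp_axis: "warp M *v axis None 1 = axis None 1"
  by (auto simp: vec_eq_iff matrix_vector_mult_def sum_option warp_def axis_def split: option.splits)

text \<open>For \<open>M\<close> the k-th coordinate vector is the gradient of the k-th coordinate,
  and gradients correspond under an invertible \<open>J\<close>. With \<open>J\<close> the Jacobian
  of \<open>\<Phi>\<close> and \<xi> the differential of \<open>x\<close>, the velocity of the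
  collar curves is the gradient of \<open>x\<close> for \<open>h\<close>. Invertibility of
  \<open>J\<close> follows from definiteness of \<open>M\<close>.\<close>

lemma pullback_gradient:
  fixes J h M :: "real ^ 'i ^ 'i"
  assumes J: "transpose J ** h ** J = M" "posdef M" "M *v axis k 1 = axis k 1"
    and \<xi>: "\<And>j. (\<Sum>i\<in>UNIV. J $ i $ j * \<xi> $ i) = (if j = k then 1 else 0)"
  shows "(\<Sum>j\<in>UNIV. h $ i $ j * J $ j $ k) = \<xi> $ i"
proof -
  have "u = 0" if "J *v u = 0" for u
  proof -
    have "M *v u = 0" using that unfolding J(1)[symmetric] by (simp add: matrix_vector_mul_assoc[symmetric])
    then show ?thesis using J(2) unfolding posdef_def by (metis inner_zero_right less_irrefl)
  qed
  then have "invertible J" unfolding invertible_left_inverse matrix_left_invertible_ker by blast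
  then have inv: "invertible (transpose J)" by (simp add: transpose_invertible)
  have "transpose J *v (h *v (J *v axis k 1)) = axis k 1"
    using J(1,3) by (simp add: matrix_vector_mul_assoc matrix_mul_assoc)
  also have "\<dots> = transpose J *v \<xi>"
    using \<xi> by (auto simp: vec_eq_iff matrix_vector_mult_def transpose_def axis_def)
  finally have "h *v (J *v axis k 1) = \<xi>"
    using inv unfolding invertible_left_inverse by (metis matrix_vector_mul_assoc matrix_vector_mul_lid)
  then have "(h *v (J *v axis k 1)) $ i = \<xi> $ i" by simp
  then show ?thesis
    by (simp add: matrix_vector_mult_basis) (simp add: matrix_vector_mult_def column_def)
qed

locale special_collar = compact_mfd N
  for N :: "('a, ('m::finite) option) mfd" +
  fixes g :: "('a, 'm option) tensor2" and gh :: "('a, 'm) tensor2" and x :: "'a \<Rightarrow> real" and \<epsilon> :: real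
    and \<Phi> :: "'a \<times> real \<Rightarrow> 'a" and h :: "('a, 'm option) tensor2" and gx :: "real \<Rightarrow> ('a, 'm) tensor2"
  assumes eps: "0 < \<epsilon>"
    and diffeo: "diffeo_onto_open (cylinder (bdry_mfd N) \<epsilon>) N (\<Phi> ` (bdry N \<times> {0..<\<epsilon>})) \<Phi>"
    and \<Phi>_0: "p \<in> bdry N \<Longrightarrow> \<Phi> (p, 0) = p"
    and x_\<Phi>: "p \<in> bdry N \<Longrightarrow> t \<in> {0..<\<epsilon>} \<Longrightarrow> x (\<Phi> (p, t)) = t"
    and defining: "defining_function_on N (\<Phi> ` (bdry N \<times> {0..<\<epsilon>})) x"
    and h: "extends_conformal N (\<Phi> ` (bdry N \<times> {0..<\<epsilon>})) (\<lambda>p. (x p)\<^sup>2) g h"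
    and gx: "t \<in> {0..<\<epsilon>} \<Longrightarrow> riemannian_metric_on (bdry_mfd N) (bdry N) (gx t)"
    and gx_0: "b \<in> atlas (bdry_mfd N) \<Longrightarrow> p \<in> fst b \<Longrightarrow> gx 0 b p = gh b p"
    and pullback_h: "b \<in> atlas (bdry_mfd N) \<Longrightarrow> c \<in> atlas N \<Longrightarrow> p \<in> fst b \<Longrightarrow> t \<in> {0..<\<epsilon>} \<Longrightarrow>
       \<Phi> (p, t) \<in> fst c \<Longrightarrow> pullback halfspace \<Phi> h (cyl_chart \<epsilon> b) c (p, t) = warp (gx t b p)"

lemma special_collarI:
  assumes "compact_manifold_with_boundary N" "special_defining_function N g gh x \<epsilon> \<Phi>"
  obtains h gx where "special_collar N g gh x \<epsilon> \<Phi> h gx"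
proof -
  have "\<exists>h gx. special_collar N g gh x \<epsilon> \<Phi> h gx"
    using assms unfolding special_defining_function_def Let_def
      special_collar_def special_collar_axioms_def compact_mfd_def
    by (elim conjE exE, intro exI conjI allI impI) (assumption | blast)+
  then show ?thesis using that by blast
qed

context special_collar
begin

abbreviation W where "W \<equiv> \<Phi> ` (bdry N \<times> {0..<\<epsilon>})"

lemma W_open: "openin (mtop N) W" and bdry_W: "bdry N \<subseteq> W"
  using defining by (auto simp: defining_function_on_def)

lemma topspace_cyl: "topspace (mtop (cylinder (bdry_mfd N) \<epsilon>)) = bdry N \<times> {0..<\<epsilon>}"
  using bdry_subset by (auto simp: cylinder_def bdry_mfd_def)

text \<open>Reads \<open>\<Phi>\<close> in coordinates with the same chart \<open>c\<close> on both
  sides: the source in the cylinder over its boundary chart, the target in \<open>c\<close> itself.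
  With this choice \<open>\<Phi>\<close> becomes the identity on the boundary face.\<close>

lemma collar_chart:
  assumes c: "c \<in> atlas N" and U: "openin (mtop N) U" "bdry N \<subseteq> U"
  defines "e \<equiv> cyl_chart \<epsilon> (bchart N c)"
  obtains E where "openin (top_of_set halfspace) E"
    "\<And>z. bemb z \<in> snd c ` fst c \<Longrightarrow> bemb z \<in> E"
    "smooth_on halfspace E (coord_map e c \<Phi>)"
    "\<And>y. y \<in> E \<Longrightarrow> coord_map e c \<Phi> y \<in> snd c ` (fst c \<inter> (U \<inter> W))"
    "\<And>y. y \<in> E \<Longrightarrow> coord_inv c (coord_map e c \<Phi> y) = \<Phi> (coord_inv c (bemb (bcoord y)), y $ None)"
    "\<And>y. y \<in> E \<Longrightarrow> coord_inv c (bemb (bcoord y)) \<in> fst c \<inter> bdry N \<and> y $ None \<in> {0..<\<epsilon>} \<and> bemb (bcoord y) \<in> snd c ` fst c"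
    "\<And>y. y \<in> E \<Longrightarrow> snd e (coord_inv c (bemb (bcoord y)), y $ None) = y"
proof -
  define V where "V = snd c ` fst c"
  define Y where "Y = {y \<in> halfspace. y $ None < \<epsilon> \<and> bemb (bcoord y) \<in> V}"
  \<comment> \<open>An explicit inverse of the cylinder chart.\<close>
  define \<Psi> where "\<Psi> y = (coord_inv c (bemb (bcoord y)), y $ None)" for y :: "real ^ ('m option)"
  have V: "openin (top_of_set halfspace) V"
    using chart_image_open[OF c chart_open(1)[OF c]] by (simp add: V_def)
  have bb: "continuous_on UNIV (\<lambda>y :: real ^ ('m option). bemb (bcoord y))"
  proof -
    have "bounded_linear (bcoord :: real ^ ('m option) \<Rightarrow> real ^ 'm)"
      by (auto intro!: linear_conv_bounded_linear[THEN iffD1] linearI simp: bcoord_def vec_eq_iff)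
    then show ?thesis
      using continuous_on_compose2[OF continuous_on_bemb[of UNIV] linear_continuous_on[of bcoord UNIV]] by simp
  qed
  have Y: "openin (top_of_set halfspace) Y"
  proof -
    obtain T where T: "open T" "V = halfspace \<inter> T" using V by (auto simp: openin_open)
    have "Y = halfspace \<inter> ({y. y $ None < \<epsilon>} \<inter> (\<lambda>y. bemb (bcoord y)) -` T)"
      using bemb_in_halfspace by (auto simp: Y_def T(2))
    moreover have "open ({y :: real ^ ('m option). y $ None < \<epsilon>} \<inter> (\<lambda>y. bemb (bcoord y)) -` T)"
      by (intro open_Int open_Collect_less continuous_intros open_vimage[OF T(1) bb])
    ultimately show ?thesis by (metis openin_open)
  qed
  have cb: "coord_inv c (bemb (bcoord y)) \<in> fst c \<inter> bdry N" if "y \<in> Y" for y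
    using that chart_coord_inv[of "bemb (bcoord y)" c] bdry_iff[OF c]
    by (auto simp: Y_def V_def bemb_def)
  have \<Psi>: "continuous_map (top_of_set Y) (mtop (cylinder (bdry_mfd N) \<epsilon>)) \<Psi>"
  proof -
    have "continuous_map (top_of_set Y) (top_of_set V) (\<lambda>y. bemb (bcoord y))"
      using continuous_on_subset[OF bb] by (auto simp: Y_def)
    then have "continuous_map (top_of_set Y) (mtop N) (coord_inv c \<circ> (\<lambda>y. bemb (bcoord y)))"
      using continuous_coord_inv[OF c] unfolding V_def by (rule continuous_map_compose)
    then have 1: "continuous_map (top_of_set Y) (subtopology (mtop N) (bdry N)) (\<lambda>y. coord_inv c (bemb (bcoord y)))"
      unfolding continuous_map_in_subtopology using cb by (auto simp: o_def)
    have 2: "continuous_map (top_of_set Y) (top_of_set {0..<\<epsilon>}) (\<lambda>y. y $ None)"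
      by (auto simp: Y_def halfspace_def intro!: continuous_intros)
    show ?thesis
      unfolding cylinder_def bdry_mfd_def \<Psi>_def mfd.select_convs by (rule continuous_map_pairedI[OF 1 2])
  qed
  have \<Phi>c: "continuous_map (mtop (cylinder (bdry_mfd N) \<epsilon>)) (mtop N) \<Phi>"
    using diffeo unfolding diffeo_onto_open_def smooth_map_def subtopology_topspace by (elim conjE)
  \<comment> \<open>The part of the source patch sent back into the domain of \<open>c\<close>. It
    contains the boundary face since \<open>\<Phi>\<close> fixes boundary points, and it is
    relatively open by continuity.\<close>
  define E where "E = {y \<in> Y. \<Phi> (\<Psi> y) \<in> fst c \<inter> (U \<inter> W)}"
  have E: "openin (top_of_set halfspace) E"
  proof -
    have "openin (mtop N) (fst c \<inter> (U \<inter> W))"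
      by (intro openin_Int chart_open(1)[OF c] U(1) W_open)
    from openin_continuous_map_preimage[OF continuous_map_compose[OF \<Psi> \<Phi>c] this]
    have "openin (top_of_set Y) E" by (simp add: E_def)
    then show ?thesis using Y by (rule openin_trans)
  qed
  have e: "fst e = (fst c \<inter> bdry N) \<times> {0..<\<epsilon>}"
    "snd e (p, t) = (\<chi> i. case i of None \<Rightarrow> t | Some \<alpha> \<Rightarrow> bcoord (snd c p) $ \<alpha>)" for p t
    by (simp_all add: e_def cyl_chart_def bchart_def)
  have sndeN: "snd e q $ None = snd q" for q by (cases q) (simp add: e)
  have bce: "bcoord (snd e q) = bcoord (snd c (fst q))" for q by (cases q) (simp add: e bcoord_def)
  have \<Psi>e: "snd e (\<Psi> y) = y" "\<Psi> y \<in> fst e" if "y \<in> Y" for y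
  proof -
    have "snd c (coord_inv c (bemb (bcoord y))) = bemb (bcoord y)"
      using that by (intro chart_coord_inv) (simp add: Y_def V_def)
    moreover have "bcoord y $ \<alpha> = y $ Some \<alpha>" for \<alpha> by (simp add: bcoord_def)
    ultimately show "snd e (\<Psi> y) = y"
      by (subst vec_eq_iff) (simp add: \<Psi>_def e bcoord_bemb split: option.splits)
    show "\<Psi> y \<in> fst e" using cb[OF that] that by (auto simp: \<Psi>_def e Y_def halfspace_def)
  qed
  \<comment> \<open>\<open>coord_inv\<close> is an arbitrary inverse, so it equals \<Psi> only once
    the cylinder chart is injective; on the boundary the tangential coordinates determine the
    point.\<close>
  have inj: "inj_on (snd e) (fst e)"
  proof (rule inj_onI)
    fix q r assume q: "q \<in> fst e" "r \<in> fst e" and eq: "snd e q = snd e r"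
    have "snd c (fst q) $ None = 0" "snd c (fst r) $ None = 0" using q bdry_iff[OF c] by (auto simp: e(1))
    then have "snd c (fst q) = snd c (fst r)" using bce[of q] bce[of r] eq bemb_bcoord by metis
    then have "fst q = fst r" using inj_onD[OF chart_inj[OF c]] q by (auto simp: e(1))
    moreover have "snd q = snd r" using sndeN[of q] sndeN[of r] eq by simp
    ultimately show "q = r" by (rule prod_eqI)
  qed
  have inv: "coord_inv e y = \<Psi> y" if "y \<in> Y" for y
    unfolding coord_inv_def using inv_into_f_f[OF inj \<Psi>e(2)[OF that]] \<Psi>e(1)[OF that] by simp
  have F: "coord_map e c \<Phi> y = snd c (\<Phi> (\<Psi> y))" if "y \<in> E" for y
    using that inv by (simp add: coord_map_def E_def)
  have "\<forall>e\<in>atlas (cylinder (bdry_mfd N) \<epsilon>). \<forall>c'\<in>atlas N. smooth_on (model (cylinder (bdry_mfd N) \<epsilon>))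
      (snd e ` {p \<in> fst e \<inter> (bdry N \<times> {0..<\<epsilon>}). \<Phi> p \<in> fst c'}) (coord_map e c' \<Phi>)"
    using diffeo unfolding diffeo_onto_open_def smooth_map_def topspace_cyl by (elim conjE)
  moreover have "model (cylinder (bdry_mfd N) \<epsilon>) = halfspace" by (simp add: cylinder_def)
  ultimately have smooth_\<Phi>: "\<forall>e\<in>atlas (cylinder (bdry_mfd N) \<epsilon>). \<forall>c'\<in>atlas N. smooth_on halfspace
      (snd e ` {p \<in> fst e \<inter> (bdry N \<times> {0..<\<epsilon>}). \<Phi> p \<in> fst c'}) (coord_map e c' \<Phi>)"
    by simp
  have bN: "bemb z $ None = 0" for z :: "real ^ 'm" by (simp add: bemb_def)
  show ?thesis
  proof (rule that[of E])
    show "openin (top_of_set halfspace) E" by (rule E)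
    show "bemb z \<in> E" if "bemb z \<in> snd c ` fst c" for z
    proof -
      have y: "bemb z \<in> Y"
        using that eps bemb_in_halfspace[of z] bN[of z] by (simp add: Y_def V_def bcoord_bemb)
      then have "\<Phi> (\<Psi> (bemb z)) = coord_inv c (bemb z)"
        using cb[OF y] \<Phi>_0 by (simp add: \<Psi>_def bcoord_bemb bN)
      then show ?thesis using y cb[OF y] U(2) bdry_W by (auto simp: E_def bcoord_bemb)
    qed
    show "smooth_on halfspace E (coord_map e c \<Phi>)"
    proof (rule smooth_on_subset)
      have "e \<in> atlas (cylinder (bdry_mfd N) \<epsilon>)" using c by (simp add: e_def cylinder_def bdry_mfd_def)
      then show "smooth_on halfspace (snd e ` {q \<in> fst e \<inter> (bdry N \<times> {0..<\<epsilon>}). \<Phi> q \<in> fst c}) (coord_map e c \<Phi>)"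
        using smooth_\<Phi> c by blast
      show "E \<subseteq> snd e ` {q \<in> fst e \<inter> (bdry N \<times> {0..<\<epsilon>}). \<Phi> q \<in> fst c}"
      proof
        fix y assume y: "y \<in> E"
        then have "y \<in> Y" "\<Phi> (\<Psi> y) \<in> fst c" by (simp_all add: E_def)
        moreover from \<Psi>e[OF this(1)] have "\<Psi> y \<in> fst e \<inter> (bdry N \<times> {0..<\<epsilon>})" "snd e (\<Psi> y) = y"
          by (simp_all add: e(1) mem_Times_iff)
        ultimately have "\<Psi> y \<in> fst e \<inter> (bdry N \<times> {0..<\<epsilon>})" "\<Phi> (\<Psi> y) \<in> fst c" "snd e (\<Psi> y) = y"
          by blast+
        then show "y \<in> snd e ` {q \<in> fst e \<inter> (bdry N \<times> {0..<\<epsilon>}). \<Phi> q \<in> fst c}"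
          by (metis (mono_tags, lifting) imageI mem_Collect_eq)
      qed
    qed
    show "coord_map e c \<Phi> y \<in> snd c ` (fst c \<inter> (U \<inter> W))" if "y \<in> E" for y
      using that unfolding F[OF that] E_def by blast
    show "coord_inv c (coord_map e c \<Phi> y) = \<Phi> (coord_inv c (bemb (bcoord y)), y $ None)" if "y \<in> E" for y
      using that coord_inv_chart[OF c] unfolding F[OF that] by (simp add: E_def \<Psi>_def)
    show "coord_inv c (bemb (bcoord y)) \<in> fst c \<inter> bdry N \<and> y $ None \<in> {0..<\<epsilon>} \<and> bemb (bcoord y) \<in> snd c ` fst c"
      if "y \<in> E" for y
      using that cb by (auto simp: E_def Y_def halfspace_def V_def)
    show "snd e (coord_inv c (bemb (bcoord y)), y $ None) = y" if "y \<in> E" for y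
      using that \<Psi>e(1) by (simp add: E_def \<Psi>_def)
  qed
qed

text \<open>Turns the normal form of \<open>h\<close> into two usable facts: the transverse
  derivative of \<open>F\<close> is the gradient of \<open>x\<close> for \<open>h\<close>, and
  \<open>h\<close> restricts to \<open>gh\<close> on the boundary.\<close>

lemma collar_flow:
  assumes c: "c \<in> atlas N" and U: "openin (mtop N) U" "bdry N \<subseteq> U"
  obtains E F where "openin (top_of_set halfspace) E"
    "\<And>z. bemb z \<in> snd c ` fst c \<Longrightarrow> bemb z \<in> E"
    "smooth_on halfspace E F"
    "\<And>y. y \<in> E \<Longrightarrow> F y \<in> snd c ` (fst c \<inter> (U \<inter> W))"
    "\<And>z. bemb z \<in> E \<Longrightarrow> F (bemb z) = bemb z"
    "\<And>y. y \<in> E \<Longrightarrow> coord_inv c (F y) = \<Phi> (coord_inv c (bemb (bcoord y)), y $ None)"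
    "\<And>y. y \<in> E \<Longrightarrow> coord_inv c (bemb (bcoord y)) \<in> bdry N \<and> y $ None \<in> {0..<\<epsilon>}"
    "\<And>y i. y \<in> E \<Longrightarrow> (\<Sum>j\<in>UNIV. h c (coord_inv c (F y)) $ i $ j * pdh None F y $ j)
      = pdh i (x \<circ> coord_inv c) (F y)"
    "\<And>p. p \<in> fst c \<inter> bdry N \<Longrightarrow> tang (h c p) = gh (bchart N c) p"
proof -
  define e where "e = cyl_chart \<epsilon> (bchart N c)"
  define F where "F = coord_map e c \<Phi>"
  obtain E where E: "openin (top_of_set halfspace) E"
    and bE: "\<And>z. bemb z \<in> snd c ` fst c \<Longrightarrow> bemb z \<in> E"
    and FE: "smooth_on halfspace E F"
    and F: "\<And>y. y \<in> E \<Longrightarrow> F y \<in> snd c ` (fst c \<inter> (U \<inter> W))"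
    and F\<Phi>: "\<And>y. y \<in> E \<Longrightarrow> coord_inv c (F y) = \<Phi> (coord_inv c (bemb (bcoord y)), y $ None)"
    and q: "\<And>y. y \<in> E \<Longrightarrow> coord_inv c (bemb (bcoord y)) \<in> fst c \<inter> bdry N \<and> y $ None \<in> {0..<\<epsilon>} \<and> bemb (bcoord y) \<in> snd c ` fst c"
    and e: "\<And>y. y \<in> E \<Longrightarrow> snd e (coord_inv c (bemb (bcoord y)), y $ None) = y"
    by (rule collar_chart[OF c U, folded e_def, folded F_def]) (rule that; assumption)
  let ?J = "\<lambda>y. jacobian F (at y within halfspace)"
  have J: "?J y $ i $ j = pdh j F y $ i" for y i j
    by (simp add: jacobian_def matrix_def pd_def)
  have b: "bchart N c \<in> atlas (bdry_mfd N)" using c by (simp add: bdry_mfd_def)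
  have fb: "fst (bchart N c) = fst c \<inter> bdry N" by (simp add: bchart_def)
  have Fc: "coord_inv c (F y) \<in> fst c" "F y \<in> halfspace" if "y \<in> E" for y
    using F[OF that] coord_inv_chart[OF c] chart_halfspace[OF c] by auto
  have pull: "transpose (?J y) ** h c (coord_inv c (F y)) ** ?J y
      = warp (gx (y $ None) (bchart N c) (coord_inv c (bemb (bcoord y))))" if "y \<in> E" for y
    using pullback_h[OF b c, of "coord_inv c (bemb (bcoord y))" "y $ None"] q[OF that] Fc(1)[OF that] e[OF that]
    unfolding F\<Phi>[OF that] by (simp add: pullback_def Let_def F_def fb flip: e_def)
  have Fb: "F (bemb z) = bemb z" if "bemb z \<in> E" for z
  proof -
    have "bemb z $ None = 0" by (simp add: bemb_def)
    then have "coord_inv c (F (bemb z)) = coord_inv c (bemb z)"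
      using F\<Phi>[OF that] q[OF that] \<Phi>_0 by (simp add: bcoord_bemb)
    then have "snd c (coord_inv c (F (bemb z))) = snd c (coord_inv c (bemb z))" by simp
    moreover have "F (bemb z) \<in> snd c ` fst c" using F[OF that] by blast
    moreover have "bemb z \<in> snd c ` fst c" using q[OF that] by (simp add: bcoord_bemb)
    ultimately show ?thesis by (metis chart_coord_inv(1))
  qed
  show ?thesis
  proof (rule that[of E F, OF E bE FE F Fb F\<Phi>])
    show "coord_inv c (bemb (bcoord y)) \<in> bdry N \<and> y $ None \<in> {0..<\<epsilon>}" if "y \<in> E" for y
      using q[OF that] by blast
    show "(\<Sum>j\<in>UNIV. h c (coord_inv c (F y)) $ i $ j * pdh None F y $ j)
      = pdh i (x \<circ> coord_inv c) (F y)" if y: "y \<in> E" for y i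
    proof -
      have yh: "y \<in> halfspace" using in_halfspace[OF E y] .
      have "posdef (gx (y $ None) (bchart N c) (coord_inv c (bemb (bcoord y))))"
        using riemannian_metric_onD[OF gx b] q[OF y] by (simp add: fb)
      note pd_warp = posdef_warp[OF this]
      have sx: "smooth_on halfspace (snd c ` (fst c \<inter> W)) (x \<circ> coord_inv c)"
        using defining c by (simp add: defining_function_on_def smooth_fun_def)
      \<comment> \<open>In collar coordinates \<open>x\<close> is the transverse coordinate, so the
        transposed Jacobian takes the differential of \<open>x\<close> to the corresponding
        covector.\<close>
      have "(\<Sum>i\<in>UNIV. ?J y $ i $ j * (\<chi> i. pdh i (x \<circ> coord_inv c) (F y)) $ i) = (if j = None then 1 else 0)" for j
      proof -
        have "F ` E \<subseteq> halfspace" using Fc(2) by blast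
        moreover have "F y \<in> snd c ` (fst c \<inter> W)" using F[OF y] by blast
        ultimately have "pdh j (\<lambda>z. (x \<circ> coord_inv c) (F z)) y
            = (\<Sum>i\<in>UNIV. pdh j F y $ i *\<^sub>R pdh i (x \<circ> coord_inv c) (F y))"
          by (intro pd_compose(2)[OF yh E y] smooth_on_differentiable[OF FE y] smooth_on_differentiable[OF sx])
        moreover have "pdh j (\<lambda>z. (x \<circ> coord_inv c) (F z)) y = pdh j (\<lambda>z. z $ None) y"
          by (rule differentiable_cong_openin(3)[OF E y]) (use F\<Phi> q x_\<Phi> in auto)
        ultimately show ?thesis by (simp add: J pd_nth[OF yh])
      qed
      from pullback_gradient[OF pull[OF y] pd_warp warp_axis this, of i]
      show ?thesis by (simp add: J)
    qed
    show "tang (h c p) = gh (bchart N c) p" if p: "p \<in> fst c \<inter> bdry N" for p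
    proof -
      let ?y = "snd c p"
      have N: "?y $ None = 0" using p bdry_iff[OF c] by auto
      have y: "?y \<in> E" using bE[of "bcoord ?y"] bemb_bcoord[OF N] p by auto
      have yh: "?y \<in> halfspace" using in_halfspace[OF E y] .
      have q: "coord_inv c (bemb (bcoord ?y)) = p" using bemb_bcoord[OF N] coord_inv_chart[OF c] p by simp
      have Fy: "F ?y = ?y" using Fb[of "bcoord ?y"] y bemb_bcoord[OF N] by simp
      \<comment> \<open>\<open>F\<close> fixes the face, so the tangential columns of its Jacobian
        are coordinate vectors. These are the only columns that enter the tangential block of the
        pullback.\<close>
      have dF: "pdh (Some \<alpha>) F ?y $ i = (if i = Some \<alpha> then 1 else 0)" for \<alpha> i
      proof -
        have Fi: "(\<lambda>z. F z $ i) differentiable (at ?y within halfspace)" for i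
          by (rule smooth_on_differentiable[OF smooth_on_nth[OF E FE] y])
        have ni: "(\<lambda>z. z $ i) differentiable (at ?y within halfspace)" for i
          by (rule bounded_linear_imp_differentiable[OF bounded_linear_vec_nth])
        have "pdh (Some \<alpha>) (\<lambda>z. F z $ i - z $ i) ?y = 0"
        proof (rule pd_tangential_eq_0[OF E y N differentiable_diff[OF Fi ni]])
          show "F z $ i - z $ i = 0" if "z \<in> E" "z $ None = 0" for z
            using Fb[of "bcoord z"] bemb_bcoord[OF that(2)] that(1) by simp
        qed
        then have "pdh (Some \<alpha>) (\<lambda>z. F z $ i) ?y = pdh (Some \<alpha>) (\<lambda>z. z $ i) ?y"
          using pd_diff[OF yh Fi ni] by simp
        moreover have "pdh (Some \<alpha>) (\<lambda>z. F z $ i) ?y = pdh (Some \<alpha>) F ?y $ i"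
          by (rule pd_bounded_linear[OF yh bounded_linear_vec_nth smooth_on_differentiable[OF FE y]])
        ultimately show ?thesis by (auto simp: pd_nth[OF yh])
      qed
      have "h c p $ Some \<alpha> $ Some \<beta> = gh (bchart N c) p $ \<alpha> $ \<beta>" for \<alpha> \<beta>
      proof -
        have "(transpose (?J ?y) ** h c p ** ?J ?y) $ Some \<alpha> $ Some \<beta> = warp (gx 0 (bchart N c) p) $ Some \<alpha> $ Some \<beta>"
          using pull[OF y] coord_inv_chart[OF c] p by (simp add: Fy q N)
        also have "\<dots> = gh (bchart N c) p $ \<alpha> $ \<beta>"
          using gx_0[OF b] p by (simp add: warp_def fb)
        finally show ?thesis
          by (simp add: matrix_matrix_mult_def transpose_def J dF if_distrib[of "\<lambda>x. x * c" for c :: real]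
            if_distrib[of "\<lambda>x. c * x" for c :: real] cong: if_cong)
      qed
      then show ?thesis by (simp add: tang_def vec_eq_iff)
    qed
  qed
qed

end

subsection \<open>The Fefferman-Graham compactification\<close>

lemma ray_derivative:
  fixes f :: "real ^ ('m::finite option) \<Rightarrow> 'b::real_normed_vector"
  assumes "openin (top_of_set halfspace) E" "\<And>t. t \<in> {0..<\<delta>} \<Longrightarrow> y + t *\<^sub>R axis None 1 \<in> E"
    and "smooth_on halfspace E f" "t \<in> {0..<\<delta>}"
  shows "((\<lambda>s. f (y + s *\<^sub>R axis None 1)) has_vector_derivative pdh None f (y + t *\<^sub>R axis None 1))
    (at t within {0..<\<delta>})"
proof -
  have "((\<lambda>s. y + s *\<^sub>R axis None (1::real)) has_vector_derivative axis None 1) (at t within {0..<\<delta>})"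
    by (auto intro!: derivative_eq_intros)
  from has_vector_derivative_pd[OF smooth_on_differentiable[OF assms(3) assms(2)[OF assms(4)]] this]
  show ?thesis
    using assms(2) in_halfspace[OF assms(1)] unfolding sum_axis_scaleR by blast
qed

text \<open>Connects \<open>even_at_0\<close>, which speaks of iterated one-sided derivatives of a
  function of t, with transverse partial derivatives in a patch. The induction needs the formula on
  the whole interval, because each further derivative uses nearby values.\<close>

lemma right_deriv_ray:
  fixes \<phi> :: "real ^ ('m::finite option) \<Rightarrow> real"
  assumes E: "openin (top_of_set halfspace) E" "\<And>t. t \<in> {0..<\<delta>} \<Longrightarrow> y + t *\<^sub>R axis None 1 \<in> E"
    and "smooth_on halfspace E \<phi>" "\<And>t. t \<in> {0..<\<delta>} \<Longrightarrow> f t = \<phi> (y + t *\<^sub>R axis None 1)" "t \<in> {0..<\<delta>}"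
  shows "(right_deriv ^^ k) f t = (pdh None ^^ k) \<phi> (y + t *\<^sub>R axis None 1)"
  using assms(5)
proof (induction k arbitrary: t)
  case 0
  then show ?case using assms(4) by simp
next
  case (Suc k)
  have sm: "smooth_on halfspace E ((pdh None ^^ k) \<phi>)"
    by (induction k) (use assms(3) in \<open>auto intro: smooth_on_pd\<close>)
  have at: "at t within {0..} = at t within {0..<\<delta>}"
    by (rule at_within_nhd[of t "{..<\<delta>}"]) (use Suc.prems in auto)
  have "((right_deriv ^^ k) f has_vector_derivative pdh None ((pdh None ^^ k) \<phi>) (y + t *\<^sub>R axis None 1))
      (at t within {0..<\<delta>})"
    by (rule has_vector_derivative_transform[OF Suc.prems Suc.IH ray_derivative[OF E sm Suc.prems]])
  then show ?case
    unfolding funpow.simps o_def right_deriv_def at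
    using Suc.prems by (intro vector_derivative_within at_within_Ico_neq_bot) auto
qed

lemma riemannian_metric_on_subset:
  assumes "riemannian_metric_on N T g" "S \<subseteq> T"
  shows "riemannian_metric_on N S g"
proof -
  have "smooth_on (model N) (snd c ` (fst c \<inter> S)) (g c \<circ> coord_inv c)" if "c \<in> atlas N" for c
    by (rule smooth_on_subset[of _ "snd c ` (fst c \<inter> T)"])
      (use assms that in \<open>auto simp: riemannian_metric_on_def\<close>)
  then show ?thesis using assms unfolding riemannian_metric_on_def by blast
qed

lemma pullback_scaleR:
  assumes "g' c' (F p) = r *\<^sub>R g c' (F p)"
  shows "pullback D F g' c c' p = r *\<^sub>R pullback D F g c c' p"
  unfolding pullback_def Let_def assms
  by (simp add: scalar_matrix_assoc[symmetric] matrix_scalar_ac)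

lemma pullback_cong: "g' c' (F p) = g c' (F p) \<Longrightarrow> pullback D F g' c c' p = pullback D F g c c' p"
  by (simp add: pullback_def)

text \<open>One complete choice of the data over which \<open>FG_Q\<close> quantifies, with the
  witnesses \<open>h\<close>, \<open>gx\<close> and \<open>U\<close> made parameters. The comparison
  argument interprets it twice, for the same \<open>g\<close> and \<open>gh\<close>.\<close>

locale fg_solution = special_collar N g gh x \<epsilon> \<Phi> h gx
  for N :: "('a, ('m::finite) option) mfd" and g gh x \<epsilon> \<Phi> h gx +
  fixes v A B :: "'a \<Rightarrow> real" and U
  assumes metric_g: "riemannian_metric_on N (inner_pts N) g"
    and einstein: "c \<in> atlas N \<Longrightarrow> p \<in> fst c \<inter> inner_pts N \<Longrightarrow>
      ricci halfspace (g c \<circ> coord_inv c) i j (snd c p) = - real CARD('m) * g c p $ i $ j"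
    and v_equation: "solves_v_equation N g v"
    and U: "openin (mtop N) U" "bdry N \<subseteq> U" "U \<subseteq> \<Phi> ` (bdry N \<times> {0..<\<epsilon>})"
    and smooth_AB: "smooth_fun N U A" "smooth_fun N U B"
    and v_formula: "p \<in> U \<inter> inner_pts N \<Longrightarrow> v p = ln (x p) + A p + B p * x p ^ CARD('m)"
    and even: "p \<in> bdry N \<Longrightarrow> even_at_0 (\<lambda>t. A (\<Phi> (p, t)))"
    and A_bdry: "p \<in> bdry N \<Longrightarrow> A p = 0"

lemma fg_solutionI:
  assumes "conformally_compact_einstein N g" "special_defining_function N g gh x \<epsilon> \<Phi>"
    and "solves_v_equation N g v" "v_expansion N x \<epsilon> \<Phi> v A B"
  obtains h gx U where "fg_solution N g gh x \<epsilon> \<Phi> h gx v A B U"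
proof -
  have cc: "conformally_compact N g" and cm: "compact_manifold_with_boundary N"
    using assms(1) by (auto simp: conformally_compact_einstein_def conformally_compact_def)
  obtain h gx where "special_collar N g gh x \<epsilon> \<Phi> h gx"
    using special_collarI[OF cm assms(2)] by blast
  then interpret special_collar N g gh x \<epsilon> \<Phi> h gx .
  obtain U where U: "openin (mtop N) U \<and> bdry N \<subseteq> U \<and> U \<subseteq> \<Phi> ` (bdry N \<times> {0..<\<epsilon>}) \<and>
        smooth_fun N U A \<and> smooth_fun N U B \<and>
        (\<forall>p\<in>U \<inter> inner_pts N. v p = ln (x p) + A p + B p * x p ^ CARD('b))"
    using assms(4) unfolding v_expansion_def by blast
  have "fg_solution N g gh x \<epsilon> \<Phi> h gx v A B U"
  proof
    show "riemannian_metric_on N (inner_pts N) g" using cc by (simp add: conformally_compact_def)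
    show "ricci halfspace (g c \<circ> coord_inv c) i j (snd c p) = - real CARD('b) * g c p $ i $ j"
      if "c \<in> atlas N" "p \<in> fst c \<inter> inner_pts N" for c p i j
      using assms(1) that unfolding conformally_compact_einstein_def by simp
    show "v p = ln (x p) + A p + B p * x p ^ CARD('b)" if "p \<in> U \<inter> inner_pts N" for p using U that by blast
    show "even_at_0 (\<lambda>t. A (\<Phi> (p, t)))" "A p = 0" if "p \<in> bdry N" for p
      using assms(4) that unfolding v_expansion_def by blast+
  qed (use U assms(3) in blast)+
  then show ?thesis by (rule that)
qed

context fg_solution
begin

definition Z where "Z p = A p + B p * x p ^ CARD('m)"

lemma x_bdry: "p \<in> bdry N \<Longrightarrow> x p = 0" and x_pos: "p \<in> W - bdry N \<Longrightarrow> 0 < x p"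
  using defining by (auto simp: defining_function_on_def)

lemma Z_bdry: "p \<in> bdry N \<Longrightarrow> Z p = 0"
  by (simp add: Z_def A_bdry x_bdry)

lemma smooth_chart:
  assumes c: "c \<in> atlas N"
  shows "smooth_on halfspace (snd c ` (fst c \<inter> U)) (A \<circ> coord_inv c)"
    "smooth_on halfspace (snd c ` (fst c \<inter> U)) (B \<circ> coord_inv c)"
    "smooth_on halfspace (snd c ` (fst c \<inter> U)) (x \<circ> coord_inv c)"
    "smooth_on halfspace (snd c ` (fst c \<inter> U)) (Z \<circ> coord_inv c)"
    "smooth_on halfspace (snd c ` (fst c \<inter> U)) (h c \<circ> coord_inv c)"
proof -
  let ?S = "snd c ` (fst c \<inter> U)"
  show A: "smooth_on halfspace ?S (A \<circ> coord_inv c)"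
    and B: "smooth_on halfspace ?S (B \<circ> coord_inv c)"
    using smooth_AB c by (auto simp: smooth_fun_def)
  have sub: "?S \<subseteq> snd c ` (fst c \<inter> W)" using U(3) by blast
  have "smooth_on halfspace (snd c ` (fst c \<inter> W)) (x \<circ> coord_inv c)"
    using defining c by (simp add: defining_function_on_def smooth_fun_def)
  then show x: "smooth_on halfspace ?S (x \<circ> coord_inv c)"
    using sub by (rule smooth_on_subset)
  have "smooth_on halfspace (snd c ` (fst c \<inter> W)) (h c \<circ> coord_inv c)"
    using h c by (simp add: extends_conformal_def riemannian_metric_on_def)
  then show "smooth_on halfspace ?S (h c \<circ> coord_inv c)"
    using sub by (rule smooth_on_subset)
  note op = chart_image_open[OF c U(1)]
  show "smooth_on halfspace ?S (Z \<circ> coord_inv c)"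
    using smooth_on_add[OF op A smooth_on_mult[OF op B smooth_on_power[OF op x, of "CARD('m)"]]]
    by (simp add: Z_def[abs_def] o_def)
qed

lemma exp_2v:
  assumes "p \<in> U \<inter> inner_pts N"
  shows "exp (2 * v p) = exp (2 * Z p) * (x p)\<^sup>2"
proof -
  have "0 < x p" using x_pos[of p] assms U(3) by (auto simp: inner_pts_def)
  moreover have "v p = ln (x p) + Z p" using v_formula[OF assms] by (simp add: Z_def)
  ultimately show ?thesis by (simp add: exp_double exp_add power_mult_distrib)
qed

lemma exp_2v_metric:
  assumes "c \<in> atlas N" "p \<in> fst c \<inter> U \<inter> inner_pts N"
  shows "exp (2 * v p) *\<^sub>R g c p = exp (2 * Z p) *\<^sub>R h c p"
  using h assms U(3) exp_2v[of p] by (auto simp: extends_conformal_def)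

text \<open>Near the boundary exp (2 v) g equals exp (2 Z) \<open>h\<close>, because exp (2 v) = exp
  (2 Z) \<open>x\<^sup>2\<close> and \<open>h\<close> extends \<open>x\<^sup>2 g\<close>. The second
  expression is smooth up to the boundary, the first on the interior, and the two regions cover
  \<open>N\<close>.\<close>

lemma extension_exists: "\<exists>G. extends_conformal N (topspace (mtop N)) (\<lambda>p. exp (2 * v p)) g G"
proof -
  \<comment> \<open>The boundary value is \<open>h\<close> itself, since \<open>Z\<close> vanishes
    there.\<close>
  define G where "G c p = (if p \<in> inner_pts N then exp (2 * v p) *\<^sub>R g c p else h c p)" for c p
  have metric_h: "riemannian_metric_on N W h" using h by (simp add: extends_conformal_def)
  have GU: "G c p = exp (2 * Z p) *\<^sub>R h c p" if "c \<in> atlas N" "p \<in> fst c \<inter> U" for c p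
    using exp_2v_metric[OF that(1)] that Z_bdry[of p] chart_open(2)[OF that(1)] by (auto simp: G_def inner_pts_def)
  have cover: "p \<in> U \<or> p \<in> inner_pts N" if "p \<in> topspace (mtop N)" for p
    using that U(2) by (auto simp: inner_pts_def)
  have "riemannian_metric_on N (topspace (mtop N)) G"
    unfolding riemannian_metric_on_def
  proof (intro conjI ballI)
    fix c assume c: "c \<in> atlas N"
    have fc: "fst c \<inter> topspace (mtop N) = fst c" using chart_open(2)[OF c] by blast
    show "smooth_on (model N) (snd c ` (fst c \<inter> topspace (mtop N))) (G c \<circ> coord_inv c)"
      unfolding fc model_eq
    proof (rule smooth_on_locally)
      show "snd c ` fst c \<subseteq> halfspace" using chart_halfspace[OF c] by blast
      fix y assume "y \<in> snd c ` fst c"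
      then obtain p where p: "p \<in> fst c" "y = snd c p" by blast
      show "\<exists>T. openin (top_of_set halfspace) T \<and> y \<in> T \<and> smooth_on halfspace T (G c \<circ> coord_inv c)"
      proof (cases "p \<in> U")
        case True
        note op = chart_image_open[OF c U(1)]
        have "smooth_on halfspace (snd c ` (fst c \<inter> U)) (\<lambda>y. exp (2 * (Z \<circ> coord_inv c) y) *\<^sub>R (h c \<circ> coord_inv c) y)"
          by (intro smooth_on_scaleR[OF op] smooth_on_exp[OF op] smooth_on_mult[OF op] smooth_on_const[OF op]
              smooth_chart[OF c])
        then have "smooth_on halfspace (snd c ` (fst c \<inter> U)) (G c \<circ> coord_inv c)"
          by (subst smooth_on_cong[OF op]) (use GU[OF c] coord_inv_chart[OF c] in auto)
        then show ?thesis using op True p by blast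
      next
        case False
        then have "p \<in> inner_pts N" using cover p chart_open(2)[OF c] by blast
        note op = chart_image_open[OF c inner_open]
        have "smooth_on halfspace (snd c ` (fst c \<inter> inner_pts N)) (v \<circ> coord_inv c)"
          "smooth_on halfspace (snd c ` (fst c \<inter> inner_pts N)) (g c \<circ> coord_inv c)"
          using v_equation metric_g c by (auto simp: solves_v_equation_def smooth_fun_def riemannian_metric_on_def)
        then have "smooth_on halfspace (snd c ` (fst c \<inter> inner_pts N)) (\<lambda>y. exp (2 * (v \<circ> coord_inv c) y) *\<^sub>R (g c \<circ> coord_inv c) y)"
          by (intro smooth_on_scaleR[OF op] smooth_on_exp[OF op] smooth_on_mult[OF op] smooth_on_const[OF op])
        then have "smooth_on halfspace (snd c ` (fst c \<inter> inner_pts N)) (G c \<circ> coord_inv c)"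
          by (subst smooth_on_cong[OF op]) (use coord_inv_chart[OF c] in \<open>auto simp: G_def\<close>)
        then show ?thesis using op \<open>p \<in> inner_pts N\<close> p by blast
      qed
    qed
    fix p assume p: "p \<in> fst c \<inter> topspace (mtop N)"
    have "posdef (G c p)"
    proof (cases "p \<in> U")
      case True
      then have "posdef (h c p)" using riemannian_metric_onD[OF metric_h c] p U(3) by blast
      then show ?thesis using GU[OF c] p True by (simp add: posdef_scaleR)
    next
      case False
      then have "p \<in> inner_pts N" using cover p by blast
      moreover from this have "posdef (g c p)" using riemannian_metric_onD[OF metric_g c] p by blast
      ultimately show ?thesis by (simp add: G_def posdef_scaleR)
    qed
    then show "transpose (G c p) = G c p" "\<forall>w. w \<noteq> 0 \<longrightarrow> 0 < w \<bullet> (G c p *v w)"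
      by (auto simp: posdef_def)
  next
    fix c c' p assume c: "c \<in> atlas N" "c' \<in> atlas N" and p: "p \<in> fst c \<inter> fst c' \<inter> topspace (mtop N)"
    show "G c p = pullback (model N) (\<lambda>q. q) G c c' p"
    proof (cases "p \<in> inner_pts N")
      case True
      then have "g c p = pullback (model N) (\<lambda>q. q) g c c' p"
        using metric_g c p unfolding riemannian_metric_on_def by blast
      moreover have "pullback (model N) (\<lambda>q. q) G c c' p = exp (2 * v p) *\<^sub>R pullback (model N) (\<lambda>q. q) g c c' p"
        by (rule pullback_scaleR) (simp add: G_def True)
      ultimately show ?thesis by (simp add: G_def True)
    next
      case False
      then have "p \<in> W" using cover p U(3) by blast
      then have "h c p = pullback (model N) (\<lambda>q. q) h c c' p"
        using metric_h c p unfolding riemannian_metric_on_def by blast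
      moreover have "pullback (model N) (\<lambda>q. q) G c c' p = pullback (model N) (\<lambda>q. q) h c c' p"
        by (rule pullback_cong) (simp add: G_def False)
      ultimately show ?thesis by (simp add: G_def False)
    qed
  qed
  then have "extends_conformal N (topspace (mtop N)) (\<lambda>p. exp (2 * v p)) g G"
    by (simp add: extends_conformal_def G_def)
  then show ?thesis by (rule exI[of _ G])
qed

text \<open>\<open>extends_conformal\<close> prescribes \<open>G\<close> only at interior points;
  continuity determines it on the boundary.\<close>

lemma extension_eq_h:
  assumes G: "extends_conformal N (topspace (mtop N)) (\<lambda>p. exp (2 * v p)) g G"
    and c: "c \<in> atlas N" and p: "p \<in> fst c \<inter> U"
  shows "G c p = exp (2 * Z p) *\<^sub>R h c p"
proof -
  let ?S = "snd c ` (fst c \<inter> U)" and ?f = "\<lambda>y. (G c \<circ> coord_inv c) y - exp (2 * (Z \<circ> coord_inv c) y) *\<^sub>R (h c \<circ> coord_inv c) y"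
  have "fst c \<inter> topspace (mtop N) = fst c" using chart_open(2)[OF c] by blast
  moreover have "smooth_on halfspace (snd c ` (fst c \<inter> topspace (mtop N))) (G c \<circ> coord_inv c)"
    using G c by (simp add: extends_conformal_def riemannian_metric_on_def)
  ultimately have "smooth_on halfspace (snd c ` fst c) (G c \<circ> coord_inv c)" by simp
  then have "continuous_on ?S (G c \<circ> coord_inv c)"
    by (rule continuous_on_subset[OF smooth_on_continuous_on]) blast
  then have "continuous_on ?S ?f"
    by (intro continuous_on_diff continuous_on_scaleR continuous_on_exp continuous_on_mult continuous_on_const
        smooth_on_continuous_on[OF smooth_chart(4)[OF c]] smooth_on_continuous_on[OF smooth_chart(5)[OF c]])
  then have "?f (snd c p) = 0"
  proof (rule eq_0_on_boundary[OF chart_image_open[OF c U(1)]])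
    show "snd c p \<in> ?S" using p by blast
    fix y assume "y \<in> ?S" "0 < y $ None"
    then obtain q where q: "y = snd c q" "q \<in> fst c \<inter> U \<inter> inner_pts N" using inner_iff[OF c] by auto
    then have "G c q = exp (2 * v q) *\<^sub>R g c q"
      using G c chart_open(2)[OF c] unfolding extends_conformal_def by blast
    then show "?f y = 0" using exp_2v_metric[OF c q(2)] q coord_inv_chart[OF c] by simp
  qed
  then show ?thesis using coord_inv_chart[OF c] p by simp
qed

lemma boundary_patch_chart:
  assumes G: "extends_conformal N (topspace (mtop N)) (\<lambda>p. exp (2 * v p)) g G" and c: "c \<in> atlas N"
  shows "boundary_patch (snd c ` (fst c \<inter> U)) (G c \<circ> coord_inv c) (x \<circ> coord_inv c) (Z \<circ> coord_inv c)
    (v \<circ> coord_inv c) (g c \<circ> coord_inv c)"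
proof -
  let ?S = "snd c ` (fst c \<inter> U)"
  have top: "snd c ` (fst c \<inter> topspace (mtop N)) = snd c ` fst c" using chart_open(2)[OF c] by (simp add: Int_absorb2)
  have "riemannian_metric_on N (topspace (mtop N)) G" using G by (simp add: extends_conformal_def)
  from metric_patch_chart[OF this openin_topspace c]
  interpret G: metric_patch "snd c ` fst c" "G c \<circ> coord_inv c" unfolding top .
  have sub: "?S \<subseteq> snd c ` fst c" by blast
  have pt: "\<exists>p. y = snd c p \<and> p \<in> fst c \<and> p \<in> U \<and> coord_inv c y = p" if "y \<in> ?S" for y
    using that coord_inv_chart[OF c] by auto
  have int_pt: "\<exists>p. y = snd c p \<and> p \<in> fst c \<and> p \<in> U \<and> p \<in> inner_pts N \<and> coord_inv c y = p"
    if "y \<in> ?S" "0 < y $ None" for y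
    using pt[OF that(1)] that(2) inner_iff[OF c] by auto
  have bd_pt: "\<exists>p. y = snd c p \<and> p \<in> fst c \<and> p \<in> U \<and> p \<in> bdry N \<and> coord_inv c y = p"
    if "y \<in> ?S" "y $ None = 0" for y
    using pt[OF that(1)] that(2) bdry_iff[OF c] by auto
  show ?thesis
  proof (intro boundary_patch.intro boundary_patch_axioms.intro)
    show "metric_patch ?S (G c \<circ> coord_inv c)"
    proof
      show "openin (top_of_set halfspace) ?S" by (rule chart_image_open[OF c U(1)])
      show "smooth_on halfspace ?S (G c \<circ> coord_inv c)" using G.smooth_metric sub by (rule smooth_on_subset)
      show "posdef ((G c \<circ> coord_inv c) y)" if "y \<in> ?S" for y using G.posdef_metric that sub by blast
    qed
    show "smooth_on halfspace ?S (x \<circ> coord_inv c)" "smooth_on halfspace ?S (Z \<circ> coord_inv c)"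
      by (rule smooth_chart[OF c])+
    show "(x \<circ> coord_inv c) y = 0" if "y \<in> ?S" "y $ None = 0" for y
      using bd_pt[OF that] x_bdry by auto
    show "0 < (x \<circ> coord_inv c) y" if "y \<in> ?S" "0 < y $ None" for y
      using int_pt[OF that] x_pos U(3) by (auto simp: inner_pts_def)
    show "\<exists>i. pdh i (x \<circ> coord_inv c) y \<noteq> 0" if "y \<in> ?S" "y $ None = 0" for y
    proof -
      from bd_pt[OF that] obtain q where q: "y = snd c q" "q \<in> fst c \<inter> bdry N" by blast
      then show ?thesis using defining c unfolding defining_function_on_def model_eq by blast
    qed
    show "(v \<circ> coord_inv c) y = ln ((x \<circ> coord_inv c) y) + (Z \<circ> coord_inv c) y" if "y \<in> ?S" "0 < y $ None" for y
      using int_pt[OF that] v_formula by (auto simp: Z_def)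
    show "ricci halfspace (g c \<circ> coord_inv c) i j y = - real CARD('m) * (g c \<circ> coord_inv c) y $ i $ j"
      if "y \<in> ?S" "0 < y $ None" for y i j
    proof -
      from int_pt[OF that] obtain q where q: "y = snd c q" "q \<in> fst c \<inter> inner_pts N" "coord_inv c y = q" by blast
      then show ?thesis using einstein[OF c q(2), of i j] by simp
    qed
    show "laplacian halfspace (g c \<circ> coord_inv c) (v \<circ> coord_inv c) y = - real CARD('m)"
      if "y \<in> ?S" "0 < y $ None" for y
    proof -
      from int_pt[OF that] obtain q where q: "y = snd c q" "q \<in> fst c \<inter> inner_pts N" by blast
      then have "- laplacian halfspace (g c \<circ> coord_inv c) (v \<circ> coord_inv c) y = real CARD('m)"
        using v_equation c unfolding solves_v_equation_def model_eq by blast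
      then show ?thesis by simp
    qed
    show "conformal_patch (?S \<inter> {y. 0 < y $ None}) (g c \<circ> coord_inv c) (v \<circ> coord_inv c) (G c \<circ> coord_inv c)"
      unfolding chart_inner_image[OF c]
    proof (intro conformal_patch.intro conformal_patch_axioms.intro)
      have "riemannian_metric_on N (U \<inter> inner_pts N) g"
        by (rule riemannian_metric_on_subset[OF metric_g]) blast
      from metric_patch_chart[OF this openin_Int[OF U(1) inner_open] c]
      show "metric_patch (snd c ` (fst c \<inter> (U \<inter> inner_pts N))) (g c \<circ> coord_inv c)" .
      have "smooth_on halfspace (snd c ` (fst c \<inter> inner_pts N)) (v \<circ> coord_inv c)"
        using v_equation c by (simp add: solves_v_equation_def smooth_fun_def)
      then show "smooth_on halfspace (snd c ` (fst c \<inter> (U \<inter> inner_pts N))) (v \<circ> coord_inv c)"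
        by (rule smooth_on_subset) blast
      fix y assume "y \<in> snd c ` (fst c \<inter> (U \<inter> inner_pts N))"
      then obtain p where "y = snd c p" "p \<in> fst c \<inter> inner_pts N" by blast
      then show "(G c \<circ> coord_inv c) y = exp (2 * (v \<circ> coord_inv c) y) *\<^sub>R (g c \<circ> coord_inv c) y"
        using G c coord_inv_chart[OF c] chart_open(2)[OF c] unfolding extends_conformal_def by auto
    qed
  qed
qed

end

text \<open>The coordinate result applied to the curve \<open>\<Phi> (p, t)\<close> read in the
  chart \<open>c\<close>, which is \<open>F\<close> along the inward axis starting at the boundary
  point.\<close>

lemma T_curv_extension:
  fixes N :: "('a, 3 option) mfd"
  assumes "fg_solution N g gh x \<epsilon> \<Phi> h gx v A B U"
    and G: "extends_conformal N (topspace (mtop N)) (\<lambda>p. exp (2 * v p)) g G"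
    and c: "c \<in> atlas N" and p: "p \<in> fst c \<inter> bdry N"
  shows "T_curv (G c \<circ> coord_inv c) (bcoord (snd c p)) = 3 * B p"
proof -
  interpret fg_solution N g gh x \<epsilon> \<Phi> h gx v A B U by fact
  let ?S = "snd c ` (fst c \<inter> U)" and ?z = "bcoord (snd c p)"
  obtain E F where E: "openin (top_of_set halfspace) E"
    and bE: "\<And>z. bemb z \<in> snd c ` fst c \<Longrightarrow> bemb z \<in> E"
    and FE: "smooth_on halfspace E F"
    and F: "\<And>y. y \<in> E \<Longrightarrow> F y \<in> snd c ` (fst c \<inter> (U \<inter> W))"
    and Fb: "\<And>z. bemb z \<in> E \<Longrightarrow> F (bemb z) = bemb z"
    and F\<Phi>: "\<And>y. y \<in> E \<Longrightarrow> coord_inv c (F y) = \<Phi> (coord_inv c (bemb (bcoord y)), y $ None)"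
    and q: "\<And>y. y \<in> E \<Longrightarrow> coord_inv c (bemb (bcoord y)) \<in> bdry N \<and> y $ None \<in> {0..<\<epsilon>}"
    and flow: "\<And>y i. y \<in> E \<Longrightarrow> (\<Sum>j\<in>UNIV. h c (coord_inv c (F y)) $ i $ j * pdh None F y $ j)
      = pdh i (x \<circ> coord_inv c) (F y)"
    by (rule collar_flow[OF c U(1,2)]) (rule that; assumption)
  have N: "snd c p $ None = 0" using bdry_iff[OF c] p by auto
  have z: "bemb ?z = snd c p" by (rule bemb_bcoord[OF N])
  have zE: "snd c p \<in> E" using bE[of ?z] p unfolding z by blast
  obtain \<delta> where "0 < \<delta>" and \<delta>: "\<And>s. 0 \<le> s \<Longrightarrow> s < \<delta> \<Longrightarrow> snd c p + s *\<^sub>R axis None 1 \<in> E"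
    using halfspace_ray[OF E zE] by blast
  let ?y = "\<lambda>t. snd c p + t *\<^sub>R axis None 1"
  have yE: "?y t \<in> E" if "t \<in> {0..<\<delta>}" for t using \<delta> that by simp
  have bc: "bcoord (?y t) = ?z" for t by (simp add: bcoord_def vec_eq_iff axis_def)
  have yN: "?y t $ None = t" for t by (simp add: N axis_def)
  have inv: "coord_inv c (F (?y t)) = \<Phi> (p, t)" if "t \<in> {0..<\<delta>}" for t
    using F\<Phi>[OF yE[OF that]] coord_inv_chart[OF c] p unfolding bc z yN by simp
  have sm: "smooth_on halfspace E (\<lambda>y. (f \<circ> coord_inv c) (F y))" if "smooth_fun N U f" for f
  proof (rule smooth_on_compose[OF E FE])
    show "smooth_on halfspace ?S (f \<circ> coord_inv c)" using that c by (simp add: smooth_fun_def)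
    show "F ` E \<subseteq> ?S" using F by blast
    show "?S \<subseteq> halfspace" using chart_halfspace[OF c] by blast
  qed
  \<comment> \<open>Along the axis \<open>a k\<close> is the k-th derivative of A on the curve;
    evenness says that it vanishes at 0 for odd k, of which 1 and 3 are used.\<close>
  define a where "a k = (pdh None ^^ k) (\<lambda>y. (A \<circ> coord_inv c) (F y))" for k :: nat
  have sa: "smooth_on halfspace E (a k)" for k
    unfolding a_def by (induction k) (use sm[OF smooth_AB(1)] in \<open>auto intro: smooth_on_pd\<close>)
  have da: "((\<lambda>s. a k (?y s)) has_real_derivative a (Suc k) (?y t)) (at t within {0..<\<delta>})" if "t \<in> {0..<\<delta>}" for k t
    using ray_derivative[OF E yE sa that, of k] by (simp add: has_real_derivative_iff_has_vector_derivative a_def)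
  have a_odd: "a k (?y 0) = 0" if "odd k" for k
  proof -
    have "(right_deriv ^^ k) (\<lambda>t. A (\<Phi> (p, t))) 0 = a k (?y 0)"
      unfolding a_def
      by (rule right_deriv_ray[OF E yE sm[OF smooth_AB(1)]]) (use inv \<open>0 < \<delta>\<close> in auto)
    then show ?thesis using even[of p] p that unfolding even_at_0_def by simp
  qed
  define b1 where "b1 = pdh None (\<lambda>y. (B \<circ> coord_inv c) (F y))"
  have sb: "smooth_on halfspace E b1"
    unfolding b1_def by (rule smooth_on_pd[OF sm[OF smooth_AB(2)]])
  have "T_curv (G c \<circ> coord_inv c) ?z = 3 * (B \<circ> coord_inv c) (bemb ?z)"
  proof (rule T_curv_boundary[OF boundary_patch_chart[OF G c] _ _ \<open>0 < \<delta>\<close>, where c = "\<lambda>t. F (?y t)"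
        and c' = "\<lambda>t. pdh None F (?y t)" and A = "A \<circ> coord_inv c"
        and ?a1.0 = "\<lambda>t. a 1 (?y t)" and ?a2.0 = "\<lambda>t. a 2 (?y t)" and ?b1.0 = "\<lambda>t. b1 (?y t)"])
    show "(Z \<circ> coord_inv c) y = (A \<circ> coord_inv c) y + (B \<circ> coord_inv c) y * (x \<circ> coord_inv c) y ^ 3" for y
      by (simp add: Z_def)
    show "(A \<circ> coord_inv c) y = 0" if "y \<in> ?S" "y $ None = 0" for y
      using that bdry_iff[OF c] coord_inv_chart[OF c] A_bdry by auto
    show "F (?y t) \<in> ?S" if "t \<in> {0..<\<delta>}" for t using F[OF yE[OF that]] by blast
    show "(x \<circ> coord_inv c) (F (?y t)) = t" if "t \<in> {0..<\<delta>}" for t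
    proof -
      have "t \<in> {0..<\<epsilon>}" using q[OF yE[OF that]] unfolding yN by blast
      then show ?thesis using inv[OF that] x_\<Phi> p by simp
    qed
    show "F (?y 0) = bemb ?z" using Fb[of ?z] zE unfolding z by simp
    show "((\<lambda>t. F (?y t)) has_vector_derivative pdh None F (?y t)) (at t within {0..<\<delta>})" if "t \<in> {0..<\<delta>}" for t
      by (rule ray_derivative[OF E yE FE that])
    show "(\<Sum>j\<in>UNIV. (G c \<circ> coord_inv c) (F (?y t)) $ i $ j * pdh None F (?y t) $ j)
        = exp (2 * (Z \<circ> coord_inv c) (F (?y t))) * pdh i (x \<circ> coord_inv c) (F (?y t))"
      if "t \<in> {0..<\<delta>}" for t i
    proof -
      have "coord_inv c (F (?y t)) \<in> fst c \<inter> U"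
        using F[OF yE[OF that]] coord_inv_chart[OF c] by auto
      from extension_eq_h[OF G c this] show ?thesis
        by (simp add: flow[OF yE[OF that], symmetric] sum_distrib_left mult.assoc)
    qed
    show "((\<lambda>s. (A \<circ> coord_inv c) (F (?y s))) has_real_derivative a 1 (?y t)) (at t within {0..<\<delta>})"
      if "t \<in> {0..<\<delta>}" for t using da[OF that, of 0] by (simp add: a_def)
    show "((\<lambda>t. a 1 (?y t)) has_real_derivative a 2 (?y t)) (at t within {0..<\<delta>})"
      if "t \<in> {0..<\<delta>}" for t using da[OF that, of 1] by (simp add: numeral_2_eq_2)
    show "((\<lambda>t. a 2 (?y t)) has_real_derivative 0) (at 0 within {0..<\<delta>})"
    proof -
      have "a (Suc 2) (?y 0) = 0" by (rule a_odd) simp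
      then show ?thesis using da[of 0 2] \<open>0 < \<delta>\<close> by simp
    qed
    show "a 1 (?y 0) = 0" by (rule a_odd) simp
    show "((\<lambda>s. (B \<circ> coord_inv c) (F (?y s))) has_real_derivative b1 (?y t)) (at t within {0..<\<delta>})"
      if "t \<in> {0..<\<delta>}" for t
      using ray_derivative[OF E yE sm[OF smooth_AB(2)] that]
      by (simp add: b1_def has_real_derivative_iff_has_vector_derivative)
    have "((\<lambda>s. b1 (?y s)) has_real_derivative pdh None b1 (?y 0)) (at 0 within {0..<\<delta>})"
      using ray_derivative[where y = "snd c p" and t = 0, OF E yE sb] \<open>0 < \<delta>\<close>
      by (simp add: has_real_derivative_iff_has_vector_derivative)
    then show "((\<lambda>t. b1 (?y t)) \<longlongrightarrow> b1 (?y 0)) (at 0 within {0..<\<delta>})"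
      using DERIV_continuous unfolding continuous_within by blast
  qed
  then show ?thesis using coord_inv_chart[OF c] p unfolding z by simp
qed

subsection \<open>Maximum principle and uniqueness\<close>

text \<open>The induction splits off the row of \<open>k\<close> and passes to the Schur complement \<open>M'\<close>.\<close>

lemma posdef_trace_nonpos:
  fixes M H :: "'i \<Rightarrow> 'i \<Rightarrow> real"
  assumes "finite I" and "\<And>i j. M i j = M j i"
    and "\<And>a. \<exists>i\<in>I. a i \<noteq> 0 \<Longrightarrow> 0 < (\<Sum>i\<in>I. \<Sum>j\<in>I. a i * a j * M i j)"
    and H: "\<And>a. (\<Sum>i\<in>I. \<Sum>j\<in>I. a i * a j * H i j) \<le> 0"
  shows "(\<Sum>i\<in>I. \<Sum>j\<in>I. M i j * H i j) \<le> 0"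
  using assms
proof (induction I arbitrary: M rule: finite_induct)
  case empty
  then show ?case by simp
next
  case (insert k I)
  have ins: "(\<Sum>i\<in>insert k I. \<Sum>j\<in>insert k I. f i j)
      = f k k + (\<Sum>j\<in>I. f k j) + (\<Sum>i\<in>I. f i k) + (\<Sum>i\<in>I. \<Sum>j\<in>I. f i j)" for f :: "'i \<Rightarrow> 'i \<Rightarrow> real"
    using insert.hyps by (simp add: sum.distrib)
  have nk: "i \<noteq> k" if "i \<in> I" for i using that insert.hyps by blast
  define m where "m = M k k"
  have m: "m > 0"
  proof -
    have "0 < (\<Sum>i\<in>insert k I. \<Sum>j\<in>insert k I. (if i = k then 1 else 0) * (if j = k then 1 else 0) * M i j)"
      by (rule insert.prems(2)) auto
    then show ?thesis unfolding ins m_def using nk by (simp cong: sum.cong)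
  qed
  define M' where "M' i j = M i j - M k i * M k j / m" for i j
  have "(\<Sum>i\<in>I. \<Sum>j\<in>I. M' i j * H i j) \<le> 0"
  proof (rule insert.IH)
    show "M' i j = M' j i" for i j using insert.prems(1)[of i j] by (simp add: M'_def mult.commute)
    show "0 < (\<Sum>i\<in>I. \<Sum>j\<in>I. a i * a j * M' i j)" if a: "\<exists>i\<in>I. a i \<noteq> 0" for a
    proof -
      define r where "r = (\<Sum>i\<in>I. a i * M k i)"
      \<comment> \<open>The value at \<open>k\<close> completes the square, so the quadratic form of
        \<open>M\<close> at this vector is that of the Schur complement at \<open>a\<close>.\<close>
      let ?b = "\<lambda>i. if i = k then - r / m else a i"
      have "0 < (\<Sum>i\<in>insert k I. \<Sum>j\<in>insert k I. ?b i * ?b j * M i j)"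
        by (rule insert.prems(2)) (use a nk in auto)
      also have "\<dots> = (r / m)\<^sup>2 * m + (\<Sum>j\<in>I. - r / m * a j * M k j) + (\<Sum>i\<in>I. a i * (- r / m) * M i k)
          + (\<Sum>i\<in>I. \<Sum>j\<in>I. a i * a j * M i j)"
        unfolding ins using nk by (simp add: m_def power2_eq_square cong: sum.cong)
      also have "(\<Sum>j\<in>I. - r / m * a j * M k j) = - r / m * r"
        unfolding r_def sum_distrib_left by (simp add: mult_ac)
      also have "(\<Sum>i\<in>I. a i * (- r / m) * M i k) = - r / m * r"
        unfolding r_def sum_distrib_left by (simp add: mult_ac insert.prems(1)[of _ k])
      also have "(r / m)\<^sup>2 * m + - r / m * r + - r / m * r + (\<Sum>i\<in>I. \<Sum>j\<in>I. a i * a j * M i j)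
          = (\<Sum>i\<in>I. \<Sum>j\<in>I. a i * a j * M i j) - r * r / m"
        using m by (simp add: power2_eq_square field_simps)
      also have "r * r / m = (\<Sum>i\<in>I. \<Sum>j\<in>I. a i * a j * (M k i * M k j / m))"
        unfolding r_def sum_product sum_divide_distrib by (simp add: mult_ac)
      also have "(\<Sum>i\<in>I. \<Sum>j\<in>I. a i * a j * M i j) - \<dots> = (\<Sum>i\<in>I. \<Sum>j\<in>I. a i * a j * M' i j)"
        unfolding sum_subtractf[symmetric] M'_def by (simp add: right_diff_distrib)
      finally show ?thesis .
    qed
    show "(\<Sum>i\<in>I. \<Sum>j\<in>I. a i * a j * H i j) \<le> 0" for a
    proof -
      have "(\<Sum>i\<in>insert k I. \<Sum>j\<in>insert k I. (if i = k then 0 else a i) * (if j = k then 0 else a j) * H i j) \<le> 0"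
        by (rule insert.prems(3))
      then show ?thesis unfolding ins using nk by (simp cong: sum.cong)
    qed
  qed
  \<comment> \<open>The difference between \<open>M\<close> and \<open>M'\<close> is row
    \<open>k\<close> times itself divided by \<open>m\<close>; paired with \<open>H\<close> it is
    the quadratic form of \<open>H\<close> at that row.\<close>
  moreover have "(\<Sum>i\<in>insert k I. \<Sum>j\<in>insert k I. M k i * M k j * H i j) \<le> 0"
    by (rule insert.prems(3))
  then have "(\<Sum>i\<in>insert k I. \<Sum>j\<in>insert k I. M k i * M k j * H i j) / m \<le> 0"
    using m by (simp add: divide_le_0_iff)
  moreover have "(\<Sum>i\<in>insert k I. \<Sum>j\<in>insert k I. M i j * H i j)
      = (\<Sum>i\<in>insert k I. \<Sum>j\<in>insert k I. M k i * M k j * H i j) / m + (\<Sum>i\<in>insert k I. \<Sum>j\<in>insert k I. M' i j * H i j)"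
    unfolding sum_divide_distrib sum.distrib[symmetric] M'_def by (simp add: algebra_simps)
  moreover have "(\<Sum>i\<in>insert k I. \<Sum>j\<in>insert k I. M' i j * H i j) = (\<Sum>i\<in>I. \<Sum>j\<in>I. M' i j * H i j)"
  proof -
    have "M' k j = 0" "M' j k = 0" for j
      using m insert.prems(1)[of j k] by (simp_all add: M'_def m_def)
    then show ?thesis unfolding ins by simp
  qed
  ultimately show ?case by linarith
qed

text \<open>Restriction to a straight line through the maximum. If the second derivative were
  positive, the first derivative, zero at the maximum, would be positive just after it, and the mean
  value theorem would give a larger value.\<close>

lemma hessian_nonpos_at_max:
  fixes f :: "real ^ ('m::finite option) \<Rightarrow> real"
  assumes S: "openin (top_of_set halfspace) S" and y: "y \<in> S" "0 < y $ None" and f: "smooth_on halfspace S f"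
    and max: "\<And>z. z \<in> S \<Longrightarrow> f z \<le> f y"
  shows "(\<Sum>i\<in>UNIV. a $ i * pdh i f y) = 0"
    and "(\<Sum>i\<in>UNIV. \<Sum>j\<in>UNIV. a $ i * a $ j * pdh i (pdh j f) y) \<le> 0"
proof -
  let ?c = "\<lambda>s. y + s *\<^sub>R a"
  have "open (?c -` (S \<inter> {y. 0 < y $ None}))"
    by (intro open_vimage open_halfspace_int[OF S] continuous_intros)
  moreover have "(0::real) \<in> ?c -` (S \<inter> {y. 0 < y $ None})" using y by simp
  ultimately obtain e where e: "e > 0" "ball 0 e \<subseteq> ?c -` (S \<inter> {y. 0 < y $ None})" by (rule openE)
  have cS: "?c s \<in> S" if "s \<in> ball 0 e" for s using that e(2) by blast
  have der: "((\<lambda>s. k (?c s)) has_real_derivative (\<Sum>i\<in>UNIV. a $ i * pdh i k (?c s))) (at s)"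
    if "smooth_on halfspace S k" "s \<in> ball 0 e" for k :: "real ^ ('m option) \<Rightarrow> real" and s
  proof -
    have "(?c has_vector_derivative a) (at s within ball 0 e)" by (auto intro!: derivative_eq_intros)
    from has_vector_derivative_pd[OF smooth_on_differentiable[OF that(1) cS[OF that(2)]] this]
    have "((\<lambda>s. k (?c s)) has_vector_derivative (\<Sum>i\<in>UNIV. a $ i *\<^sub>R pdh i k (?c s))) (at s within ball 0 e)"
      using cS in_halfspace[OF S] by blast
    then show ?thesis
      using at_within_open[OF that(2) open_ball] by (simp add: has_real_derivative_iff_has_vector_derivative)
  qed
  have 0: "(0::real) \<in> ball 0 e" using e(1) by simp
  let ?d = "\<lambda>z. \<Sum>j\<in>UNIV. a $ j * pdh j f z"
  have zero: "?d (?c 0) = 0"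
    by (rule DERIV_local_max[OF der[OF f 0] e(1)]) (use max cS in \<open>auto simp: dist_real_def\<close>)
  then show "(\<Sum>i\<in>UNIV. a $ i * pdh i f y) = 0" by simp
  have sd: "smooth_on halfspace S ?d"
    by (intro smooth_on_sum[OF S] smooth_on_mult[OF S] smooth_on_const[OF S] smooth_on_pd f)
  have d2: "(\<Sum>i\<in>UNIV. a $ i * pdh i ?d y)
      = (\<Sum>i\<in>UNIV. \<Sum>j\<in>UNIV. a $ i * a $ j * pdh i (pdh j f) y)"
  proof -
    note yh = in_halfspace[OF S y(1)]
    have "pdh i ?d y = (\<Sum>j\<in>UNIV. pdh i (\<lambda>z. a $ j * pdh j f z) y)" for i
      by (rule pd_sum[OF yh])
        (intro smooth_on_differentiable[OF _ y(1)] smooth_on_mult[OF S] smooth_on_const[OF S] smooth_on_pd f)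
    moreover have "pdh i (\<lambda>z. a $ j * pdh j f z) y = a $ j * pdh i (pdh j f) y" for i j
      by (rule pd_bounded_linear[OF yh bounded_linear_mult_right smooth_on_differentiable[OF smooth_on_pd[OF f] y(1)]])
    ultimately show ?thesis by (simp add: sum_distrib_left mult.assoc)
  qed
  show "(\<Sum>i\<in>UNIV. \<Sum>j\<in>UNIV. a $ i * a $ j * pdh i (pdh j f) y) \<le> 0"
  proof (rule ccontr)
    assume "\<not> ?thesis"
    then have "0 < (\<Sum>i\<in>UNIV. a $ i * pdh i ?d (?c 0))" using d2 by simp
    from DERIV_pos_inc_right[OF der[OF sd 0] this]
    obtain r where r: "r > 0" "\<And>h. h > 0 \<Longrightarrow> h < r \<Longrightarrow> ?d (?c 0) < ?d (?c (0 + h))" by blast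
    define t where "t = min r e / 2"
    have t: "0 < t" "t < r" "t < e" using r(1) e(1) by (auto simp: t_def)
    obtain s where s: "0 < s" "s < t" "f (?c t) - f (?c 0) = (t - 0) * ?d (?c s)"
      using MVT2[OF t(1), of "\<lambda>s. f (?c s)" "\<lambda>s. ?d (?c s)"] der[OF f] t by auto
    have "0 < ?d (?c s)" using r(2)[of s] s t zero by simp
    then have "f (?c 0) < f (?c t)" using s(3) t(1) by (smt (verit) mult_pos_pos)
    moreover have "f (?c t) \<le> f y" using cS[of t] t max by (auto simp: dist_real_def)
    ultimately show False by simp
  qed
qed

text \<open>At a maximum the gradient vanishes, so only the trace of the second derivatives against
  the positive inverse metric remains.\<close>

lemma (in metric_patch) laplacian_nonpos_at_max:
  assumes y: "y \<in> S" "0 < y $ None" and f: "smooth_on halfspace S f" and max: "\<And>z. z \<in> S \<Longrightarrow> f z \<le> f y"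
  shows "laplacian halfspace \<gamma> f y \<le> 0"
proof -
  have grad: "pdh k f y = 0" for k
  proof -
    have "(\<Sum>i\<in>UNIV. axis k 1 $ i * pdh i f y) = 0"
      by (rule hessian_nonpos_at_max(1)[OF open_S y f max])
    then show ?thesis using sum_axis_scaleR[of k "\<lambda>i. pdh i f y"] by simp
  qed
  have "(\<Sum>i\<in>UNIV. \<Sum>j\<in>UNIV. matrix_inv (\<gamma> y) $ i $ j * pdh i (pdh j f) y) \<le> 0"
  proof (rule posdef_trace_nonpos)
    note p = posdef_matrix_inv[OF posdef_metric[OF y(1)]]
    show "matrix_inv (\<gamma> y) $ i $ j = matrix_inv (\<gamma> y) $ j $ i" for i j by (rule posdef_sym[OF p])
    show "0 < (\<Sum>i\<in>UNIV. \<Sum>j\<in>UNIV. a i * a j * matrix_inv (\<gamma> y) $ i $ j)" if "\<exists>i\<in>UNIV. a i \<noteq> 0" for a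
    proof -
      have "(\<chi> i. a i) \<noteq> 0" using that by (auto simp: vec_eq_iff)
      then have "0 < (\<chi> i. a i) \<bullet> (matrix_inv (\<gamma> y) *v (\<chi> i. a i))" using p unfolding posdef_def by blast
      then show ?thesis by (simp add: inner_vec_def matrix_vector_mult_def sum_distrib_left mult_ac)
    qed
    show "(\<Sum>i\<in>UNIV. \<Sum>j\<in>UNIV. a i * a j * pdh i (pdh j f) y) \<le> 0" for a
      using hessian_nonpos_at_max(2)[OF open_S y f max, of "\<chi> i. a i"] by simp
  qed simp
  then show ?thesis by (simp add: laplacian_def grad)
qed

lemma laplacian_lincomb:
  assumes S: "openin (top_of_set halfspace) S" "y \<in> S" and f: "smooth_on halfspace S f" and k: "smooth_on halfspace S k"
  shows "laplacian halfspace \<gamma> (\<lambda>z. r * f z - k z) y = r * laplacian halfspace \<gamma> f y - laplacian halfspace \<gamma> k y"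
proof -
  have lin: "pdh i (\<lambda>z. r * f z - k z) w = r * pdh i f w - pdh i k w"
    if "w \<in> S" "smooth_on halfspace S f" "smooth_on halfspace S k" for i w f k
  proof -
    note wh = in_halfspace[OF S(1) that(1)] and diff = smooth_on_differentiable[OF _ that(1)]
    have "pdh i (\<lambda>z. r * f z - k z) w = pdh i (\<lambda>z. r * f z) w - pdh i k w"
      by (intro pd_diff[OF wh] diff that smooth_on_mult[OF S(1)] smooth_on_const[OF S(1)])
    also have "pdh i (\<lambda>z. r * f z) w = r * pdh i f w"
      by (rule pd_bounded_linear[OF wh bounded_linear_mult_right diff[OF that(2)]])
    finally show ?thesis .
  qed
  have pp: "pdh i (pdh j (\<lambda>z. r * f z - k z)) y
      = r * pdh i (pdh j f) y - pdh i (pdh j k) y" for i j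
  proof -
    have "pdh i (pdh j (\<lambda>z. r * f z - k z)) y
        = pdh i (\<lambda>z. r * pdh j f z - pdh j k z) y"
      by (rule differentiable_cong_openin(3)[OF S]) (rule lin[OF _ f k])
    then show ?thesis by (simp only: lin[OF S(2) smooth_on_pd[OF f] smooth_on_pd[OF k]])
  qed
  show ?thesis
    unfolding laplacian_def lin[OF S(2) f k] pp
    by (simp add: algebra_simps sum.distrib sum_subtractf sum_distrib_left)
qed

section \<open>Comparison of two solutions on the whole manifold\<close>

lemma (in compact_mfd) continuous_map_chartwise:
  fixes u :: "'a \<Rightarrow> real"
  assumes Q: "openin (mtop N) Q" and u: "\<And>c. c \<in> atlas N \<Longrightarrow> continuous_on (snd c ` (fst c \<inter> Q)) (u \<circ> coord_inv c)"
  shows "continuous_map (subtopology (mtop N) Q) euclideanreal u"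
  unfolding continuous_map
proof (intro conjI allI impI)
  fix V :: "real set" assume V: "openin euclidean V"
  show "openin (subtopology (mtop N) Q) {p \<in> topspace (subtopology (mtop N) Q). u p \<in> V}"
  proof (subst openin_subopen, intro ballI)
    fix p assume p: "p \<in> {p \<in> topspace (subtopology (mtop N) Q). u p \<in> V}"
    then obtain c where c: "c \<in> atlas N" "p \<in> fst c" using chart_cover by auto
    have cQ: "fst c \<inter> Q \<subseteq> topspace (mtop N)" using chart_open(2)[OF c(1)] by blast
    have "continuous_map (subtopology (mtop N) (fst c \<inter> Q)) (top_of_set (snd c ` (fst c \<inter> Q))) (snd c)"
      unfolding continuous_map_in_subtopology
      using continuous_map_from_subtopology_mono[OF chart_continuous[OF c(1)], of "fst c \<inter> Q"] by auto
    moreover have "continuous_map (top_of_set (snd c ` (fst c \<inter> Q))) euclideanreal (u \<circ> coord_inv c)"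
      using u[OF c(1)] by simp
    ultimately have "continuous_map (subtopology (mtop N) (fst c \<inter> Q)) euclideanreal ((u \<circ> coord_inv c) \<circ> snd c)"
      by (rule continuous_map_compose)
    from openin_continuous_map_preimage[OF this V]
    have "openin (subtopology (mtop N) (fst c \<inter> Q)) {q \<in> fst c \<inter> Q. u (coord_inv c (snd c q)) \<in> V}"
      using cQ by (simp add: Int_absorb1 Collect_conj_eq Int_assoc cong: conj_cong)
    moreover have "{q \<in> fst c \<inter> Q. u (coord_inv c (snd c q)) \<in> V} = {q \<in> fst c \<inter> Q. u q \<in> V}"
      using coord_inv_chart[OF c(1)] by auto
    ultimately have "openin (mtop N) {q \<in> fst c \<inter> Q. u q \<in> V}"
      using openin_Int[OF chart_open(1)[OF c(1)] Q] openin_trans_full by force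
    then have "openin (subtopology (mtop N) Q) {q \<in> fst c \<inter> Q. u q \<in> V}"
      using openin_subset_topspace_eq openin_open_subtopology[OF Q] by blast
    moreover have "p \<in> {q \<in> fst c \<inter> Q. u q \<in> V}" using p c by auto
    moreover have "{q \<in> fst c \<inter> Q. u q \<in> V} \<subseteq> {p \<in> topspace (subtopology (mtop N) Q). u p \<in> V}" using cQ by auto
    ultimately show "\<exists>T. openin (subtopology (mtop N) Q) T \<and> p \<in> T
        \<and> T \<subseteq> {p \<in> topspace (subtopology (mtop N) Q). u p \<in> V}" by blast
  qed
qed simp

lemma (in compact_mfd) chartwise_inner:
  assumes "smooth_fun N (inner_pts N) v" "c \<in> atlas N"
  shows "smooth_on halfspace (snd c ` (fst c \<inter> inner_pts N)) (v \<circ> coord_inv c)"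
    "continuous_on (snd c ` (fst c \<inter> inner_pts N)) (v \<circ> coord_inv c)"
proof -
  show "smooth_on halfspace (snd c ` (fst c \<inter> inner_pts N)) (v \<circ> coord_inv c)"
    using assms by (simp add: smooth_fun_def)
  then show "continuous_on (snd c ` (fst c \<inter> inner_pts N)) (v \<circ> coord_inv c)"
    by (rule smooth_on_continuous_on)
qed

text \<open>The right-hand side involves only \<open>gh\<close>, so any two choices of the data give
  the same boundary metric.\<close>

lemma (in fg_solution) extension_bdry:
  assumes G: "extends_conformal N (topspace (mtop N)) (\<lambda>p. exp (2 * v p)) g G"
    and c: "c \<in> atlas N" and p: "p \<in> fst c \<inter> bdry N"
  shows "tang (G c p) = gh (bchart N c) p"
proof -
  have "tang (h c p) = gh (bchart N c) p"
    by (rule collar_flow[OF c U(1,2)]) (use p in blast)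
  moreover have "G c p = h c p"
    using extension_eq_h[OF G c, of p] p U(2) Z_bdry[of p] by auto
  ultimately show ?thesis by simp
qed

text \<open>The perturbation \<open>- \<delta> v\<close> is strictly subharmonic because \<open>\<Delta> v = - n\<close>; it is unbounded
  at the boundary, but only its values on the compact set where \<open>v - v'\<close> is at least half its
  positive value matter.\<close>

lemma fg_solution_le:
  fixes N :: "('a, ('m::finite) option) mfd"
  assumes "fg_solution N g gh x \<epsilon> \<Phi> h gx v A B U" "fg_solution N g gh x' \<epsilon>' \<Phi>' h' gx' v' A' B' U'"
    and p0: "p0 \<in> inner_pts N"
  shows "v p0 \<le> v' p0"
proof (rule ccontr)
  assume less: "\<not> v p0 \<le> v' p0"
  interpret s: fg_solution N g gh x \<epsilon> \<Phi> h gx v A B U by fact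
  interpret s': fg_solution N g gh x' \<epsilon>' \<Phi>' h' gx' v' A' B' U' by fact
  obtain G G' where G: "extends_conformal N (topspace (mtop N)) (\<lambda>p. exp (2 * v p)) g G"
    and G': "extends_conformal N (topspace (mtop N)) (\<lambda>p. exp (2 * v' p)) g G'"
    using s.extension_exists s'.extension_exists by blast
  have sv: "smooth_fun N (inner_pts N) v" "smooth_fun N (inner_pts N) v'"
    using s.v_equation s'.v_equation by (auto simp: solves_v_equation_def)
  define u where "u p = (if p \<in> inner_pts N then v p - v' p else 0)" for p
  \<comment> \<open>Continuity of \<open>u\<close> at the boundary is read off from one diagonal
    component of the two compactified metrics, whose ratio is exp (2 u). The index is tangential, so
    that on the boundary the ratio is 1.\<close>
  fix \<alpha>0 :: 'm
  let ?i = "Some \<alpha>0"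
  have u_eq: "u p = ln (G c p $ ?i $ ?i / G' c p $ ?i $ ?i) / 2" if c: "c \<in> atlas N" and p: "p \<in> fst c" for c p
  proof (cases "p \<in> inner_pts N")
    case True
    have pt: "p \<in> fst c \<inter> topspace (mtop N) \<inter> inner_pts N" using p True s.chart_open(2)[OF c] by blast
    have "0 < g c p $ ?i $ ?i" using posdef_diag[OF riemannian_metric_onD[OF s.metric_g c]] p True by blast
    moreover have "G c p = exp (2 * v p) *\<^sub>R g c p" "G' c p = exp (2 * v' p) *\<^sub>R g c p"
      using G G' c pt unfolding extends_conformal_def by blast+
    ultimately have "G c p $ ?i $ ?i / G' c p $ ?i $ ?i = exp (2 * (v p - v' p))"
      by (simp add: right_diff_distrib exp_diff)
    then show ?thesis using True by (simp add: u_def)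
  next
    case False
    then have b: "p \<in> fst c \<inter> bdry N" using p s.chart_open(2)[OF c] by (auto simp: inner_pts_def)
    have "tang (G c p) $ \<alpha>0 $ \<alpha>0 = tang (G' c p) $ \<alpha>0 $ \<alpha>0"
      using s.extension_bdry[OF G c b] s'.extension_bdry[OF G' c b] by simp
    moreover have "0 < G c p $ ?i $ ?i"
      using posdef_diag[OF riemannian_metric_onD[OF _ c]] G p s.chart_open(2)[OF c] unfolding extends_conformal_def by blast
    ultimately show ?thesis using False by (simp add: u_def tang_def)
  qed
  have cu: "continuous_on (snd c ` fst c) (u \<circ> coord_inv c)" if c: "c \<in> atlas N" for c
  proof -
    have top: "fst c \<inter> topspace (mtop N) = fst c" using s.chart_open(2)[OF c] by blast
    have mp: "metric_patch (snd c ` fst c) (H c \<circ> coord_inv c)" if "extends_conformal N (topspace (mtop N)) f g H" for f H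
      using s.metric_patch_chart[OF _ openin_topspace c, of H] that unfolding extends_conformal_def top by blast
    have cont: "continuous_on (snd c ` fst c) (\<lambda>y. (H c \<circ> coord_inv c) y $ ?i $ ?i)"
      "y \<in> snd c ` fst c \<Longrightarrow> 0 < (H c \<circ> coord_inv c) y $ ?i $ ?i"
      if "extends_conformal N (topspace (mtop N)) f g H" for f H y
      using smooth_on_continuous_on[OF metric_patch.smooth_comp[OF mp[OF that]]]
        posdef_diag[OF metric_patch.posdef_metric[OF mp[OF that]]] by blast+
    have "continuous_on (snd c ` fst c)
        (\<lambda>y. ln ((G c \<circ> coord_inv c) y $ ?i $ ?i / (G' c \<circ> coord_inv c) y $ ?i $ ?i) / 2)"
      by (intro continuous_on_divide continuous_on_ln continuous_on_const cont(1)[OF G] cont(1)[OF G'] ballI)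
        (use cont(2)[OF G] cont(2)[OF G'] in \<open>fastforce dest: less_imp_neq\<close>)+
    then show ?thesis
    proof (rule continuous_on_eq)
      fix y assume "y \<in> snd c ` fst c"
      from u_eq[OF c s.chart_coord_inv(2)[OF this]]
      show "ln ((G c \<circ> coord_inv c) y $ ?i $ ?i / (G' c \<circ> coord_inv c) y $ ?i $ ?i) / 2 = (u \<circ> coord_inv c) y" by simp
    qed
  qed
  have contu: "continuous_map (mtop N) euclideanreal u"
    using s.continuous_map_chartwise[OF openin_topspace, of u] cu s.chart_open(2)
    by (simp add: Int_absorb2 subtopology_topspace)
  have contv: "continuous_map (subtopology (mtop N) (inner_pts N)) euclideanreal v"
    by (rule s.continuous_map_chartwise[OF s.inner_open s.chartwise_inner(2)[OF sv(1)]])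
  define m where "m = u p0"
  have m: "m > 0" using less p0 by (simp add: m_def u_def)
  define K where "K = {p \<in> topspace (mtop N). m / 2 \<le> u p}"
  have Ksub: "K \<subseteq> inner_pts N" using m by (auto simp: K_def u_def)
  have "closedin (mtop N) {p \<in> topspace (mtop N). u p \<in> {m/2..}}"
    by (rule closedin_continuous_map_preimage[OF contu]) simp
  then have "closedin (mtop N) K" by (simp add: K_def)
  moreover have "compact_space (mtop N)" using s.mfd by (simp add: compact_manifold_with_boundary_def)
  ultimately have "compactin (mtop N) K" using closedin_compact_space by blast
  then have Kc: "compactin (subtopology (mtop N) (inner_pts N)) K" using Ksub by (simp add: compactin_subtopology)
  have p0K: "p0 \<in> K" using p0 m by (auto simp: K_def m_def inner_pts_def)
  have "compact (v ` K)" using image_compactin[OF Kc contv] by simp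
  then obtain C where C: "\<And>p. p \<in> K \<Longrightarrow> \<bar>v p\<bar> \<le> C"
    using compact_imp_bounded bounded_real by (metis imageI)
  \<comment> \<open>Makes the variation of \<delta> v on \<open>K\<close>, at most 2 \<delta> C,
    smaller than m / 2; the summand 1 keeps the denominator positive.\<close>
  define \<delta> where "\<delta> = m / 8 * inverse (C + 1)"
  have C0: "0 \<le> C" using C[OF p0K] by linarith
  have \<delta>: "0 < \<delta>" "2 * \<delta> * C < m / 2"
  proof -
    show "0 < \<delta>" using m C0 by (simp add: \<delta>_def)
    moreover have "C + 1 \<noteq> 0" using C0 by linarith
    then have "\<delta> * (C + 1) = m / 8" by (simp add: \<delta>_def mult.assoc)
    ultimately show "2 * \<delta> * C < m / 2" using m by (simp add: distrib_left)
  qed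
  have "continuous_map (subtopology (mtop N) (inner_pts N)) euclideanreal (\<lambda>p. u p - \<delta> * v p)"
    by (intro continuous_map_diff continuous_map_real_mult_left contv continuous_map_from_subtopology contu)
  from image_compactin[OF Kc this] have "compact ((\<lambda>p. u p - \<delta> * v p) ` K)" by simp
  moreover have "(\<lambda>p. u p - \<delta> * v p) ` K \<noteq> {}" using p0K by blast
  ultimately have "\<exists>s\<in>(\<lambda>p. u p - \<delta> * v p) ` K. \<forall>t\<in>(\<lambda>p. u p - \<delta> * v p) ` K. t \<le> s"
    by (rule compact_attains_sup)
  then obtain q where q: "q \<in> K" and qmax: "\<And>p. p \<in> K \<Longrightarrow> u p - \<delta> * v p \<le> u q - \<delta> * v q"
    by blast
  \<comment> \<open>The strict inequality puts the maximum point in an open subset \<open>Q\<close>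
    of \<open>K\<close>, where the maximum over \<open>K\<close> is a local one.\<close>
  have uq: "m / 2 < u q"
  proof -
    have "- C \<le> v q" "v p0 \<le> C" using C[OF q] C[OF p0K] by linarith+
    then have "\<delta> * - C \<le> \<delta> * v q" "\<delta> * v p0 \<le> \<delta> * C"
      using \<delta>(1) by (simp_all only: mult_le_cancel_left_pos)
    then show ?thesis using qmax[OF p0K] \<delta>(2) unfolding m_def[symmetric] by simp
  qed
  define Q where "Q = inner_pts N \<inter> {p \<in> topspace (mtop N). u p \<in> {m/2<..}}"
  have Q: "openin (mtop N) Q"
    unfolding Q_def by (intro openin_Int s.inner_open openin_continuous_map_preimage[OF contu]) simp
  have QK: "Q \<subseteq> K" by (auto simp: Q_def K_def)
  have qQ: "q \<in> Q" using q uq Ksub by (auto simp: Q_def K_def)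
  then obtain c where c: "c \<in> atlas N" "q \<in> fst c" using s.chart_cover by (auto simp: Q_def)
  let ?S = "snd c ` (fst c \<inter> Q)" and ?f = "\<lambda>y. (1 - \<delta>) * (v \<circ> coord_inv c) y - (v' \<circ> coord_inv c) y"
  have QI: "Q \<subseteq> inner_pts N" by (auto simp: Q_def)
  have sub: "?S \<subseteq> snd c ` (fst c \<inter> inner_pts N)" using QI by blast
  have op: "openin (top_of_set halfspace) ?S" by (rule s.chart_image_open[OF c(1) Q])
  have sm: "smooth_on halfspace ?S (v \<circ> coord_inv c)" "smooth_on halfspace ?S (v' \<circ> coord_inv c)"
    using s.chartwise_inner(1)[OF sv(1) c(1)] s.chartwise_inner(1)[OF sv(2) c(1)] sub smooth_on_subset by blast+
  have qS: "snd c q \<in> ?S" using c qQ by blast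
  have qI: "q \<in> fst c \<inter> inner_pts N" using c qQ QI by blast
  have "metric_patch ?S (g c \<circ> coord_inv c)"
    by (rule s.metric_patch_chart[OF riemannian_metric_on_subset[OF s.metric_g QI] Q c(1)])
  then have "laplacian halfspace (g c \<circ> coord_inv c) ?f (snd c q) \<le> 0"
  proof (rule metric_patch.laplacian_nonpos_at_max[OF _ qS])
    show "0 < snd c q $ None" using s.inner_iff[OF c] qI by blast
    show "smooth_on halfspace ?S ?f"
      by (intro smooth_on_diff[OF op] smooth_on_mult[OF op] smooth_on_const[OF op] sm)
    fix z assume "z \<in> ?S"
    then obtain r where r: "r \<in> fst c" "r \<in> Q" "z = snd c r" by blast
    have f: "?f (snd c p) = u p - \<delta> * v p" if "p \<in> fst c" "p \<in> Q" for p
      using that QI s.coord_inv_chart[OF c(1)] by (auto simp: u_def algebra_simps)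
    show "?f z \<le> ?f (snd c q)"
      unfolding r(3) f[OF r(1,2)] f[OF c(2) qQ] using qmax QK r(2) by blast
  qed
  \<comment> \<open>(1 - \<delta>) (- n) + n = n \<delta> is positive, against the sign at a
    maximum.\<close>
  moreover have "laplacian halfspace (g c \<circ> coord_inv c) ?f (snd c q) = real CARD('m) * \<delta>"
  proof -
    have "- laplacian halfspace (g c \<circ> coord_inv c) (v \<circ> coord_inv c) (snd c q) = real CARD('m)"
      "- laplacian halfspace (g c \<circ> coord_inv c) (v' \<circ> coord_inv c) (snd c q) = real CARD('m)"
      using s.v_equation s'.v_equation c(1) qI unfolding solves_v_equation_def s.model_eq by blast+
    then have "laplacian halfspace (g c \<circ> coord_inv c) (v \<circ> coord_inv c) (snd c q) = - real CARD('m)"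
      "laplacian halfspace (g c \<circ> coord_inv c) (v' \<circ> coord_inv c) (snd c q) = - real CARD('m)" by linarith+
    then show ?thesis
      unfolding laplacian_lincomb[OF op qS sm] by (simp add: algebra_simps)
  qed
  ultimately show False using \<delta>(1) by (simp add: mult_le_0_iff)
qed

text \<open>Three applications of the functional equation lead from - 3/2 to 3/2 with product (-
  3/2) (- 1/2) (1/2) = 3/8, and 8 * 3/8 = 3. The fact \<open>half\<close> keeps the half-integers
  away from the poles.\<close>

lemma k_const_3: "k_const 3 = 3"
proof -
  have half: "r \<notin> \<int>\<^sub>\<le>\<^sub>0" if "r * 2 = of_int (2 * k + 1)" for r :: real and k
  proof
    assume "r \<in> \<int>\<^sub>\<le>\<^sub>0"
    then obtain n where "r = of_int n" by (rule nonpos_Ints_cases)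
    then have "(of_int (n * 2) :: real) = of_int (2 * k + 1)" using that by simp
    then have "n * 2 = 2 * k + 1" by (simp only: of_int_eq_iff)
    then show False by presburger
  qed
  have "Gamma (3/2 :: real) = 1/2 * Gamma (1/2)"
    using Gamma_plus1[OF half[of "1/2" 0]] by simp
  moreover have "Gamma (1/2 :: real) = -(1/2) * Gamma (-(1/2))"
    using Gamma_plus1[OF half[of "-(1/2)" "-1"]] by simp
  moreover have "Gamma (-(1/2) :: real) = -(3/2) * Gamma (-(3/2))"
    using Gamma_plus1[OF half[of "-(3/2)" "-2"]] by simp
  moreover have "Gamma (1/2 :: real) \<noteq> 0" by (rule less_imp_neq[OF Gamma_real_pos, symmetric]) simp
  ultimately have "Gamma (3/2 :: real) = 3/8 * Gamma (-(3/2))" "Gamma (-(3/2) :: real) \<noteq> 0" by auto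
  then show ?thesis by (simp add: k_const_def field_simps)
qed

theorem lemma2p2:
  fixes N :: "('a, 3 option) mfd"
    and g :: "('a, 3 option) tensor2"
    and gh :: "('a, 3) tensor2"
    and x v A B :: "'a \<Rightarrow> real"
    and \<epsilon> :: real
    and \<Phi> :: "'a \<times> real \<Rightarrow> 'a"
  assumes "conformally_compact_einstein N g"
    and "gh \<in> conformal_infinity N g"
    and "special_defining_function N g gh x \<epsilon> \<Phi>"
    and "solves_v_equation N g v"
    and "v_expansion N x \<epsilon> \<Phi> v A B"
  shows "(\<exists>G. extends_conformal N (topspace (mtop N)) (\<lambda>p. exp (2 * v p)) g G) \<and>
    (\<forall>G. extends_conformal N (topspace (mtop N)) (\<lambda>p. exp (2 * v p)) g G \<longrightarrow>
      (\<forall>c\<in>atlas N. \<forall>p\<in>fst c \<inter> bdry N.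
         T_curv (G c \<circ> coord_inv c) (bcoord (snd c p)) = 3 * B p \<and>
         3 * B p = FG_Q N g gh p))"
proof -
  obtain h gx U where sol: "fg_solution N g gh x \<epsilon> \<Phi> h gx v A B U"
    using fg_solutionI[OF assms(1,3,4,5)] by blast
  have "FG_Q N g gh p = 3 * B p" if c: "c \<in> atlas N" and p: "p \<in> fst c \<inter> bdry N" for c p
  proof -
    have "(THE b. \<exists>x \<epsilon> \<Phi> v A B. special_defining_function N g gh x \<epsilon> \<Phi> \<and> solves_v_equation N g v \<and>
               v_expansion N x \<epsilon> \<Phi> v A B \<and> b = B p) = B p"
    proof (rule the_equality)
      show "\<exists>x \<epsilon> \<Phi> v A B'. special_defining_function N g gh x \<epsilon> \<Phi> \<and> solves_v_equation N g v \<and>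
               v_expansion N x \<epsilon> \<Phi> v A B' \<and> B p = B' p"
        using assms(3-5) by blast
      fix b assume "\<exists>x \<epsilon> \<Phi> v A B. special_defining_function N g gh x \<epsilon> \<Phi> \<and> solves_v_equation N g v \<and>
               v_expansion N x \<epsilon> \<Phi> v A B \<and> b = B p"
      then obtain x' \<epsilon>' \<Phi>' v' A' B' where *: "special_defining_function N g gh x' \<epsilon>' \<Phi>'"
        "solves_v_equation N g v'" "v_expansion N x' \<epsilon>' \<Phi>' v' A' B'" "b = B' p" by blast
      obtain h' gx' U' where sol': "fg_solution N g gh x' \<epsilon>' \<Phi>' h' gx' v' A' B' U'"
        using fg_solutionI[OF assms(1) *(1-3)] by blast
      \<comment> \<open>Equal functions \<open>v\<close> have the same extensions \<open>G\<close>.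
        The curvature T of \<open>G\<close> mentions neither \<open>x\<close> nor
        \<open>\<Phi>\<close>, so computing it from both sets of data equates the two values of
        B.\<close>
      have vv: "v' q = v q" if "q \<in> inner_pts N" for q
        using fg_solution_le[OF sol sol' that] fg_solution_le[OF sol' sol that] by simp
      obtain G where G: "extends_conformal N (topspace (mtop N)) (\<lambda>p. exp (2 * v p)) g G"
        using fg_solution.extension_exists[OF sol] by blast
      then have G': "extends_conformal N (topspace (mtop N)) (\<lambda>p. exp (2 * v' p)) g G"
        using vv by (simp add: extends_conformal_def)
      show "b = B p"
        using T_curv_extension[OF sol G c p] T_curv_extension[OF sol' G' c p] *(4) by simp
    qed
    then show ?thesis by (simp add: FG_Q_def k_const_3)
  qed
  then show ?thesis
    using fg_solution.extension_exists[OF sol] T_curv_extension[OF sol] by simp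
qed

end
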